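(* Let $\mathbb{D}$ be a division ring with finite dimension $d$ over a central subfield $\mathbb{F}$, and let $n\geq 1$. Assume that $\mathbb{D}$ is not of quadratic type over $\mathbb{F}$, and that $|\mathbb{F}|\geq nd$. Then, up to equivalence, there is exactly one optimal unital $\mathbb{F}$-affine subspace of $\mathrm{M}_n(\mathbb{D})$.
   Context: A central subfield of $\mathbb{D}$ is a subfield contained in the center of $\mathbb{D}$. A subset of $\mathrm{M}_n(\mathbb{D})$ is called unital if it is contained in $\mathrm{GL}_n(\mathbb{D})$. A unital $\mathbb{F}$-affine subspace of $\mathrm{M}_n(\mathbb{D})$ is optimal if it has the greatest possible dimension over $\mathbb{F}$ among all unital $\mathbb{F}$-affine subspaces of $\mathrm{M}_n(\mathbb{D})$. Two subsets $\mathcal{S},\mathcal{T}$ of $\mathrm{M}_n(\mathbb{D})$ are equivalent if $\mathcal{T}=P\mathcal{S}Q$ for some $P,Q\in\mathrm{GL}_n(\mathbb{D})$. $\mathbb{D}$ is of quadratic type over $\mathbb{F}$ if one of the following holds: (i) $d=1$; (ii) $d=2$ and $\mathbb{D}$ is a separable field extension of $\mathbb{F}$; (iii) $d=4$ and $\mathbb{D}$ is a quaternion algebra over $\mathbb{F}$; (iv) $d=2^m$ for some $m\geq 1$, $\operatorname{char}(\mathbb{F})=2$, $\mathbb{D}$ is a field and $x^2\in\mathbb{F}$ for all $x\in\mathbb{D}$. *)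

theory Defs
  imports "HOL-Analysis.Analysis" "HOL-Computational_Algebra.Computational_Algebra"
begin

text \<open>
  A central subfield of a division ring is given by a field type \<open>'f\<close> together with
  its inclusion \<open>\<iota> :: 'f \<Rightarrow> 'd\<close>; the subfield itself is \<open>range \<iota>\<close>. Since \<open>'f\<close> is a field,
  the homomorphism \<open>\<iota>\<close> is automatically injective. Having the scalars as a type makes the
  library locale \<^locale>\<open>vector_space\<close> applicable.
\<close>

definition ring_center :: "'d::ring set" where
  "ring_center = {z. \<forall>x. z * x = x * z}"

definition central_subfield :: "('f::field \<Rightarrow> 'd::division_ring) \<Rightarrow> bool" where
  "central_subfield \<iota> \<longleftrightarrow>
     \<iota> 1 = 1 \<and> (\<forall>a b. \<iota> (a + b) = \<iota> a + \<iota> b) \<and> (\<forall>a b. \<iota> (a * b) = \<iota> a * \<iota> b) \<and>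
     range \<iota> \<subseteq> ring_center"

definition scale_ring :: "('f::field \<Rightarrow> 'd::division_ring) \<Rightarrow> 'f \<Rightarrow> 'd \<Rightarrow> 'd" where
  "scale_ring \<iota> c x = \<iota> c * x"

definition scale_mat ::
  "('f::field \<Rightarrow> 'd::division_ring) \<Rightarrow> 'f \<Rightarrow> 'd^'n^'n \<Rightarrow> 'd^'n^'n" where
  "scale_mat \<iota> c M = (\<chi> i j. \<iota> c * M $ i $ j)"

lemma vector_space_scale_ring:
  assumes "central_subfield \<iota>"
  shows "vector_space (scale_ring \<iota>)"
  using assms
  by unfold_locales (auto simp: central_subfield_def scale_ring_def algebra_simps)

lemma vector_space_scale_mat:
  assumes "central_subfield \<iota>"
  shows "vector_space (scale_mat \<iota>)"
  using assms
  by unfold_locales (auto simp: central_subfield_def scale_mat_def algebra_simps vec_eq_iff)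

subsection \<open>Division rings of quadratic type\<close>

definition commutative_ring :: "'d::division_ring itself \<Rightarrow> bool" where
  "commutative_ring _ \<longleftrightarrow> (\<forall>x y :: 'd. x * y = y * x)"

text \<open>The library's \<^const>\<open>poly\<close> needs commutative coefficients, whence an explicit evaluation.\<close>

definition eval_over ::
  "('f::field \<Rightarrow> 'd::division_ring) \<Rightarrow> 'f poly \<Rightarrow> 'd \<Rightarrow> 'd" where
  "eval_over \<iota> p x = (\<Sum>i\<le>degree p. \<iota> (coeff p i) * x ^ i)"

text \<open>
  The polynomial \<open>p\<close> below is, up to a unit, the minimal polynomial of \<open>x\<close>.
\<close>

definition separable_field_extension :: "('f::field \<Rightarrow> 'd::division_ring) \<Rightarrow> bool" where
  "separable_field_extension \<iota> \<longleftrightarrow>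
     commutative_ring TYPE('d) \<and>
     (\<forall>x. \<exists>p. irreducible p \<and> eval_over \<iota> p x = 0 \<and> coprime p (pderiv p))"

definition two_sided_ideal :: "'d::ring set \<Rightarrow> bool" where
  "two_sided_ideal I \<longleftrightarrow>
     0 \<in> I \<and> (\<forall>x\<in>I. \<forall>y\<in>I. x - y \<in> I) \<and> (\<forall>r. \<forall>x\<in>I. r * x \<in> I \<and> x * r \<in> I)"

text \<open>
  A quaternion algebra is a central simple algebra of dimension 4 (in any characteristic).
  Simplicity is automatic for division rings.
\<close>

definition quaternion_algebra :: "('f::field \<Rightarrow> 'd::division_ring) \<Rightarrow> bool" where
  "quaternion_algebra \<iota> \<longleftrightarrow>
     ring_center = range \<iota> \<and>
     (\<forall>I :: 'd set. two_sided_ideal I \<longrightarrow> I = {0} \<or> I = UNIV) \<and>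
     vector_space.dim (scale_ring \<iota>) (UNIV :: 'd set) = 4"

definition quadratic_type :: "('f::field \<Rightarrow> 'd::division_ring) \<Rightarrow> bool" where
  "quadratic_type \<iota> \<longleftrightarrow>
     (let d = vector_space.dim (scale_ring \<iota>) (UNIV :: 'd set) in
       d = 1 \<or>
       (d = 2 \<and> separable_field_extension \<iota>) \<or>
       (d = 4 \<and> quaternion_algebra \<iota>) \<or>
       ((\<exists>m\<ge>1. d = 2 ^ m) \<and> CHAR('f) = 2 \<and> commutative_ring TYPE('d) \<and>
         (\<forall>x. x ^ 2 \<in> range \<iota>)))"

subsection \<open>Unital affine subspaces of matrices\<close>

text \<open>Affine subspaces are nonempty: they are the translates of linear subspaces.\<close>

definition affine_subspace_mat ::
  "('f::field \<Rightarrow> 'd::division_ring) \<Rightarrow> ('d^'n^'n) set \<Rightarrow> bool" where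
  "affine_subspace_mat \<iota> S \<longleftrightarrow>
     (\<exists>A V. module.subspace (scale_mat \<iota>) V \<and> S = (\<lambda>M. A + M) ` V)"

text \<open>The set of differences of an affine subspace is its translation vector space.\<close>

definition affine_dim_mat ::
  "('f::field \<Rightarrow> 'd::division_ring) \<Rightarrow> ('d^'n^'n) set \<Rightarrow> nat" where
  "affine_dim_mat \<iota> S = vector_space.dim (scale_mat \<iota>) {M - N | M N. M \<in> S \<and> N \<in> S}"

definition unital :: "('d::division_ring^'n^'n) set \<Rightarrow> bool" where
  "unital S \<longleftrightarrow> S \<subseteq> {M. invertible M}"

definition optimal_unital_affine ::
  "('f::field \<Rightarrow> 'd::division_ring) \<Rightarrow> ('d^'n^'n) set \<Rightarrow> bool" where
  "optimal_unital_affine \<iota> S \<longleftrightarrow>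
     affine_subspace_mat \<iota> S \<and> unital S \<and>
     (\<forall>T :: ('d^'n^'n) set. affine_subspace_mat \<iota> T \<and> unital T \<longrightarrow> affine_dim_mat \<iota> T \<le> affine_dim_mat \<iota> S)"

definition equivalent_mat_sets ::
  "('d::division_ring^'n^'n) set \<Rightarrow> ('d^'n^'n) set \<Rightarrow> bool" where
  "equivalent_mat_sets S T \<longleftrightarrow>
     (\<exists>P Q :: 'd^'n^'n. invertible P \<and> invertible Q \<and> T = (\<lambda>M. P ** M ** Q) ` S)"

end

theory Submission
  imports Defs
begin

text \<open>
  After multiplication by an invertible matrix, a unital affine subspace is \<open>I + W\<close>, where no matrix in the
  linear space \<open>W\<close> fixes a nonzero column. Let \<open>z\<close> be a column for which \<open>W z\<close> has the greatest
  dimension. Since the field is large, every \<open>N\<close> in \<open>W\<close> with \<open>N z = 0\<close> maps all columns into \<open>W z\<close>,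
  hence into a \<open>D\<close>-hyperplane that misses \<open>z\<close>. So these \<open>N\<close> form a space of the same kind in size \<open>n - 1\<close>,
  which bounds the dimension of \<open>W\<close> by induction and, in the optimal case, makes the annihilator of \<open>z\<close>
  triangular in a suitable basis. It remains to see that the last row of \<open>W\<close> vanishes left of the diagonal, and
  this reduces to \<open>2 \<times> 2\<close> matrices. There, a lower left entry \<open>b l h\<close> depending linearly on the last column
  \<open>(l, h)\<close> and not identically zero would lead to a linear bijection \<open>\<kappa>\<close> of \<open>D\<close> and to linear forms
  \<open>f\<^sub>1\<close>, \<open>f\<^sub>2\<close> with \<open>f\<^sub>1 (\<kappa> (h y) y) = 0\<close> whenever \<open>f\<^sub>2 h = 0\<close>. Polarizing this identity
  shows that every element of \<open>D\<close> is quadratic over the field, which means that \<open>D\<close> is of quadratic type.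
\<close>

subsection \<open>Linear algebra over the central subfield\<close>

text \<open>Entries need not commute, so eigenvalues are counted not by a characteristic polynomial
  but by the linear independence of eigenvectors of a pencil. Such a pencil lives on a space of
  dimension at most \<open>n * d - 1\<close> and is tested against one scalar more than that
  dimension; this is the origin of the bound \<open>n * d\<close> on the size of the field. The
  optimal dimension is the sum of \<open>j * d - 1\<close> for \<open>j = 1, ..., n\<close>: column
  \<open>j\<close> of a triangular matrix has \<open>j\<close> entries, the diagonal one being
  confined to a hyperplane over the scalars that misses 1. These hyperplanes may vary along the
  diagonal, but all choices are equivalent, because every linear form on \<open>D\<close> is a fixed
  one preceded by a left multiplication. The obstacle is that the induction only controls the
  matrices that kill \<open>z\<close>. For the others, the last row left of the diagonal is a linear
  function of the last column, and excluding a nonzero function is where an element that is not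
  quadratic is needed.\<close>

lemma (in finite_dimensional_vector_space) exists_linear_complement:
  assumes K: "subspace K" and V: "subspace V" and KV: "K \<subseteq> V"
  obtains U where "subspace U" "U \<subseteq> V" "U \<inter> K = {0}" "dim V = dim U + dim K"
    "\<And>v. v \<in> V \<Longrightarrow> \<exists>u\<in>U. v - u \<in> K"
proof -
  obtain B where B: "B \<subseteq> K" "independent B" "K \<subseteq> span B" "card B = dim K"
    using basis_exists by blast
  obtain C where C: "B \<subseteq> C" "C \<subseteq> V" "independent C" "V \<subseteq> span C"
    using maximal_independent_subset_extend[of B V] B KV by blast
  have finC: "finite C" using C(3) finiteI_independent by blast
  have spB: "span B = K" using B span_minimal[OF _ K] by (simp add: subset_antisym)
  have spC: "span C = V" using C span_minimal[OF _ V] by (simp add: subset_antisym)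
  have CB: "B \<union> (C - B) = C" using C(1) by blast
  have indep: "independent (C - B)" using C(3) independent_mono by blast
  have sum: "V = {x + y |x y. x \<in> K \<and> y \<in> span (C - B)}"
    using span_Un[of B "C - B"] unfolding CB spB spC by simp
  have dims: "dim V = dim (span (C - B)) + dim K"
  proof -
    have "dim V = card C" using C(2-4) basis_card_eq_dim by metis
    also have "\<dots> = card (C - B) + card B"
      using C(1) finC by (metis add.commute card_Diff_subset card_mono finite_subset le_add_diff_inverse)
    finally show ?thesis using indep B(4) by (simp add: dim_eq_card_independent)
  qed
  have "span (C - B) \<inter> K = {0}"
  proof -
    have "dim {x + y |x y. x \<in> span (C - B) \<and> y \<in> K} + dim (span (C - B) \<inter> K)
        = dim (span (C - B)) + dim K"
      by (rule dim_sums_Int) (use K in auto)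
    moreover have "{x + y |x y. x \<in> span (C - B) \<and> y \<in> K} = V"
      unfolding sum by (auto; metis add.commute)
    ultimately have "dim (span (C - B) \<inter> K) = 0" using dims by simp
    then show ?thesis using K by (auto simp: span_zero subspace_0)
  qed
  moreover have "\<exists>u\<in>span (C - B). v - u \<in> K" if "v \<in> V" for v
    using that unfolding sum by (auto; metis add_diff_cancel_right')
  moreover have "span (C - B) \<subseteq> V" using C(2) span_minimal[of "C - B" V] V by blast
  ultimately show thesis using that[of "span (C - B)"] dims by blast
qed

context finite_dimensional_vector_space_pair_1
begin

lemma rank_nullity:
  assumes V: "vs1.subspace V" and f: "Vector_Spaces.linear s1 s2 f"
  shows "vs1.dim V = vs2.dim (f ` V) + vs1.dim {v \<in> V. f v = 0}"
proof -
  interpret f: Vector_Spaces.linear s1 s2 f by fact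
  have K: "vs1.subspace {v \<in> V. f v = 0}"
    using vs1.subspace_inter[OF V f.subspace_kernel] by (simp add: Collect_conj_eq)
  obtain U where U: "vs1.subspace U" "U \<subseteq> V" "U \<inter> {v \<in> V. f v = 0} = {0}"
    "vs1.dim V = vs1.dim U + vs1.dim {v \<in> V. f v = 0}"
    "\<And>v. v \<in> V \<Longrightarrow> \<exists>u\<in>U. v - u \<in> {v \<in> V. f v = 0}"
    using vs1.exists_linear_complement[OF K V] by blast
  have "f ` V = f ` U"
  proof
    show "f ` V \<subseteq> f ` U"
    proof
      fix y assume "y \<in> f ` V"
      then obtain v where "v \<in> V" "y = f v" by blast
      moreover from this obtain u where "u \<in> U" "f (v - u) = 0" using U(5) by blast
      ultimately show "y \<in> f ` U" by (auto simp: f.diff)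
    qed
  qed (use U(2) in blast)
  moreover have "vs2.dim (f ` U) = vs1.dim U"
  proof (rule dim_image_eq[OF f])
    have "vs1.span U = U" using U(1) vs1.span_eq_iff by blast
    moreover have "\<forall>x\<in>U. f x = 0 \<longrightarrow> x = 0" using U(2,3) by blast
    ultimately show "inj_on f (vs1.span U)" using f.inj_on_iff_eq_0[OF U(1)] by metis
  qed
  ultimately show ?thesis using U(4) by simp
qed

text \<open>The usual induction for eigenvectors of distinct eigenvalues, with a second map
  \<open>A\<close> in place of the identity and everything read modulo \<open>N\<close>; injectivity
  of \<open>A\<close> modulo \<open>N\<close> allows it to be cancelled. Speaking of vanishing sums
  rather than of fixed vectors lets the induction rescale the terms.\<close>

lemma pencil_eigenvectors_zero:
  assumes U: "vs1.subspace U" and N: "vs2.subspace N"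
    and A: "Vector_Spaces.linear s1 s2 A" and B: "Vector_Spaces.linear s1 s2 B"
    and inj: "\<And>u. u \<in> U \<Longrightarrow> A u \<in> N \<Longrightarrow> u = 0"
    and "finite \<Lambda>" and "\<And>c. c \<in> \<Lambda> \<Longrightarrow> u c \<in> U" and "\<And>c. c \<in> \<Lambda> \<Longrightarrow> B (u c) - s2 c (A (u c)) \<in> N"
    and "(\<Sum>c\<in>\<Lambda>. u c) = 0" and "c \<in> \<Lambda>"
  shows "u c = 0"
  using assms(6-10)
proof (induction \<Lambda> arbitrary: u c rule: finite_induct)
  case (insert a L)
  interpret A: Vector_Spaces.linear s1 s2 A by fact
  interpret B: Vector_Spaces.linear s1 s2 B by fact
  let ?w = "\<lambda>c. s1 (c - a) (u c)"
  have ua: "u a = - (\<Sum>c\<in>L. u c)"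
    using insert.prems(3) insert.hyps by (simp add: eq_neg_iff_add_eq_0)
  \<comment> \<open>Since the vectors sum to zero, the \<open>B\<close> terms cancel. What remains
    is \<open>A\<close> of a shorter relation with weights \<open>c - a\<close>, which are nonzero
    on \<open>L\<close>.\<close>
  have "(\<Sum>c\<in>L. B (u c) - s2 c (A (u c))) + (B (u a) - s2 a (A (u a))) \<in> N"
    using insert.prems by (intro vs2.subspace_add[OF N] vs2.subspace_sum[OF N]) auto
  also have "(\<Sum>c\<in>L. B (u c) - s2 c (A (u c))) + (B (u a) - s2 a (A (u a))) = - A (\<Sum>c\<in>L. ?w c)"
    unfolding ua A.neg B.neg A.sum B.sum A.scale
    by (simp add: vs2.scale_left_diff_distrib sum_subtractf vs2.scale_sum_right sum_negf)
  finally have "- (- A (\<Sum>c\<in>L. ?w c)) \<in> N" using vs2.subspace_neg[OF N] by blast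
  then have "A (\<Sum>c\<in>L. ?w c) \<in> N" by simp
  then have sum0: "(\<Sum>c\<in>L. ?w c) = 0"
    using inj insert.prems(1) U by (simp add: vs1.subspace_sum vs1.subspace_scale)
  have "?w c = 0" if "c \<in> L" for c
  proof (rule insert.IH[OF _ _ sum0 that])
    fix c assume c: "c \<in> L"
    show "?w c \<in> U" using insert.prems(1) U c by (simp add: vs1.subspace_scale)
    have "B (?w c) - s2 c (A (?w c)) = s2 (c - a) (B (u c) - s2 c (A (u c)))"
      by (simp add: A.scale B.scale vs2.scale_right_diff_distrib vs2.scale_scale mult.commute)
    then show "B (?w c) - s2 c (A (?w c)) \<in> N"
      using insert.prems(2) c vs2.subspace_scale[OF N] by simp
  qed
  then have L: "u c = 0" if "c \<in> L" for c using that insert.hyps(2) by fastforce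
  then have "u a = 0" using ua by simp
  then show ?case using L insert.prems(4) by blast
qed simp

text \<open>Meant for contradiction: if every scalar were an eigenvalue, any
  \<open>dim U + 1\<close> scalars would violate the bound.\<close>

lemma card_pencil_eigenvalues:
  assumes U: "vs1.subspace U" and N: "vs2.subspace N"
    and A: "Vector_Spaces.linear s1 s2 A" and B: "Vector_Spaces.linear s1 s2 B"
    and inj: "\<And>u. u \<in> U \<Longrightarrow> A u \<in> N \<Longrightarrow> u = 0"
    and fin: "finite \<Lambda>" and ev: "\<And>c. c \<in> \<Lambda> \<Longrightarrow> \<exists>u\<in>U. u \<noteq> 0 \<and> B u - s2 c (A u) \<in> N"
  shows "card \<Lambda> \<le> vs1.dim U"
proof -
  interpret A: Vector_Spaces.linear s1 s2 A by fact
  interpret B: Vector_Spaces.linear s1 s2 B by fact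
  obtain u where u: "\<And>c. c \<in> \<Lambda> \<Longrightarrow> u c \<in> U \<and> u c \<noteq> 0 \<and> B (u c) - s2 c (A (u c)) \<in> N"
    using ev by metis
  have zero: "k c = 0" if "(\<Sum>c\<in>\<Lambda>. s1 (k c) (u c)) = 0" "c \<in> \<Lambda>" for k c
  proof -
    have "s1 (k c) (u c) = 0"
    proof (rule pencil_eigenvectors_zero[OF U N A B inj fin _ _ that])
      fix c assume c: "c \<in> \<Lambda>"
      show "s1 (k c) (u c) \<in> U" using u c U by (simp add: vs1.subspace_scale)
      have "B (s1 (k c) (u c)) - s2 c (A (s1 (k c) (u c))) = s2 (k c) (B (u c) - s2 c (A (u c)))"
        by (simp add: A.scale B.scale vs2.scale_right_diff_distrib vs2.scale_scale mult.commute)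
      then show "B (s1 (k c) (u c)) - s2 c (A (s1 (k c) (u c))) \<in> N"
        using u c vs2.subspace_scale[OF N] by simp
    qed
    then show ?thesis using u that(2) by simp
  qed
  have inj_u: "inj_on u \<Lambda>"
  proof (rule inj_onI, rule ccontr)
    fix a b assume ab: "a \<in> \<Lambda>" "b \<in> \<Lambda>" "u a = u b" "a \<noteq> b"
    let ?k = "\<lambda>c. if c = a then 1 else if c = b then - 1 else 0"
    have "(\<Sum>c\<in>\<Lambda>. s1 (?k c) (u c)) = (\<Sum>c\<in>{a,b}. s1 (?k c) (u c))"
      by (rule sum.mono_neutral_right) (use fin ab in auto)
    also have "\<dots> = 0" using ab by simp
    finally show False using zero[of ?k a] ab(1) by simp
  qed
  have "vs1.independent (u ` \<Lambda>)"
    unfolding vs1.independent_explicit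
  proof safe
    fix k c assume k: "(\<Sum>v\<in>u ` \<Lambda>. s1 (k v) v) = 0" and c: "c \<in> \<Lambda>"
    show "k (u c) = 0" using zero[of "\<lambda>c. k (u c)" c] k c by (simp add: sum.reindex[OF inj_u])
  qed (use fin in simp)
  then have "card (u ` \<Lambda>) \<le> vs1.dim U"
    using u by (intro vs1.independent_card_le_dim) auto
  then show ?thesis by (simp add: card_image[OF inj_u])
qed

end

lemma (in vector_space) exists_separating_form:
  assumes H: "subspace H" and v: "v \<notin> H"
  obtains g where "Vector_Spaces.linear scale (*) g" "\<And>x. x \<in> H \<Longrightarrow> g x = 0" "g v = 1"
proof -
  interpret p: vector_space_pair scale "(*)" by unfold_locales
  obtain B where B: "B \<subseteq> H" "independent B" "H \<subseteq> span B" using maximal_independent_subset by blast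
  have sp: "span B = H" using B span_minimal[OF _ H] by (simp add: subset_antisym)
  have "independent (insert v B)" using B v sp by (simp add: independent_insertI)
  then obtain g where g: "\<forall>x\<in>insert v B. g x = (if x = v then 1 else 0)" "Vector_Spaces.linear scale (*) g"
    using p.linear_independent_extend[of "insert v B" "\<lambda>x. if x = v then 1 else 0"] by blast
  have "g b = 0" if "b \<in> B" for b using that g(1) B(1) v by auto
  then have "g x = 0" if "x \<in> H" for x using p.linear_eq_0_on_span[OF g(2)] that sp by blast
  with g show thesis using that by simp
qed

lemma finite_dimensional_if_finite_span:
  assumes "vector_space s" "finite S" "module.span s S = UNIV"
  shows "\<exists>B. finite_dimensional_vector_space s B"
proof -
  interpret vector_space s by fact
  obtain B where B: "B \<subseteq> S" "independent B" "S \<subseteq> span B" using maximal_independent_subset by blast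
  then have "span B = UNIV" using assms(3) span_mono span_span by (metis top.extremum_uniqueI)
  then have "finite_dimensional_vector_space s B"
    using B assms(2) by unfold_locales (auto intro: finite_subset)
  then show ?thesis by blast
qed

lemma (in finite_dimensional_vector_space) dim_kernel_form:
  assumes V: "subspace V" and g: "Vector_Spaces.linear scale (*) g" and v: "v \<in> V" "g v \<noteq> 0"
  shows "dim {x \<in> V. g x = 0} + 1 = dim V"
proof -
  interpret p: finite_dimensional_vector_space_pair_1 scale Basis "(*)" by unfold_locales
  interpret g: Vector_Spaces.linear scale "(*)" g by fact
  have "c \<in> g ` V" for c
  proof
    show "c = g (scale (c / g v) v)" using v by (simp add: g.scale)
    show "scale (c / g v) v \<in> V" using v V subspace_scale by blast
  qed
  then have "g ` V = UNIV" by blast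
  then show ?thesis using p.rank_nullity[OF V g] by simp
qed

subsection \<open>Division algebras over a central subfield\<close>

text \<open>The cardinality of an infinite set is 0 by convention, so the bound is asked of finite
  fields only.\<close>

abbreviation large_field :: "'f itself \<Rightarrow> nat \<Rightarrow> bool" where
  "large_field _ k \<equiv> finite (UNIV :: 'f set) \<longrightarrow> k \<le> card (UNIV :: 'f set)"

locale central_algebra =
  fixes \<iota> :: "'f::field \<Rightarrow> 'd::division_ring"
  assumes central: "central_subfield \<iota>"
    and finite_dim: "\<exists>B. finite_dimensional_vector_space (scale_ring \<iota>) B"
begin

lemma embed_1 [simp]: "\<iota> 1 = 1"
  and embed_add: "\<iota> (a + b) = \<iota> a + \<iota> b"
  and embed_mult: "\<iota> (a * b) = \<iota> a * \<iota> b"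
  using central by (auto simp: central_subfield_def)

lemma embed_commute: "x * \<iota> a = \<iota> a * x"
proof -
  have "\<iota> a \<in> ring_center" using central by (auto simp: central_subfield_def)
  then show ?thesis by (simp add: ring_center_def)
qed

lemma embed_0 [simp]: "\<iota> 0 = 0"
  using embed_add[of 0 0] by simp

lemma embed_uminus: "\<iota> (- a) = - \<iota> a"
  using embed_add[of a "- a"] by (simp add: eq_neg_iff_add_eq_0 add.commute)

lemma embed_diff: "\<iota> (a - b) = \<iota> a - \<iota> b"
  using embed_add[of a "- b"] by (simp add: embed_uminus)

lemma embed_eq_0_iff [simp]: "\<iota> a = 0 \<longleftrightarrow> a = 0"
proof
  assume "\<iota> a = 0"
  then have "a \<noteq> 0 \<Longrightarrow> \<iota> (a * inverse a) = 0" unfolding embed_mult by simp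
  then show "a = 0" by force
qed simp

lemma embed_eq_iff [simp]: "\<iota> a = \<iota> b \<longleftrightarrow> a = b"
  using embed_eq_0_iff[of "a - b"] unfolding embed_diff by simp

lemma embed_left_commute: "x * (\<iota> a * y) = \<iota> a * (x * y)"
  by (subst (1 2) mult.assoc[symmetric]) (simp only: embed_commute)

lemma embed_inverse: "\<iota> (inverse a) = inverse (\<iota> a)"
proof (cases "a = 0")
  case False
  then have "\<iota> (inverse a) * \<iota> a = 1" by (simp flip: embed_mult)
  then show ?thesis using inverse_unique[of "\<iota> a" "\<iota> (inverse a)"] embed_commute[of "\<iota> (inverse a)" a] by simp
qed simp

text \<open>A finite basis is a parameter of the locale instantiated next, so one is fixed by
  choice.\<close>

definition algebra_basis :: "'d set" where
  "algebra_basis = (SOME B. finite_dimensional_vector_space (scale_ring \<iota>) B)"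

sublocale D: finite_dimensional_vector_space "scale_ring \<iota>" algebra_basis
  unfolding algebra_basis_def using finite_dim by (rule someI_ex)

abbreviation form :: "('d \<Rightarrow> 'f) \<Rightarrow> bool" where
  "form f \<equiv> Vector_Spaces.linear (scale_ring \<iota>) (*) f"

lemma finite_scalars:
  assumes "large_field TYPE('f) k"
  obtains \<Lambda> :: "'f set" where "finite \<Lambda>" "card \<Lambda> = k"
proof (cases "finite (UNIV :: 'f set)")
  case True
  then show ?thesis using assms obtain_subset_with_card_n[of k "UNIV :: 'f set"] that by (metis rev_finite_subset top_greatest)
next
  case False
  then show ?thesis using infinite_arbitrarily_large[of "UNIV :: 'f set" k] that by blast
qed

lemma form_iff:
  "form f \<longleftrightarrow> (\<forall>x y. f (x + y) = f x + f y) \<and> (\<forall>c x. f (\<iota> c * x) = c * f x)"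
  unfolding Vector_Spaces.linear_iff by (auto simp: scale_ring_def D.vector_space_axioms vector_space_over_itself.vector_space_axioms)

lemma form_add: "form f \<Longrightarrow> f (x + y) = f x + f y"
  and form_scale: "form f \<Longrightarrow> f (\<iota> c * x) = c * f x"
  by (auto simp: form_iff)

lemma form_0: "form f \<Longrightarrow> f 0 = 0"
  using form_scale[of f 0 0] by simp

lemma form_uminus: "form f \<Longrightarrow> f (- x) = - f x"
  using form_scale[of f "- 1" x] by (simp add: embed_uminus)

lemma form_diff: "form f \<Longrightarrow> f (x - y) = f x - f y"
  using form_add[of f x "- y"] by (simp add: form_uminus)

lemma form_mult_left: "form f \<Longrightarrow> form (\<lambda>x. f (a * x))"
  by (simp add: form_iff distrib_left embed_left_commute)

lemma form_mult_right: "form f \<Longrightarrow> form (\<lambda>x. f (x * a))"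
  by (simp add: form_iff distrib_right mult.assoc)

lemma endo_linear_iff:
  "Vector_Spaces.linear (scale_ring \<iota>) (scale_ring \<iota>) T \<longleftrightarrow>
     (\<forall>x y. T (x + y) = T x + T y) \<and> (\<forall>c x. T (\<iota> c * x) = \<iota> c * T x)"
  unfolding Vector_Spaces.linear_iff by (auto simp: scale_ring_def D.vector_space_axioms)

lemma subspace_iff:
  "D.subspace S \<longleftrightarrow> 0 \<in> S \<and> (\<forall>x\<in>S. \<forall>y\<in>S. x + y \<in> S) \<and> (\<forall>c. \<forall>x\<in>S. \<iota> c * x \<in> S)"
  by (simp add: D.subspace_def scale_ring_def)

lemma subspace_form_kernel: "form f \<Longrightarrow> D.subspace {x. f x = 0}"
  by (simp add: subspace_iff form_0 form_add form_scale)

lemma dim_form_kernel: "form f \<Longrightarrow> f v \<noteq> 0 \<Longrightarrow> D.dim {x. f x = 0} + 1 = D.dim UNIV"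
  using D.dim_kernel_form[of UNIV f v] by simp

text \<open>The pairing \<open>f\<^sub>0 (a * x)\<close> is nondegenerate, because
  \<open>a * x\<close> runs through all of \<open>D\<close> when \<open>a\<close> is nonzero. Hence
  \<open>D\<close> embeds into its dual by way of \<open>a\<close>, and the dimensions
  agree.\<close>

lemma form_represented:
  assumes f0: "form f\<^sub>0" "f\<^sub>0 v \<noteq> 0" and f: "form f"
  obtains a where "\<And>x. f x = f\<^sub>0 (a * x)"
proof -
  \<comment> \<open>The values of the form on the basis are taken as coordinates of an element of
    \<open>D\<close>; thus the map into the dual becomes an endomorphism, for which injective
    implies surjective.\<close>
  let ?T = "\<lambda>a. \<Sum>b\<in>algebra_basis. scale_ring \<iota> (f\<^sub>0 (a * b)) b"
  have coeff: "k b = l b"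
    if "(\<Sum>b\<in>algebra_basis. scale_ring \<iota> (k b) b) = (\<Sum>b\<in>algebra_basis. scale_ring \<iota> (l b) b)"
      "b \<in> algebra_basis" for k l b
  proof -
    have "(\<Sum>b\<in>algebra_basis. scale_ring \<iota> (k b - l b) b) = 0"
      using that(1) by (simp only: D.scale_left_diff_distrib sum_subtractf) simp
    then have "k b - l b = 0"
      using D.independentD[OF D.independent_Basis D.finite_Basis order_refl, of "\<lambda>b. k b - l b"] that(2) by blast
    then show ?thesis by simp
  qed
  have form_eqI: "g = h" if "form g" "form h" "\<And>b. b \<in> algebra_basis \<Longrightarrow> g b = h b" for g h
  proof -
    interpret p: vector_space_pair "scale_ring \<iota>" "(*) :: 'f \<Rightarrow> _" by unfold_locales
    have "g x = h x" for x
      by (rule p.linear_eq_on[OF that(1,2), of x algebra_basis]) (use that(3) in \<open>auto simp: D.span_Basis\<close>)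
    then show ?thesis by (rule HOL.ext)
  qed
  have "Vector_Spaces.linear (scale_ring \<iota>) (scale_ring \<iota>) ?T"
    unfolding endo_linear_iff
  proof (intro conjI allI)
    show "?T (x + y) = ?T x + ?T y" for x y
      by (simp only: distrib_right form_add[OF f0(1)] D.scale_left_distrib sum.distrib)
    show "?T (\<iota> c * x) = \<iota> c * ?T x" for c x
      by (simp add: mult.assoc form_scale[OF f0(1)] sum_distrib_left scale_ring_def embed_mult)
  qed
  moreover have "inj ?T"
  proof -
    interpret T: Vector_Spaces.linear "scale_ring \<iota>" "scale_ring \<iota>" ?T by fact
    have "a = 0" if "?T a = 0" for a
    proof (rule ccontr)
      assume a: "a \<noteq> 0"
      have "f\<^sub>0 (a * b) = 0" if "b \<in> algebra_basis" for b
        by (rule coeff[of _ "\<lambda>_. 0", OF _ that]) (simp add: \<open>?T a = 0\<close>)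
      then have "(\<lambda>x. f\<^sub>0 (a * x)) = (\<lambda>x. 0)"
        by (intro form_eqI form_mult_left[OF f0(1)]) (auto simp: form_iff)
      then have "f\<^sub>0 (a * (inverse a * v)) = 0" by (rule fun_cong)
      then show False using f0(2) a by (simp flip: mult.assoc)
    qed
    then show ?thesis unfolding T.inj_iff_eq_0 by blast
  qed
  ultimately have "surj ?T" by (rule D.linear_inj_imp_surj)
  then obtain a where a: "?T a = (\<Sum>b\<in>algebra_basis. scale_ring \<iota> (f b) b)" unfolding surj_def by metis
  have "f = (\<lambda>x. f\<^sub>0 (a * x))"
    by (rule form_eqI[OF f form_mult_left[OF f0(1)]]) (rule coeff[OF a[symmetric]])
  then show thesis using that fun_cong by blast
qed

text \<open>
  For \<open>e\<close> in the kernel of \<open>f\<close>, the elements \<open>(e\<inverse> + s)\<inverse>\<close> are eigenvectors of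
  the multiplication by \<open>e\<inverse>\<close> modulo the scalars.
\<close>

lemma inverses_span:
  assumes f: "form f" "f 1 = 1" and g: "form g" and gf: "\<And>x. f x \<noteq> 0 \<Longrightarrow> g (inverse x) = 0"
    and large: "large_field TYPE('f) (D.dim UNIV)"
  shows "g x = 0"
proof -
  \<comment> \<open>Inverses of elements outside the kernel of \<open>f\<close> are covered by
    \<open>gf\<close>; only kernel elements remain.\<close>
  have *: "g (inverse e) = 0" if e: "f e = 0" "e \<noteq> 0" for e
  proof (rule ccontr)
    assume ge: "g (inverse e) \<noteq> 0"
    interpret p: finite_dimensional_vector_space_pair_1 "scale_ring \<iota>" algebra_basis "scale_ring \<iota>"
      by unfold_locales
    obtain \<Lambda> :: "'f set" where \<Lambda>: "finite \<Lambda>" "card \<Lambda> = D.dim UNIV"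
      using finite_scalars[OF large] by blast
    let ?g = "\<lambda>v. g (inverse e * v)"
    have g': "form ?g" using form_mult_left[OF g] .
    \<comment> \<open>The kernel of \<open>?g\<close> is a hyperplane, too small for as many
      eigenvalues as the dimension of \<open>D\<close>.\<close>
    have "card \<Lambda> \<le> D.dim {u. ?g u = 0}"
    proof (rule p.card_pencil_eigenvalues[where A = id and B = "\<lambda>u. inverse e * u" and N = "range \<iota>"])
      show "D.subspace {u. ?g u = 0}" using subspace_form_kernel[OF g'] .
      show "D.subspace (range \<iota>)"
        unfolding subspace_iff by (auto simp flip: embed_add embed_mult intro: range_eqI[of _ _ 0])
      show "Vector_Spaces.linear (scale_ring \<iota>) (scale_ring \<iota>) id"
        "Vector_Spaces.linear (scale_ring \<iota>) (scale_ring \<iota>) (\<lambda>u. inverse e * u)"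
        by (auto simp: endo_linear_iff distrib_left embed_left_commute)
      show "u = 0" if u: "u \<in> {u. ?g u = 0}" "id u \<in> range \<iota>" for u
      proof -
        obtain c where c: "u = \<iota> c" using u(2) by auto
        then have "c * g (inverse e) = 0"
          using u(1) by (simp add: embed_commute form_scale[OF g])
        then show ?thesis using ge c by simp
      qed
      fix c assume "c \<in> \<Lambda>"
      define x where "x = inverse e - \<iota> c"
      define u where "u = inverse x"
      \<comment> \<open>As \<open>f e = 0\<close>, the product \<open>x * e\<close> has
        \<open>f\<close>-value 1 for every \<open>c\<close>. So \<open>gf\<close> applies to its
        inverse, which is \<open>inverse e * u\<close>.\<close>
      have xe: "x * e = 1 - \<iota> c * e" using e by (simp add: x_def algebra_simps)
      have "f (1 - \<iota> c * e) = 1" using f e by (simp add: form_diff form_scale)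
      then have fxe: "f (x * e) = 1" using xe by simp
      then have x0: "x \<noteq> 0" using form_0[OF f(1)] by auto
      have "g (inverse (x * e)) = 0" using gf fxe by simp
      then have "?g u = 0" using x0 e by (simp add: u_def nonzero_inverse_mult_distrib)
      moreover have "u \<noteq> 0" using x0 by (simp add: u_def)
      moreover have "inverse e * u - scale_ring \<iota> c (id u) = 1"
        using x0 by (simp add: scale_ring_def u_def x_def flip: left_diff_distrib)
      ultimately show "\<exists>u\<in>{u. ?g u = 0}. u \<noteq> 0 \<and> inverse e * u - scale_ring \<iota> c (id u) \<in> range \<iota>"
        by (auto intro!: exI[of _ u] range_eqI[of _ _ 1])
    qed (fact \<Lambda>(1))
    moreover have "D.dim {u. ?g u = 0} + 1 = D.dim UNIV"
      using dim_form_kernel[OF g', of 1] ge by simp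
    ultimately show False using \<Lambda>(2) by simp
  qed
  show ?thesis
  proof (cases "x = 0")
    case False
    then show ?thesis using *[of "inverse x"] gf[of "inverse x"] by (cases "f (inverse x) = 0") auto
  qed (simp add: form_0[OF g])
qed

definition quadratic_element :: "'d \<Rightarrow> bool" where
  "quadratic_element x \<longleftrightarrow> (\<exists>a b. x * x = \<iota> a + \<iota> b * x)"

text \<open>The powers 1, \<open>x\<close>, \<open>x * x\<close> are independent. This converts a
  bound on the field by the dimension into the three scalars needed to compare coefficients of
  polynomials of degree two.\<close>

lemma dim_ge_3_if_not_quadratic_element:
  assumes "\<not> quadratic_element x"
  shows "D.dim UNIV \<ge> 3"
proof -
  have 1: "1 \<notin> D.span {}" by simp
  have "D.span {1} = range \<iota>" unfolding D.span_singleton scale_ring_def by simp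
  then have 2: "x \<notin> D.span {1}"
    using assms unfolding quadratic_element_def
    by (metis (no_types, lifting) add.left_neutral embed_0 imageE)
  have 3: "x * x \<notin> D.span {x, 1}"
  proof
    assume "x * x \<in> D.span {x, 1}"
    then obtain k where "x * x - scale_ring \<iota> k x \<in> D.span {1}"
      unfolding D.span_breakdown_eq by blast
    then obtain a where "x * x - \<iota> k * x = \<iota> a"
      unfolding D.span_singleton scale_ring_def by auto
    then have "x * x = \<iota> a + \<iota> k * x" by (simp add: algebra_simps)
    then show False using assms quadratic_element_def by blast
  qed
  have "D.independent {x * x, x, 1}"
    by (intro D.independent_insertI 1 2 3 D.independent_empty)
  moreover have "x * x \<noteq> x" "x * x \<noteq> 1" "x \<noteq> 1"
    using 2 3 D.span_base[of x "{x,1}"] D.span_base[of 1 "{x,1}"] D.span_base[of 1 "{1}"] by (force, force, force)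
  then have "card {x * x, x, 1} = 3" by simp
  ultimately show ?thesis using D.independent_card_le_dim[of "{x * x, x, 1}" UNIV] by simp
qed

subsection \<open>The two-dimensional case\<close>

text \<open>A nonconstant affine function takes the value 1. So when the absence of fixed columns is
  tested along a line of matrices, it becomes a linear identity.\<close>

lemma affine_avoids_1:
  fixes a b :: 'f
  assumes "\<And>t. a + t * b \<noteq> 1"
  shows "b = 0"
  using assms[of "(1 - a) / b"] by (cases "b = 0") auto

lemma exists_scalar_not_0_1:
  assumes "large_field TYPE('f) 3"
  obtains t :: 'f where "t \<noteq> 0" "t \<noteq> 1"
proof -
  have "\<exists>t. t \<notin> {0, 1 :: 'f}"
  proof (rule ccontr)
    assume "\<not> ?thesis"
    then have U: "(UNIV :: 'f set) = {0, 1}" by auto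
    then have "finite (UNIV :: 'f set)" by (metis finite.emptyI finite.insertI)
    moreover have "card (UNIV :: 'f set) = 2" using arg_cong[OF U, of card] by simp
    ultimately show False using assms by simp
  qed
  then show thesis using that by blast
qed

lemma quadratic_polynomial_zero:
  fixes a b c :: 'f
  assumes zero: "\<And>t. a + t * b + t * t * c = 0" and large: "large_field TYPE('f) 3"
  shows "c = 0"
proof -
  obtain t :: 'f where t: "t \<noteq> 0" "t \<noteq> 1" by (rule exists_scalar_not_0_1[OF large])
  have a: "a = 0" using zero[of 0] by simp
  have "b + c = 0" using zero[of 1] a by simp
  then have b: "b = - c" by (simp add: eq_neg_iff_add_eq_0)
  have "t * ((t - 1) * c) = a + t * b + t * t * c"
    unfolding a b by (simp add: algebra_simps)
  then have "t * ((t - 1) * c) = 0" using zero by simp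
  then show "c = 0" using t by simp
qed

text \<open>
  Polarizing the quadratic form \<open>N\<close> of the proof at \<open>1\<close> and replacing \<open>h\<close> by \<open>h * x\<close> in the result
  gives \<open>f\<^sub>2 (h * q) = 0\<close> for all \<open>h\<close>, where \<open>q\<close> is the value at \<open>x\<close> of a quadratic polynomial.
\<close>

lemma quadratic_element_if_twisted_form:
  assumes f1: "form f\<^sub>1" "f\<^sub>1 v \<noteq> 0" and f2: "form f\<^sub>2" "f\<^sub>2 1 = 1"
    and \<kappa>: "\<And>x y. \<kappa> (x + y) = \<kappa> x + \<kappa> y" "\<And>c x. \<kappa> (\<iota> c * x) = \<iota> c * \<kappa> x" "surj \<kappa>"
    and zero: "\<And>h y. f\<^sub>2 h = 0 \<Longrightarrow> f\<^sub>1 (\<kappa> (h * y) * y) = 0"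
  shows "quadratic_element x"
proof -
  define N where "N y = f\<^sub>1 (\<kappa> y * y)" for y
  have \<kappa>_diff: "\<kappa> (x - y) = \<kappa> x - \<kappa> y" for x y
    by (metis \<kappa>(1) add_diff_cancel_right' diff_add_cancel)
  \<comment> \<open>Subtracting the scalar \<open>f\<^sub>2 h\<close> from \<open>h\<close> moves it
    into the kernel of \<open>f\<^sub>2\<close>, where the hypothesis applies.\<close>
  have N: "f\<^sub>1 (\<kappa> (h * y) * y) = f\<^sub>2 h * N y" for h y
  proof -
    have "f\<^sub>1 (\<kappa> ((h - \<iota> (f\<^sub>2 h)) * y) * y) = 0"
      using zero[of "h - \<iota> (f\<^sub>2 h)" y] form_scale[OF f2(1), of "f\<^sub>2 h" 1] f2(2)
      by (simp add: form_diff[OF f2(1)])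
    then show ?thesis
      by (simp add: N_def left_diff_distrib \<kappa>_diff \<kappa>(2) mult.assoc form_diff[OF f1(1)] form_scale[OF f1(1)])
  qed
  define T where "T x = N (x + 1) - N x - N 1" for x
  \<comment> \<open>The previous identity at \<open>x + 1\<close>, minus its instances at
    \<open>x\<close> and at 1.\<close>
  have polar: "f\<^sub>1 (\<kappa> (h * x)) + f\<^sub>1 (\<kappa> h * x) = f\<^sub>2 h * T x" for h x
  proof -
    have "f\<^sub>2 h * N (x + 1) = f\<^sub>1 (\<kappa> (h * x) * x) + f\<^sub>1 (\<kappa> (h * x)) + (f\<^sub>1 (\<kappa> h * x) + f\<^sub>1 (\<kappa> h))"
      unfolding N[of h "x + 1", symmetric] by (simp add: distrib_left distrib_right \<kappa>(1) form_add[OF f1(1)] add_ac)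
    then show ?thesis using N[of h x] N[of h 1] by (simp add: T_def right_diff_distrib)
  qed
  have f1k: "f\<^sub>1 (\<kappa> h) = f\<^sub>2 h * N 1" for h using N[of h 1] by simp
  have "f\<^sub>2 (h * (\<iota> (N 1) * (x * x) - \<iota> (T x) * x + \<iota> (N x))) = 0" for h
  proof -
    have "f\<^sub>2 (h * x * x) * N 1 + f\<^sub>2 h * N x = f\<^sub>2 (h * x) * T x"
      \<comment> \<open>With \<open>h * x\<close> in place of \<open>h\<close>, each term on the
        left of \<open>polar\<close> is a value already known from \<open>f1k\<close> or
        \<open>N\<close>.\<close>
      using polar[of "h * x" x] unfolding f1k N .
    then show ?thesis
      using form_scale[OF f2(1), of "N x" h]
      by (simp add: right_diff_distrib distrib_left form_add[OF f2(1)] form_diff[OF f2(1)] embed_left_commute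
          form_scale[OF f2(1)] mult.commute[of "f\<^sub>2 _"] embed_commute algebra_simps)
  qed
  note ann = this
  have zero: "\<iota> (N 1) * (x * x) - \<iota> (T x) * x + \<iota> (N x) = 0" (is "?q = 0")
  proof (rule ccontr)
    assume "?q \<noteq> 0"
    then show False using ann[of "inverse ?q"] f2(2) by simp
  qed
  \<comment> \<open>Surjectivity of \<kappa> is what makes the leading coefficient
    \<open>N 1\<close> of the quadratic relation nonzero.\<close>
  obtain w where "\<kappa> w = v" using \<kappa>(3) by (metis surjD)
  then have N1: "N 1 \<noteq> 0" using f1k[of w] f1(2) by auto
  have "\<iota> (N 1) * (x * x) = \<iota> (T x) * x - \<iota> (N x)" using zero by (simp add: algebra_simps)
  then have "inverse (\<iota> (N 1)) * (\<iota> (N 1) * (x * x)) = inverse (\<iota> (N 1)) * (\<iota> (T x) * x - \<iota> (N x))" by simp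
  then have "x * x = inverse (\<iota> (N 1)) * (\<iota> (T x) * x - \<iota> (N x))"
    using N1 by (simp flip: mult.assoc)
  also have "\<dots> = \<iota> (- (inverse (N 1) * N x)) + \<iota> (inverse (N 1) * T x) * x"
    by (simp add: embed_mult embed_uminus embed_inverse right_diff_distrib mult.assoc)
  finally show ?thesis unfolding quadratic_element_def by blast
qed

text \<open>
  The hypothesis on \<open>\<phi>\<close> and \<open>b\<close> says that no matrix with rows \<open>(a, l)\<close> and \<open>(b l h, h)\<close>,
  where \<open>\<phi> l h = f\<^sub>1 a\<close>, fixes a nonzero column.
\<close>

lemma lower_corner_zero:
  assumes f1: "form f\<^sub>1" "f\<^sub>1 1 = 1" and f2: "form f\<^sub>2" "f\<^sub>2 1 = 1"
    and b_add: "\<And>l l' h h'. f\<^sub>2 h = 0 \<Longrightarrow> f\<^sub>2 h' = 0 \<Longrightarrow> b (l + l') (h + h') = b l h + b l' h'"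
    and b_scale: "\<And>c l h. f\<^sub>2 h = 0 \<Longrightarrow> b (\<iota> c * l) (\<iota> c * h) = \<iota> c * b l h"
    and \<phi>_add: "\<And>l l' h h'. f\<^sub>2 h = 0 \<Longrightarrow> f\<^sub>2 h' = 0 \<Longrightarrow> \<phi> (l + l') (h + h') = \<phi> l h + \<phi> l' h'"
    and \<phi>_scale: "\<And>c l h. f\<^sub>2 h = 0 \<Longrightarrow> \<phi> (\<iota> c * l) (\<iota> c * h) = c * \<phi> l h"
    and avoid: "\<And>l h. f\<^sub>2 h = 0 \<Longrightarrow> \<phi> l h + f\<^sub>1 (l * (inverse (1 - h) * b l h)) \<noteq> 1"
    and not_quadratic: "\<not> quadratic_element x"
    and large: "large_field TYPE('f) (D.dim UNIV)"
    and h: "f\<^sub>2 h = 0"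
  shows "b l h = 0"
\<comment> \<open>The linear map taking \<open>l\<close> to \<open>b l 0\<close> either has a
  kernel, and then columns can be shifted without changing \<open>b\<close>, or it is bijective, and
  its inverse is the map \<kappa> of the twisted form.\<close>
proof (cases "\<exists>l\<^sub>0. l\<^sub>0 \<noteq> 0 \<and> b l\<^sub>0 0 = 0")
  case True
  have f20: "f\<^sub>2 0 = 0" using form_0[OF f2(1)] .
  \<comment> \<open>Adding a multiple of \<open>l\<^sub>0\<close> to \<open>l\<close> leaves
    \<open>b l h\<close> unchanged, so the avoided expression is affine in the multiple.\<close>
  have shift: "f\<^sub>1 (l\<^sub>0 * (inverse (1 - h) * b l h)) = 0"
    if l0: "b l\<^sub>0 0 = 0" and h: "f\<^sub>2 h = 0" for l\<^sub>0 l h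
  proof -
    have *: "\<phi> l\<^sub>0 0 + f\<^sub>1 (l\<^sub>0 * (inverse (1 - h) * b l h)) = 0" if h: "f\<^sub>2 h = 0" for l h
    proof (rule affine_avoids_1)
      fix t
      have b: "b (l + \<iota> t * l\<^sub>0) h = b l h"
        using b_add[OF h f20, of l "\<iota> t * l\<^sub>0"] b_scale[OF f20, of t l\<^sub>0] l0 by simp
      have \<phi>: "\<phi> (l + \<iota> t * l\<^sub>0) h = \<phi> l h + t * \<phi> l\<^sub>0 0"
        using \<phi>_add[OF h f20, of l "\<iota> t * l\<^sub>0"] \<phi>_scale[OF f20, of t l\<^sub>0] by simp
      have "\<phi> (l + \<iota> t * l\<^sub>0) h + f\<^sub>1 ((l + \<iota> t * l\<^sub>0) * (inverse (1 - h) * b (l + \<iota> t * l\<^sub>0) h)) \<noteq> 1"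
        using avoid[OF h] .
      then show "(\<phi> l h + f\<^sub>1 (l * (inverse (1 - h) * b l h)))
          + t * (\<phi> l\<^sub>0 0 + f\<^sub>1 (l\<^sub>0 * (inverse (1 - h) * b l h))) \<noteq> 1"
        unfolding b \<phi> distrib_right form_add[OF f1(1)] mult.assoc form_scale[OF f1(1)]
        by (simp add: algebra_simps)
    qed
    \<comment> \<open>At \<open>l = h = 0\<close> only the \<phi> term survives, which separates it
      from the other one.\<close>
    have "b 0 0 = 0" using b_scale[OF f20, of 0 0] by simp
    then have "\<phi> l\<^sub>0 0 = 0" using *[OF f20, of 0] form_0[OF f1(1)] by simp
    then show ?thesis using *[OF h] by simp
  qed
  from True obtain l0 where l0: "l0 \<noteq> 0" "b l0 0 = 0" by blast
  have \<beta>0: "b l 0 = 0" for l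
  proof (rule ccontr)
    assume u: "b l 0 \<noteq> 0"
    have g: "form (\<lambda>x. f\<^sub>1 (l0 * (x * b l 0)))"
      using form_mult_right[OF form_mult_left[OF f1(1), of l0], of "b l 0"] .
    have "f\<^sub>1 (l0 * (inverse y * b l 0)) = 0" if y: "f\<^sub>2 y \<noteq> 0" for y
    proof -
      \<comment> \<open>Every \<open>y\<close> outside the kernel of \<open>f\<^sub>2\<close> is a
        scalar multiple of \<open>1 - h\<close> with \<open>h\<close> in that kernel, so its inverse
        is reached by \<open>shift\<close>.\<close>
      define h where "h = 1 - \<iota> (inverse (f\<^sub>2 y)) * y"
      have h: "f\<^sub>2 h = 0" using y f2 by (simp add: h_def form_diff form_scale)
      have y0: "y \<noteq> 0" using y f20 by auto
      have "inverse (1 - h) = inverse y * \<iota> (f\<^sub>2 y)"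
        using y y0 by (simp add: h_def embed_inverse nonzero_inverse_mult_distrib)
      then have inv: "inverse (1 - h) = \<iota> (f\<^sub>2 y) * inverse y" by (simp add: embed_commute)
      have "b l h = b l 0 + b 0 h" using b_add[OF f20 h, of l 0] by simp
      then have "f\<^sub>1 (l0 * (inverse (1 - h) * b l 0)) = 0"
        using shift[OF l0(2) h, of l] shift[OF l0(2) h, of 0]
        by (simp add: distrib_left form_add[OF f1(1)])
      then show ?thesis
        unfolding inv using y by (simp add: mult.assoc embed_left_commute form_scale[OF f1(1)])
    qed
    \<comment> \<open>The form vanishes on all of \<open>D\<close>; it is tested where its argument
      becomes 1.\<close>
    then have "f\<^sub>1 (l0 * (inverse l0 * inverse (b l 0) * b l 0)) = 0"
      using inverses_span[OF f2 g _ large] by blast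
    moreover have "l0 * (inverse l0 * inverse (b l 0) * b l 0) = 1"
      using l0 u by (simp add: mult.assoc)
    ultimately show False using f1 by simp
  qed
  \<comment> \<open>Now every \<open>l\<close> qualifies as a shift, in particular the one that
    turns the argument of \<open>f\<^sub>1\<close> in \<open>shift\<close> into 1.\<close>
  show ?thesis
  proof (rule ccontr)
    assume b: "b l h \<noteq> 0"
    have "1 - h \<noteq> 0" using h f2 by auto
    then have "inverse (b l h) * (1 - h) * (inverse (1 - h) * b l h) = inverse (b l h) * ((1 - h) * inverse (1 - h)) * b l h"
      by (simp only: mult.assoc)
    also have "\<dots> = 1" using \<open>1 - h \<noteq> 0\<close> b by simp
    finally show False
      using shift[OF \<beta>0 h, of "inverse (b l h) * (1 - h)" l] f1 by simp
  qed
next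
  case False
  define \<beta> where "\<beta> l = b l 0" for l
  have f20: "f\<^sub>2 0 = 0" using form_0[OF f2(1)] .
  have \<beta>: "\<beta> (x + y) = \<beta> x + \<beta> y" "\<beta> (\<iota> c * x) = \<iota> c * \<beta> x" for x y c
    using b_add[OF f20 f20, of x y] b_scale[OF f20, of c x] by (auto simp: \<beta>_def)
  have lin: "Vector_Spaces.linear (scale_ring \<iota>) (scale_ring \<iota>) \<beta>"
    using \<beta> by (simp add: endo_linear_iff)
  interpret \<beta>: Vector_Spaces.linear "scale_ring \<iota>" "scale_ring \<iota>" \<beta> by fact
  have inj: "inj \<beta>" unfolding \<beta>.inj_iff_eq_0 using False by (auto simp: \<beta>_def)
  have surj: "surj \<beta>" using D.linear_inj_imp_surj[OF lin inj] .
  define \<kappa> where "\<kappa> = inv \<beta>"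
  have \<beta>\<kappa>: "\<beta> (\<kappa> x) = x" for x using surj by (simp add: \<kappa>_def surj_f_inv_f)
  have \<kappa>_eq: "\<kappa> x = y" if "\<beta> y = x" for x y using that inj by (auto simp: \<kappa>_def)
  have \<kappa>_add: "\<kappa> (x + y) = \<kappa> x + \<kappa> y" and \<kappa>_scale: "\<kappa> (\<iota> c * x) = \<iota> c * \<kappa> x" for x y c
    by (rule \<kappa>_eq, simp add: \<beta> \<beta>\<kappa>)+
  have \<kappa>_surj: "surj \<kappa>" using inj by (simp add: \<kappa>_def inj_imp_surj_inv)
  define \<gamma> where "\<gamma> h = b 0 h" for h
  define \<psi> where "\<psi> l = \<phi> l 0" for l
  have \<psi>: "\<psi> (x + y) = \<psi> x + \<psi> y" "\<psi> (\<iota> c * x) = c * \<psi> x" for x y c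
    using \<phi>_add[OF f20 f20, of x y] \<phi>_scale[OF f20, of c x] by (auto simp: \<psi>_def)
  have E: "\<phi> (- \<kappa> (h * y + \<gamma> h)) h - f\<^sub>1 (\<kappa> (h * y + \<gamma> h) * y) = 0" (is "\<phi> (- ?k) h - _ = 0")
    if h: "f\<^sub>2 h = 0" for h y
  proof (rule affine_avoids_1)
    fix s
    have sh: "f\<^sub>2 (\<iota> s * h) = 0" using h by (simp add: form_scale[OF f2(1)])
    \<comment> \<open>Chosen so that \<open>b ?l\<close> at \<open>\<iota> s * h\<close> equals
      \<open>(1 - \<iota> s * h) * y\<close>. The inverse in \<open>avoid\<close> then cancels, and
      the condition becomes affine in \<open>s\<close>.\<close>
    let ?l = "\<kappa> y + \<iota> s * - ?k"
    have "\<beta> ?l = y - \<iota> s * (h * y + \<gamma> h)"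
      using \<beta>\<kappa> by (simp only: \<beta> \<beta>.neg) (simp add: algebra_simps)
    then have "b ?l (\<iota> s * h) = y - \<iota> s * (h * y + \<gamma> h) + \<iota> s * \<gamma> h"
      using b_add[OF f20 sh, of ?l 0] b_scale[OF h, of s 0] by (simp add: \<beta>_def \<gamma>_def)
    also have "\<dots> = (1 - \<iota> s * h) * y" by (simp add: algebra_simps)
    finally have b: "b ?l (\<iota> s * h) = (1 - \<iota> s * h) * y" .
    have "f\<^sub>2 (1 - \<iota> s * h) = 1" using sh f2 by (simp add: form_diff)
    then have "1 - \<iota> s * h \<noteq> 0" using f20 by auto
    then have "inverse (1 - \<iota> s * h) * b ?l (\<iota> s * h) = y" unfolding b by (simp flip: mult.assoc)
    then have *: "\<phi> ?l (\<iota> s * h) + f\<^sub>1 (?l * y) \<noteq> 1" using avoid[OF sh, of ?l] by simp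
    have \<phi>_eq: "\<phi> ?l (\<iota> s * h) = \<psi> (\<kappa> y) + s * \<phi> (- ?k) h"
      using \<phi>_add[OF f20 sh, of "\<kappa> y" "\<iota> s * - ?k"] \<phi>_scale[OF h, of s "- ?k"] by (simp add: \<psi>_def)
    have f1_eq: "f\<^sub>1 (?l * y) = f\<^sub>1 (\<kappa> y * y) - s * f\<^sub>1 (?k * y)"
      unfolding distrib_right form_add[OF f1(1)] mult.assoc form_scale[OF f1(1)]
      by (simp add: form_uminus[OF f1(1)])
    have "\<psi> (\<kappa> y) + f\<^sub>1 (\<kappa> y * y) + s * (\<phi> (- ?k) h - f\<^sub>1 (?k * y))
        = (\<psi> (\<kappa> y) + s * \<phi> (- ?k) h) + (f\<^sub>1 (\<kappa> y * y) - s * f\<^sub>1 (?k * y))"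
      unfolding right_diff_distrib by (simp only: diff_conv_add_uminus add_ac)
    then show "\<psi> (\<kappa> y) + f\<^sub>1 (\<kappa> y * y) + s * (\<phi> (- ?k) h - f\<^sub>1 (?k * y)) \<noteq> 1"
      using * unfolding \<phi>_eq f1_eq by (rule ssubst)
  qed
  have "f\<^sub>1 (\<kappa> (h * y) * y) = 0" if h: "f\<^sub>2 h = 0" for h y
  proof -
    \<comment> \<open>\<open>E\<close> with \<open>y\<close> scaled by \<open>t\<close>, sorted by
      powers of \<open>t\<close>; only the coefficient of \<open>t * t\<close> matters.\<close>
    have "\<phi> (- \<kappa> (\<gamma> h)) h + t * - (\<psi> (\<kappa> (h * y)) + f\<^sub>1 (\<kappa> (\<gamma> h) * y)) + t * t * - f\<^sub>1 (\<kappa> (h * y) * y) = 0" for t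
    proof -
      have "\<phi> (- \<kappa> (h * (\<iota> t * y) + \<gamma> h)) h - f\<^sub>1 (\<kappa> (h * (\<iota> t * y) + \<gamma> h) * (\<iota> t * y)) = 0"
        using E[OF h] .
      moreover have "\<kappa> (h * (\<iota> t * y) + \<gamma> h) = \<kappa> (\<gamma> h) + \<iota> t * \<kappa> (h * y)"
        by (simp add: \<kappa>_add \<kappa>_scale embed_left_commute add.commute)
      moreover have "\<phi> (- (\<kappa> (\<gamma> h) + \<iota> t * \<kappa> (h * y))) h = \<phi> (- \<kappa> (\<gamma> h)) h - t * \<psi> (\<kappa> (h * y))"
        using \<phi>_add[OF h f20, of "- \<kappa> (\<gamma> h)" "\<iota> (- t) * \<kappa> (h * y)"] \<psi>(2)[of "- t" "\<kappa> (h * y)"]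
        by (simp add: \<psi>_def embed_uminus)
      moreover have "f\<^sub>1 ((\<kappa> (\<gamma> h) + \<iota> t * \<kappa> (h * y)) * (\<iota> t * y)) = t * f\<^sub>1 (\<kappa> (\<gamma> h) * y) + t * t * f\<^sub>1 (\<kappa> (h * y) * y)"
        unfolding distrib_right form_add[OF f1(1)] mult.assoc form_scale[OF f1(1)]
        by (simp add: embed_left_commute[of "\<kappa> _"] form_scale[OF f1(1)])
      ultimately show ?thesis by (simp add: algebra_simps)
    qed
    moreover have "large_field TYPE('f) 3"
      using large dim_ge_3_if_not_quadratic_element[OF not_quadratic] by linarith
    ultimately have "- f\<^sub>1 (\<kappa> (h * y) * y) = 0" by (rule quadratic_polynomial_zero)
    then show ?thesis by simp
  qed
  then have "quadratic_element x"
    using f1 by (intro quadratic_element_if_twisted_form[OF f1(1) _ f2 \<kappa>_add \<kappa>_scale \<kappa>_surj, of 1]) auto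
  then show ?thesis using not_quadratic by blast
qed

subsection \<open>Algebras all of whose elements are quadratic\<close>

lemma coords_unique:
  assumes x: "x \<notin> range \<iota>" and eq: "\<iota> a + \<iota> b * x = \<iota> a' + \<iota> b' * x"
  shows "a = a'" "b = b'"
proof -
  show "b = b'"
  proof (rule ccontr)
    assume b: "b \<noteq> b'"
    have "\<iota> (b - b') * x = \<iota> (a' - a)" using eq by (simp add: embed_diff algebra_simps)
    then have "inverse (\<iota> (b - b')) * (\<iota> (b - b') * x) = inverse (\<iota> (b - b')) * \<iota> (a' - a)" by simp
    then have "x = inverse (\<iota> (b - b')) * \<iota> (a' - a)"
      using b by (simp flip: mult.assoc)
    then have "x = \<iota> (inverse (b - b') * (a' - a))" by (simp add: embed_mult embed_inverse)
    then show False using x by blast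
  qed
  then show "a = a'" using eq by simp
qed

lemma quadratic_elementE:
  assumes "quadratic_element x"
  obtains a b where "x * x = \<iota> a + \<iota> b * x"
  using assms by (auto simp: quadratic_element_def)

lemma span_1_x: "D.span {x, 1} = {\<iota> a + \<iota> b * x |a b. True}"
proof -
  have "y \<in> D.span {x, 1} \<longleftrightarrow> (\<exists>b a. y = \<iota> a + \<iota> b * x)" for y
    unfolding D.span_breakdown_eq D.span_singleton scale_ring_def image_iff by (simp add: diff_eq_eq)
  then show ?thesis by blast
qed

lemma independent_1_x: "x \<notin> range \<iota> \<Longrightarrow> D.independent {x, 1}"
  by (intro D.independent_insertI D.independent_empty) (auto simp: D.span_singleton scale_ring_def)

lemma dim_span_1_x:
  assumes "x \<notin> range \<iota>"
  shows "D.dim {\<iota> a + \<iota> b * x |a b. True} = 2"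
proof -
  have "x \<noteq> 1" using assms by (metis embed_1 rangeI)
  then show ?thesis
    using D.dim_span_eq_card_independent[OF independent_1_x[OF assms]] by (simp add: span_1_x)
qed

lemma inverse_mem_span_1_x:
  assumes q: "quadratic_element z" and z: "z \<notin> range \<iota>"
  shows "\<exists>a b. inverse z = \<iota> a + \<iota> b * z"
proof -
  obtain p r where pr: "z * z = \<iota> p + \<iota> r * z" using q by (rule quadratic_elementE)
  have "z \<noteq> 0" using z by (metis embed_0 rangeI)
  have "p \<noteq> 0"
  proof
    assume "p = 0"
    then have "z * z = \<iota> r * z" using pr by simp
    then have "z = \<iota> r" using \<open>z \<noteq> 0\<close> by simp
    then show False using z by blast
  qed
  have "\<iota> p = (z - \<iota> r) * z" using pr by (simp add: left_diff_distrib)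
  then have "\<iota> p * inverse z = z - \<iota> r" using \<open>z \<noteq> 0\<close> by (simp add: mult.assoc)
  then have "inverse (\<iota> p) * (\<iota> p * inverse z) = inverse (\<iota> p) * (z - \<iota> r)" by simp
  then have "inverse z = inverse (\<iota> p) * (z - \<iota> r)" using \<open>p \<noteq> 0\<close> by (simp flip: mult.assoc)
  then have "inverse z = \<iota> (- (inverse p * r)) + \<iota> (inverse p) * z"
    by (simp add: embed_uminus embed_mult embed_inverse right_diff_distrib)
  then show ?thesis by blast
qed

lemma span_1_x_mult:
  assumes "quadratic_element x"
  shows "\<exists>a'' b''. (\<iota> a + \<iota> b * x) * (\<iota> a' + \<iota> b' * x) = \<iota> a'' + \<iota> b'' * x"
proof -
  obtain n t where x: "x * x = \<iota> n + \<iota> t * x" using assms by (rule quadratic_elementE)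
  have "(\<iota> a + \<iota> b * x) * (\<iota> a' + \<iota> b' * x)
      = \<iota> a * \<iota> a' + (\<iota> a * \<iota> b' + \<iota> b * \<iota> a') * x + \<iota> b * \<iota> b' * (x * x)"
    using embed_commute[of x a'] embed_left_commute[of x b' x]
    by (simp add: distrib_left distrib_right mult.assoc)
  also have "\<dots> = \<iota> (a * a' + b * b' * n) + \<iota> (a * b' + b * a' + b * b' * t) * x"
    unfolding x by (simp add: embed_add embed_mult distrib_left distrib_right mult.assoc add_ac)
  finally show ?thesis by blast
qed

text \<open>The square of \<open>x + \<iota> c * y\<close> is quadratic for every \<open>c\<close>,
  which puts \<open>2 * c\<close> times \<open>x * y\<close> into the span of 1, \<open>x\<close>,
  \<open>y\<close>. If 2 is invertible, \<open>y\<close> can be solved for inside the field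
  generated by \<open>x\<close>. If 2 is 0, comparing coefficients for two values of
  \<open>c\<close> kills the linear term of \<open>x * x\<close>.\<close>

lemma commuting_quadratic_elements:
  assumes quad: "\<And>z. quadratic_element z" and large: "large_field TYPE('f) 3"
    and comm: "x * y = y * x" and x: "x \<notin> range \<iota>" and y: "\<And>a b. y \<noteq> \<iota> a + \<iota> b * x"
  shows "(2::'f) = 0 \<and> x * x \<in> range \<iota>"
proof -
  obtain n t where xx: "x * x = \<iota> n + \<iota> t * x" using quad[of x] by (rule quadratic_elementE)
  obtain m s where yy: "y * y = \<iota> m + \<iota> s * y" using quad[of y] by (rule quadratic_elementE)
  have key: "\<exists>k r. \<iota> (2 * c) * (x * y) = \<iota> k + \<iota> (r - t) * x + \<iota> (r * c - c * c * s) * y" for c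
  proof -
    obtain k r where kr: "(x + \<iota> c * y) * (x + \<iota> c * y) = \<iota> k + \<iota> r * (x + \<iota> c * y)"
      using quad[of "x + \<iota> c * y"] by (rule quadratic_elementE)
    have "(x + \<iota> c * y) * (x + \<iota> c * y) = x * x + \<iota> (2 * c) * (x * y) + \<iota> c * \<iota> c * (y * y)"
    proof -
      have "x * (\<iota> c * y) = \<iota> c * (x * y)" "\<iota> c * y * x = \<iota> c * (x * y)"
        "\<iota> c * y * (\<iota> c * y) = \<iota> c * \<iota> c * (y * y)"
        using comm by (simp_all add: embed_left_commute[of x] embed_left_commute[of y] mult.assoc)
      moreover have "\<iota> (2 * c) = \<iota> c + \<iota> c" by (simp flip: embed_add)
      ultimately show ?thesis by (simp add: distrib_left distrib_right add_ac)
    qed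
    then have "\<iota> (2 * c) * (x * y) = \<iota> k + \<iota> r * (x + \<iota> c * y) - x * x - \<iota> c * \<iota> c * (y * y)"
      unfolding kr by (simp add: algebra_simps)
    also have "\<dots> = \<iota> (k - n - c * c * m) + \<iota> (r - t) * x + \<iota> (r * c - c * c * s) * y"
      unfolding xx yy embed_diff embed_mult by (simp add: algebra_simps)
    finally show ?thesis by blast
  qed
  have two: "(2::'f) = 0"
  proof (rule ccontr)
    assume 2: "(2::'f) \<noteq> 0"
    \<comment> \<open>Taking \<open>c\<close> to be one half gives \<open>x * y\<close> the
      coefficient 1.\<close>
    then have "2 * inverse (2::'f) = 1" by simp
    then obtain k p q where kpq: "x * y = \<iota> k + \<iota> p * x + \<iota> q * y"
      using key[of "inverse 2"] by (metis embed_1 mult_1)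
    define z where "z = x - \<iota> q"
    have "z * y = \<iota> k + \<iota> p * x" unfolding z_def left_diff_distrib kpq by simp
    moreover have z: "z \<notin> range \<iota>"
    proof
      assume "z \<in> range \<iota>"
      then obtain e where "z = \<iota> e" by blast
      then have "x = \<iota> (e + q)" by (simp add: z_def embed_add algebra_simps)
      then show False using x by blast
    qed
    moreover have "z \<noteq> 0" using z by (metis embed_0 rangeI)
    ultimately have "y = inverse z * (\<iota> k + \<iota> p * x)" by (metis left_inverse mult.assoc mult_1)
    moreover obtain a b where "inverse z = \<iota> a + \<iota> b * z" using inverse_mem_span_1_x[OF quad z] by blast
    moreover have "\<iota> a + \<iota> b * z = \<iota> (a - b * q) + \<iota> b * x"
      by (simp add: z_def embed_diff embed_mult algebra_simps)
    ultimately show False using span_1_x_mult[OF quad, of "a - b * q" b x k p] y by metis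
  qed
  have "t = c * s" if c: "c \<noteq> 0" for c
  proof -
    obtain k r where "\<iota> (2 * c) * (x * y) = \<iota> k + \<iota> (r - t) * x + \<iota> (r * c - c * c * s) * y"
      using key[of c] by blast
    then have eq: "\<iota> k + \<iota> (r - t) * x + \<iota> (r * c - c * c * s) * y = 0" using two by simp
    have rc: "r * c - c * c * s = 0"
    proof (rule ccontr)
      let ?w = "r * c - c * c * s"
      assume w: "?w \<noteq> 0"
      have "\<iota> ?w * y = - (\<iota> k + \<iota> (r - t) * x)" using eq unfolding eq_neg_iff_add_eq_0 by (simp only: add_ac)
      then have "inverse (\<iota> ?w) * (\<iota> ?w * y) = inverse (\<iota> ?w) * - (\<iota> k + \<iota> (r - t) * x)" by simp
      then have "y = inverse (\<iota> ?w) * - (\<iota> k + \<iota> (r - t) * x)"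
        using w unfolding mult.assoc[symmetric] by (subst (asm) left_inverse) simp_all
      also have "\<dots> = \<iota> (- (inverse ?w * k)) + \<iota> (- (inverse ?w * (r - t))) * x"
        unfolding embed_uminus embed_mult embed_inverse by (simp add: right_diff_distrib mult.assoc)
      finally show False using y by blast
    qed
    then have "\<iota> k + \<iota> (r - t) * x = \<iota> 0 + \<iota> 0 * x" using eq unfolding rc by simp
    then have "r = t" using coords_unique(2)[OF x] by fastforce
    moreover have "r = c * s" using rc c by (simp add: algebra_simps)
    ultimately show ?thesis by simp
  qed
  note ts = this
  \<comment> \<open>The relation at 1 and at another nonzero \<open>c\<close> gives
    \<open>t = s\<close> and \<open>t = c * s\<close>, which forces \<open>t = 0\<close>.\<close>
  obtain c :: 'f where c: "c \<noteq> 0" "c \<noteq> 1" by (rule exists_scalar_not_0_1[OF large])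
  have "t = s" "t = c * s" using ts[of 1] ts[OF c(1)] by auto
  then have "(c - 1) * t = 0" by (simp add: left_diff_distrib)
  then have "t = 0" using c(2) by simp
  then show ?thesis using two xx by simp
qed

lemma char_2_iff: "CHAR('f) = 2 \<longleftrightarrow> (2::'f) = 0"
proof
  show "CHAR('f) = 2 \<Longrightarrow> (2::'f) = 0" by (metis of_nat_CHAR of_nat_numeral)
  assume "(2::'f) = 0"
  then have "of_nat 2 = (0::'f)" by simp
  then have "CHAR('f) dvd 2" by (simp only: of_nat_eq_0_iff_char_dvd)
  moreover have "CHAR('f) \<noteq> 1" by simp
  ultimately show "CHAR('f) = 2" by (metis prime_nat_iff two_is_prime_nat)
qed

text \<open>A subring of largest dimension \<open>2 ^ m\<close> that contains the scalars is a
  field, since inverses are scalar multiples. Adjoining an element \<open>y\<close> outside it would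
  double the dimension: the square of \<open>y\<close> is a scalar, so \<open>S + S y\<close> is
  again a ring and the sum is direct.\<close>

lemma dim_power_of_2_if_squares_scalar:
  assumes comm: "commutative_ring TYPE('d)" and sq: "\<And>x::'d. x * x \<in> range \<iota>"
  shows "\<exists>m. D.dim UNIV = 2 ^ m"
proof -
  have C: "x * y = y * x" for x y :: 'd using comm by (simp add: commutative_ring_def)
  define P where "P m \<longleftrightarrow> (\<exists>S. D.subspace S \<and> 1 \<in> S \<and> (\<forall>x\<in>S. \<forall>y\<in>S. x * y \<in> S) \<and> D.dim S = 2 ^ m)" for m
  have "P 0"
    unfolding P_def
  proof (intro exI conjI)
    show "D.subspace (D.span {1})" by simp
    show "\<forall>x\<in>D.span {1}. \<forall>y\<in>D.span {1}. x * y \<in> D.span {1}"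
      by (auto simp: D.span_singleton scale_ring_def simp flip: embed_mult)
  qed (auto simp: D.span_base D.dim_span)
  moreover have "m \<le> D.dim UNIV" if "P m" for m
  proof -
    have "2 ^ m \<le> D.dim UNIV" using that D.dim_subset[OF subset_UNIV] unfolding P_def by metis
    then show ?thesis using less_exp[of m] by linarith
  qed
  ultimately obtain m where m: "P m" "\<And>k. P k \<Longrightarrow> k \<le> m"
    using GreatestI_ex_nat[of P "D.dim UNIV"] Greatest_le_nat[of P _ "D.dim UNIV"] by blast
  then obtain S where S: "D.subspace S" "1 \<in> S" "\<And>x y. x \<in> S \<Longrightarrow> y \<in> S \<Longrightarrow> x * y \<in> S" "D.dim S = 2 ^ m"
    unfolding P_def by blast
  have "S = UNIV"
  proof (rule ccontr)
    assume "S \<noteq> UNIV"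
    then obtain y where y: "y \<notin> S" by blast
    have inv: "inverse a \<in> S" if a: "a \<in> S" for a
    proof (cases "a = 0")
      case False
      obtain c where c: "a * a = \<iota> c" using sq[of a] by auto
      then have "c \<noteq> 0" using False by auto
      have "\<iota> (inverse c) * a * a = 1" using c \<open>c \<noteq> 0\<close> by (simp add: embed_inverse mult.assoc)
      then have "inverse a = \<iota> (inverse c) * a" using inverse_unique C by metis
      then show ?thesis using a S(1) by (simp add: subspace_iff)
    qed (use a in simp)
    let ?Sy = "(\<lambda>a. a * y) ` S" and ?T = "{u + v |u v. u \<in> S \<and> v \<in> (\<lambda>a. a * y) ` S}"
    have lin: "Vector_Spaces.linear (scale_ring \<iota>) (scale_ring \<iota>) (\<lambda>a. a * y)"
      by (simp add: endo_linear_iff distrib_right mult.assoc)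
    interpret p: finite_dimensional_vector_space_pair_1 "scale_ring \<iota>" algebra_basis "scale_ring \<iota>"
      by unfold_locales
    interpret l: Vector_Spaces.linear "scale_ring \<iota>" "scale_ring \<iota>" "\<lambda>a. a * y" by fact
    have y0: "y \<noteq> 0" using y S(1) D.subspace_0 by blast
    have sub: "D.subspace ?Sy" using l.subspace_image[OF S(1)] .
    have dim: "D.dim ?Sy = 2 ^ m"
      using p.dim_image_eq[OF lin, of S] y0 S(4) by (auto simp: inj_on_def)
    have "S \<inter> ?Sy \<subseteq> {0}"
    proof
      fix w assume "w \<in> S \<inter> ?Sy"
      then obtain a where a: "a \<in> S" "w = a * y" "a * y \<in> S" by auto
      have "a = 0"
      proof (rule ccontr)
        assume "a \<noteq> 0"
        then have "y = inverse a * (a * y)" by (simp flip: mult.assoc)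
        then show False using S(3)[OF inv[OF a(1)] a(3)] y by simp
      qed
      then show "w \<in> {0}" using a by simp
    qed
    then have zero: "D.dim (S \<inter> ?Sy) = 0" using D.dim_eq_0 by blast
    then have "D.dim ?T = 2 ^ Suc m"
      using D.dim_sums_Int[OF S(1) sub, unfolded dim S(4) zero] by simp
    moreover have "D.subspace ?T" using D.subspace_sums[OF S(1) sub] .
    moreover have "1 \<in> ?T" using S(2) D.subspace_0[OF sub] by force
    moreover have "v * w \<in> ?T" if vw: "v \<in> ?T" "w \<in> ?T" for v w
    proof -
      obtain a b a' b' where ab: "v = a + b * y" "w = a' + b' * y" "a \<in> S" "b \<in> S" "a' \<in> S" "b' \<in> S"
        using vw by blast
      obtain c where c: "y * y = \<iota> c" using sq[of y] by auto
      have "b * y * (b' * y) = \<iota> c * (b * b')"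
        using c C by (metis mult.assoc)
      moreover have "b * y * a' = b * a' * y" using C by (metis mult.assoc)
      ultimately have "v * w = (a * a' + \<iota> c * (b * b')) + (a * b' + b * a') * y"
        unfolding ab by (simp add: distrib_left distrib_right mult.assoc add_ac)
      moreover have "a * a' + \<iota> c * (b * b') \<in> S" "a * b' + b * a' \<in> S"
        using ab S(1,3) by (auto simp: subspace_iff)
      ultimately show ?thesis by blast
    qed
    ultimately have "P (Suc m)" unfolding P_def by blast
    then show False using m(2) by fastforce
  qed
  then show ?thesis using S(4) by blast
qed

text \<open>A scalar has a linear polynomial. For any other \<open>x\<close> the polynomial is
  quadratic, and it is separable exactly when its discriminant is nonzero.\<close>

lemma separable_if_not_square_scalar:
  assumes dim2: "\<And>x y. x \<notin> range \<iota> \<Longrightarrow> \<exists>a b. y = \<iota> a + \<iota> b * x"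
    and sep: "\<not> ((2::'f) = 0 \<and> (\<forall>x. x * x \<in> range \<iota>))" and comm: "commutative_ring TYPE('d)"
  shows "separable_field_extension \<iota>"
  unfolding separable_field_extension_def
proof (intro conjI allI comm)
  fix x
  show "\<exists>p. irreducible p \<and> eval_over \<iota> p x = 0 \<and> coprime p (pderiv p)"
  proof (cases "x \<in> range \<iota>")
    case True
    then obtain c where c: "x = \<iota> c" by blast
    have "irreducible [:- c, 1:]" by (rule irreducible_linear_field_poly) simp
    moreover have "eval_over \<iota> [:- c, 1:] x = 0" by (simp add: eval_over_def c embed_uminus)
    moreover have "coprime [:- c, 1:] (pderiv [:- c, 1:])" by (simp add: pderiv_pCons pCons_one)
    ultimately show ?thesis by blast
  next
    case False
    obtain n t where xx: "x * x = \<iota> n + \<iota> t * x" using dim2[OF False] by blast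
    let ?p = "[:- n, - t, 1:]"
    \<comment> \<open>If \<Delta> is 0, then \<open>x + x - \<iota> t\<close> squares to 0 and hence
      is 0. As \<open>x\<close> is not a scalar, this means characteristic 2 and
      \<open>t = 0\<close>, and then all squares are scalars.\<close>
    define \<Delta> where "\<Delta> = t * t + 4 * n"
    have \<Delta>: "\<Delta> \<noteq> 0"
    proof
      assume "\<Delta> = 0"
      have two: "\<iota> 2 = 2" using embed_add[of 1 1] by simp
      have "(x + x - \<iota> t) * (x + x - \<iota> t)
          = x * x + x * x + x * x + x * x - (\<iota> t * x + \<iota> t * x + \<iota> t * x + \<iota> t * x) + \<iota> t * \<iota> t"
        using embed_commute[of x t] by (simp add: algebra_simps)
      also have "\<dots> = \<iota> t * \<iota> t + (\<iota> n + \<iota> n + \<iota> n + \<iota> n)" unfolding xx by (simp add: algebra_simps)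
      also have "\<dots> = \<iota> (t * t + (n + n + n + n))" by (simp only: embed_add embed_mult)
      also have "t * t + (n + n + n + n) = 0" using \<open>\<Delta> = 0\<close> unfolding \<Delta>_def by simp
      finally have "x + x - \<iota> t = 0" by simp
      then have "\<iota> (- t) + \<iota> 2 * x = \<iota> 0 + \<iota> 0 * x" by (simp add: embed_uminus two mult_2)
      then have "- t = 0" "(2::'f) = 0" using coords_unique[OF False] by blast+
      then have t: "t = 0" and two0: "(2::'f) = 0" by auto
      have "w * w \<in> range \<iota>" for w
      proof -
        obtain a b where w: "w = \<iota> a + \<iota> b * x" using dim2[OF False] by blast
        have "\<iota> b * x * \<iota> a = \<iota> a * (\<iota> b * x)" "\<iota> b * x * (\<iota> b * x) = \<iota> b * \<iota> b * (x * x)"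
          by (rule embed_commute, simp only: mult.assoc embed_left_commute[of x])
        then have "w * w = \<iota> a * \<iota> a + \<iota> 2 * (\<iota> a * (\<iota> b * x)) + \<iota> b * \<iota> b * (x * x)"
          unfolding w two mult_2 distrib_left distrib_right by (simp only: add_ac)
        also have "\<dots> = \<iota> (a * a + b * b * n)"
          using two0 xx t by (simp add: embed_add embed_mult)
        finally show ?thesis by blast
      qed
      then show False using sep two0 by blast
    qed
    have no_root: "r * r - t * r - n \<noteq> 0" for r
    proof
      assume r: "r * r - t * r - n = 0"
      \<comment> \<open>A root would factor the relation satisfied by \<open>x\<close>, and without
        zero divisors \<open>x\<close> would be a scalar.\<close>
      have "(x - \<iota> r) * (x - \<iota> (t - r)) = x * x - \<iota> t * x + \<iota> r * \<iota> (t - r)"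
        using embed_commute[of x r] embed_commute[of x t] by (simp add: embed_diff algebra_simps)
      also have "\<dots> = \<iota> (n + r * (t - r))" unfolding xx by (simp add: embed_add embed_mult)
      also have "n + r * (t - r) = 0" using r by (simp add: algebra_simps)
      finally have "x = \<iota> r \<or> x = \<iota> (t - r)" by simp
      then show False using False by blast
    qed
    have deg: "degree ?p = 2" by simp
    have "irreducible ?p"
    proof (rule irreducibleI)
      show "?p \<noteq> 0" by simp
      show "\<not> ?p dvd 1" using deg by (metis is_unit_iff_degree zero_neq_numeral \<open>?p \<noteq> 0\<close>)
      fix q r assume qr: "?p = q * r"
      then have q0: "q \<noteq> 0" and r0: "r \<noteq> 0" by auto
      have sum: "degree q + degree r = 2" using degree_mult_eq[OF q0 r0] qr deg by simp
      have no_lin: "degree s \<noteq> 1" if "s dvd ?p" for s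
      proof
        assume "degree s = 1"
        then obtain a b where s: "s = [:a, b:]" "b \<noteq> 0" by (metis degree1_coeffs)
        then have "poly s (- a / b) = 0" by simp
        then have "poly ?p (- a / b) = 0" using that by (metis dvd_def mult_zero_left poly_mult)
        then show False using no_root[of "- a / b"] by (simp add: algebra_simps)
      qed
      have "degree q \<noteq> 1" "degree r \<noteq> 1" using no_lin qr by auto
      then have "degree q = 0 \<or> degree r = 0" using sum by linarith
      then show "q dvd 1 \<or> r dvd 1" using q0 r0 by (simp add: is_unit_iff_degree)
    qed
    moreover have "eval_over \<iota> ?p x = 0"
      using xx by (simp add: eval_over_def numeral_2_eq_2 embed_uminus)
    moreover have "coprime ?p (pderiv ?p)"
    proof (rule coprimeI)
      fix q assume q: "q dvd ?p" "q dvd pderiv ?p"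
      \<comment> \<open>The square of the derivative minus four times the polynomial is the constant
        \<Delta>.\<close>
      have "q dvd pderiv ?p * pderiv ?p - [:4:] * ?p" using q by (metis dvd_diff dvd_mult)
      also have "pderiv ?p * pderiv ?p - [:4:] * ?p = [:\<Delta>:]"
        by (simp add: pderiv_pCons \<Delta>_def algebra_simps)
      finally show "is_unit q" using \<Delta> by (metis dvd_trans is_unit_triv)
    qed
    ultimately show ?thesis by blast
  qed
qed

text \<open>Dimensions 1 and 2 are immediate up to separability. From dimension 3 on, every element
  that is not a scalar has a partner outside the span of 1 and itself, so
  \<open>commuting_quadratic_elements\<close> forces characteristic 2 and scalar squares.\<close>

lemma quadratic_type_if_commutative:
  assumes quad: "\<And>z. quadratic_element z" and large: "large_field TYPE('f) (D.dim UNIV)"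
    and comm: "commutative_ring TYPE('d)"
  shows "quadratic_type \<iota>"
proof -
  have dim_1: "D.dim UNIV = 1" if "range \<iota> = UNIV"
    using that D.dim_span_eq_card_independent[of "{1}"] by (simp add: D.span_singleton scale_ring_def)
  have squares: "quadratic_type \<iota>" if char: "(2::'f) = 0" and sq: "\<And>x. x * x \<in> range \<iota>"
  proof -
    obtain m where "D.dim UNIV = 2 ^ m" using dim_power_of_2_if_squares_scalar[OF comm sq] by blast
    \<comment> \<open>The exponent 0 means dimension 1, the first clause; the last clause asks for a
      positive exponent.\<close>
    then show ?thesis
      using char sq comm unfolding quadratic_type_def Let_def char_2_iff power2_eq_square
      by (cases "m = 0") auto
  qed
  show ?thesis
  proof (cases "\<forall>x y. x \<notin> range \<iota> \<longrightarrow> (\<exists>a b. y = \<iota> a + \<iota> b * x)")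
    case True
    show ?thesis
    proof (cases "range \<iota> = UNIV")
      case True
      then show ?thesis using dim_1 by (simp add: quadratic_type_def Let_def)
    next
      case False
      then obtain x where x: "x \<notin> range \<iota>" by blast
      then have "{\<iota> a + \<iota> b * x |a b. True} = UNIV" using True by auto
      then have "D.dim UNIV = 2" using dim_span_1_x[OF x] by simp
      then show ?thesis
        using separable_if_not_square_scalar[OF _ _ comm] True squares
        by (auto simp: quadratic_type_def Let_def)
    qed
  next
    case False
    then obtain x y where xy: "x \<notin> range \<iota>" "\<And>a b. y \<noteq> \<iota> a + \<iota> b * x" by blast
    have "D.independent {y, x, 1}"
      using xy by (intro D.independent_insertI independent_1_x) (auto simp: span_1_x)
    moreover have "card {y, x, 1} = 3"
      using xy D.span_base[of _ "{x, 1}"] unfolding span_1_x by (auto simp: card_insert_if) (metis embed_1 rangeI)+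
    ultimately have dim3: "D.dim UNIV \<ge> 3" using D.independent_card_le_dim[of "{y, x, 1}" UNIV] by simp
    then have large3: "large_field TYPE('f) 3" using large by linarith
    have C: "x * y = y * x" for x y :: 'd using comm by (simp add: commutative_ring_def)
    have "(2::'f) = 0 \<and> z * z \<in> range \<iota>" if z: "z \<notin> range \<iota>" for z
    proof -
      have "{\<iota> a + \<iota> b * z |a b. True} \<noteq> UNIV" using dim_span_1_x[OF z] dim3 by auto
      then obtain w where "\<And>a b. w \<noteq> \<iota> a + \<iota> b * z" by blast
      then show ?thesis using commuting_quadratic_elements[OF quad large3 C z] by blast
    qed
    moreover have "z * z \<in> range \<iota>" if "z \<in> range \<iota>" for z using that by (auto simp flip: embed_mult)
    ultimately show ?thesis using squares xy(1) by blast
  qed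
qed

section \<open>Noncommutative algebras of quadratic elements\<close>

lemma not_scalar_if_noncommuting: "x * y \<noteq> y * x \<Longrightarrow> x \<notin> range \<iota>"
  by (auto simp: embed_commute[of y])

text \<open>Polarization of the squaring map. In characteristic 2 the anticommutator is the
  commutator, so for noncommuting elements the scalar is nonzero.\<close>

lemma anticommutator_scalar:
  assumes "u * u \<in> range \<iota>" "v * v \<in> range \<iota>" "(u + v) * (u + v) \<in> range \<iota>"
  shows "\<exists>c. u * v + v * u = \<iota> c"
proof -
  obtain a b c where *: "u * u = \<iota> a" "v * v = \<iota> b" "(u + v) * (u + v) = \<iota> c"
    using assms unfolding image_iff by metis
  have "(u + v) * (u + v) = u * u + v * v + (u * v + v * u)" by (simp add: distrib_left distrib_right add_ac)
  then have "u * v + v * u = \<iota> (c - a - b)" unfolding * embed_diff by (simp add: algebra_simps)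
  then show ?thesis by blast
qed

text \<open>Suppose a central \<open>z\<close> is not a scalar. An element \<open>u\<close> that
  fails to commute with something cannot span \<open>z\<close> together with 1, so
  \<open>commuting_quadratic_elements\<close> for \<open>u\<close> and \<open>z\<close> gives
  characteristic 2 and a scalar square. The commutators of \<open>x\<close> and of
  \<open>z * x\<close> with \<open>y\<close> are then scalars, the second being \<open>z\<close>
  times the first, so \<open>z\<close> is a scalar after all.\<close>

lemma center_is_range_if_noncommutative:
  fixes x y :: 'd
  assumes quad: "\<And>z. quadratic_element z" and large: "large_field TYPE('f) 3"
    and nc: "x * y \<noteq> y * x"
  shows "ring_center = range \<iota>"
proof
  show "range \<iota> \<subseteq> ring_center" using central by (simp add: central_subfield_def)
  show "ring_center \<subseteq> range \<iota>"
  proof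
    fix z :: 'd assume "z \<in> ring_center"
    then have z: "z * w = w * z" for w by (simp add: ring_center_def)
    show "z \<in> range \<iota>"
    proof (rule ccontr)
      assume zF: "z \<notin> range \<iota>"
      have sq: "(2::'f) = 0 \<and> u * u \<in> range \<iota>" if u: "u * v \<noteq> v * u" for u v
      proof (rule commuting_quadratic_elements[OF quad large z[symmetric]])
        show "u \<notin> range \<iota>" using not_scalar_if_noncommuting[OF u] .
        show "z \<noteq> \<iota> a + \<iota> b * u" for a b
        proof
          assume eq: "z = \<iota> a + \<iota> b * u"
          then have b: "b \<noteq> 0" using zF by auto
          have "\<iota> b * (u * v) = \<iota> b * (v * u)"
            using z[of v] unfolding eq distrib_left distrib_right embed_commute[of v] embed_left_commute[of v] mult.assoc
            by simp
          then show False using b u by simp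
        qed
      qed
      have anti: "\<exists>c. u * v + v * u = \<iota> c" if uv: "u * v \<noteq> v * u" for u v
      proof -
        have "(u + v) * v \<noteq> v * (u + v)" using uv by (simp add: distrib_left distrib_right)
        then show ?thesis
          using sq[of u v] sq[of v u] sq[of "u + v" v] uv by (intro anticommutator_scalar) auto
      qed
      obtain c where c: "x * y + y * x = \<iota> c" using anti[OF nc] by blast
      have "c \<noteq> 0"
      proof
        assume "c = 0"
        then have "x * y = - (y * x)" using c by (simp add: eq_neg_iff_add_eq_0)
        moreover have "- w = w" for w :: 'd
        proof -
          have "w + w = \<iota> 2 * w" using embed_add[of 1 1] by (simp add: mult_2)
          then have "w + w = 0" using sq[OF nc] by simp
          then show ?thesis by (simp only: neg_eq_iff_add_eq_0)
        qed
        ultimately show False using nc by simp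
      qed
      have z0: "z \<noteq> 0" using zF by (metis embed_0 rangeI)
      have yzx: "y * (z * x) = z * (y * x)" unfolding mult.assoc[symmetric] z[of y] ..
      have "z * x * y \<noteq> y * (z * x)"
      proof
        assume "z * x * y = y * (z * x)"
        then have "z * (x * y) = z * (y * x)" unfolding yzx mult.assoc .
        then show False using z0 nc by simp
      qed
      then obtain c' where "z * x * y + y * (z * x) = \<iota> c'" using anti by blast
      then have "z * \<iota> c = \<iota> c'" unfolding c[symmetric] distrib_left yzx mult.assoc .
      then have "z * \<iota> c * inverse (\<iota> c) = \<iota> c' * inverse (\<iota> c)" by simp
      then have "z = \<iota> (c' * inverse c)" using \<open>c \<noteq> 0\<close> by (simp add: mult.assoc embed_mult embed_inverse)
      then show False using zF by blast
    qed
  qed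
qed

text \<open>Otherwise the characteristic is 2 and all squares are scalars. The anticommutator of
  \<open>x\<close> with \<open>x * y\<close> is \<open>x\<close> times that of \<open>x\<close> with
  \<open>y\<close>; both are scalars and the latter is nonzero, so \<open>x\<close> would be a
  scalar.\<close>

lemma exists_separable_element:
  fixes x y :: 'd
  assumes quad: "\<And>z. quadratic_element z" and nc: "x * y \<noteq> y * x"
  obtains w n t where "w \<notin> range \<iota>" "w * w = \<iota> n + \<iota> t * w" "(2::'f) \<noteq> 0 \<or> t \<noteq> 0"
proof (rule ccontr)
  note witness = that
  assume no: "\<not> thesis"
  have x: "x \<notin> range \<iota>" using not_scalar_if_noncommuting[OF nc] .
  have *: "(2::'f) = 0 \<and> w * w \<in> range \<iota>" if w: "w \<notin> range \<iota>" for w :: 'd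
  proof -
    obtain n t where "w * w = \<iota> n + \<iota> t * w" using quad by (rule quadratic_elementE)
    then have "(2::'f) = 0" "t = 0" "w * w = \<iota> n + \<iota> t * w" using no witness[OF w] by blast+
    then show ?thesis by simp
  qed
  have sq: "w * w \<in> range \<iota>" for w
  proof (cases "w \<in> range \<iota>")
    case True
    then show ?thesis by (auto simp flip: embed_mult)
  next
    case False
    then show ?thesis using *[OF False] by blast
  qed
  note anti = anticommutator_scalar[OF sq sq sq]
  obtain c where c: "x * y + y * x = \<iota> c" using anti by blast
  have "c \<noteq> 0"
  proof
    assume "c = 0"
    then have "x * y = - (y * x)" using c by (simp add: eq_neg_iff_add_eq_0)
    moreover have "- w = w" for w :: 'd
    proof -
      have "w + w = \<iota> 2 * w" using embed_add[of 1 1] by (simp add: mult_2)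
      then have "w + w = 0" using *[OF x] by simp
      then show ?thesis by (simp only: neg_eq_iff_add_eq_0)
    qed
    ultimately show False using nc by simp
  qed
  obtain c' where "x * (x * y) + (x * y) * x = \<iota> c'" using anti by blast
  then have "x * \<iota> c = \<iota> c'" unfolding c[symmetric] distrib_left by (simp add: mult.assoc)
  then have "x * \<iota> c * inverse (\<iota> c) = \<iota> c' * inverse (\<iota> c)" by simp
  then have "x = \<iota> (c' * inverse c)" using \<open>c \<noteq> 0\<close> by (simp add: mult.assoc embed_mult embed_inverse)
  then show False using x by blast
qed

text \<open>
  With \<open>w\<close> separable over the scalars, the commutator with \<open>w\<close> splits the algebra into the
  centralizer of \<open>w\<close>, spanned by \<open>1\<close> and \<open>w\<close>, and a one-dimensional space over that centralizer.
\<close>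

lemma dim_4_if_noncommutative:
  fixes x y :: 'd
  assumes quad: "\<And>z. quadratic_element z" and large: "large_field TYPE('f) 3"
    and nc: "x * y \<noteq> y * x"
  shows "D.dim UNIV = 4"
proof -
  obtain w n t where w: "w \<notin> range \<iota>" "w * w = \<iota> n + \<iota> t * w" "(2::'f) \<noteq> 0 \<or> t \<noteq> 0"
    by (rule exists_separable_element[OF quad nc])
  interpret p: finite_dimensional_vector_space_pair_1 "scale_ring \<iota>" algebra_basis "scale_ring \<iota>"
    by unfold_locales
  define K where "K = {\<iota> a + \<iota> b * w |a b. True}"
  have dimK: "D.dim K = 2" unfolding K_def using dim_span_1_x[OF w(1)] .
  have subK: "D.subspace K" unfolding K_def span_1_x[symmetric] by simp
  have commK: "k * w = w * k" if "k \<in> K" for k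
    using that by (auto simp: K_def distrib_left distrib_right mult.assoc embed_left_commute[of w] embed_commute[of w])
  have K_iff: "u \<in> K \<longleftrightarrow> u * w = w * u" for u
  proof
    assume uw: "u * w = w * u"
    show "u \<in> K"
    proof (rule ccontr)
      assume "u \<notin> K"
      then have "(2::'f) = 0 \<and> w * w \<in> range \<iota>"
        using commuting_quadratic_elements[OF quad large uw[symmetric] w(1)] unfolding K_def by blast
      then obtain m where "w * w = \<iota> m" "(2::'f) = 0" by (auto simp: image_iff)
      then have "\<iota> n + \<iota> t * w = \<iota> m + \<iota> 0 * w" using w(2) by simp
      then have "t = 0" by (rule coords_unique(2)[OF w(1)])
      then show False using w(3) \<open>(2::'f) = 0\<close> by blast
    qed
  qed (rule commK)
  \<comment> \<open>The other root of the polynomial of \<open>w\<close>; separability makes it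
    different from \<open>w\<close>.\<close>
  define w' where "w' = \<iota> t - w"
  have w'w: "w' * w = - \<iota> n" "w * w' = - \<iota> n"
    using w(2) embed_commute[of w t] by (simp_all add: w'_def left_diff_distrib right_diff_distrib)
  have ne: "w \<noteq> w'"
  proof
    assume "w = w'"
    then have "w + w = w' + w" by simp
    then have "w + w = \<iota> t" by (simp add: w'_def)
    then have "\<iota> (- t) + \<iota> 2 * w = \<iota> 0 + \<iota> 0 * w"
      using embed_add[of 1 1] by (simp add: embed_uminus mult_2)
    then have "- t = 0" "(2::'f) = 0" using coords_unique[OF w(1)] by blast+
    then show False using w(3) by simp
  qed
  define \<delta> where "\<delta> u = w * u - u * w" for u
  have lin: "Vector_Spaces.linear (scale_ring \<iota>) (scale_ring \<iota>) \<delta>"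
    by (simp add: endo_linear_iff \<delta>_def distrib_left distrib_right embed_left_commute[of w] mult.assoc right_diff_distrib)
  \<comment> \<open>The elements that carry \<open>w\<close> to its conjugate. They contain the
    range of \<delta>, and any nonzero one generates them over the centralizer \<open>K\<close>,
    which is the kernel of \<delta>.\<close>
  define E where "E = {u. u * w = w' * u}"
  have subE: "D.subspace E"
    by (auto simp: E_def subspace_iff distrib_left distrib_right mult.assoc embed_left_commute[of w'])
  have \<delta>E: "\<delta> u \<in> E" for u
  proof -
    have "w' * (w * u - u * w) = - (\<iota> n * u) - (\<iota> t - w) * u * w"
      unfolding right_diff_distrib mult.assoc[symmetric] w'w by (simp add: w'_def)
    also have "\<dots> = w * u * w - u * (\<iota> n + \<iota> t * w)"
      by (simp add: algebra_simps embed_left_commute[of u] embed_commute[of u])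
    also have "\<dots> = (w * u - u * w) * w" unfolding w(2)[symmetric] by (simp add: algebra_simps)
    finally show ?thesis by (simp add: E_def \<delta>_def)
  qed
  obtain u where u: "w * u \<noteq> u * w"
  proof -
    have "w \<notin> ring_center" using center_is_range_if_noncommutative[OF quad large nc] w(1) by simp
    then show thesis using that by (auto simp: ring_center_def)
  qed
  define j where "j = \<delta> u"
  have j: "j \<noteq> 0" "j * w = w' * j" using u \<delta>E[of u] by (auto simp: j_def \<delta>_def E_def)
  have E_eq: "E = (\<lambda>k. k * j) ` K"
  proof
    show "E \<subseteq> (\<lambda>k. k * j) ` K"
    proof
      fix v assume "v \<in> E"
      then have v: "v * w = w' * v" by (simp add: E_def)
      have inv: "inverse j * w' = w * inverse j"
      proof -
        have "inverse j * w' = inverse j * (w' * j) * inverse j" using j(1) by (simp add: mult.assoc)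
        also have "\<dots> = inverse j * (j * w) * inverse j" unfolding j(2) ..
        also have "\<dots> = (inverse j * j) * w * inverse j" by (simp only: mult.assoc)
        finally show ?thesis using j(1) by simp
      qed
      have "v * inverse j * w' = w' * (v * inverse j)"
        unfolding mult.assoc inv unfolding mult.assoc[symmetric] v ..
      then have "v * inverse j * w = w * (v * inverse j)"
        using embed_commute[of "v * inverse j" t] by (simp add: w'_def left_diff_distrib right_diff_distrib)
      then have "v * inverse j \<in> K" using K_iff by simp
      moreover have "v = v * inverse j * j" using j(1) by (simp add: mult.assoc)
      ultimately show "v \<in> (\<lambda>k. k * j) ` K" by blast
    qed
    show "(\<lambda>k. k * j) ` K \<subseteq> E"
    proof
      fix v assume "v \<in> (\<lambda>k. k * j) ` K"
      then obtain k where k: "k \<in> K" "v = k * j" by blast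
      have "k * w' = w' * k" using commK[OF k(1)] embed_commute[of k t] by (simp add: w'_def left_diff_distrib right_diff_distrib)
      then have "k * j * w = w' * (k * j)" unfolding mult.assoc j(2) unfolding mult.assoc[symmetric] by simp
      then show "v \<in> E" using k(2) by (simp add: E_def)
    qed
  qed
  have linj: "Vector_Spaces.linear (scale_ring \<iota>) (scale_ring \<iota>) (\<lambda>k. k * j)"
    by (simp add: endo_linear_iff distrib_right mult.assoc)
  have dimE: "D.dim E = 2"
    unfolding E_eq using dimK by (subst p.dim_image_eq[OF linj]) (simp_all add: inj_on_def j(1))
  have ker: "{v \<in> UNIV. \<delta> v = 0} = K"
  proof (rule set_eqI)
    fix v
    show "v \<in> {v \<in> UNIV. \<delta> v = 0} \<longleftrightarrow> v \<in> K"
      unfolding K_iff \<delta>_def mem_Collect_eq right_minus_eq by (simp only: UNIV_I simp_thms) (rule eq_commute)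
  qed
  have "D.dim UNIV = D.dim (range \<delta>) + 2"
    using p.rank_nullity[OF D.subspace_UNIV lin, unfolded ker dimK] .
  moreover have "D.dim (range \<delta>) \<le> 2" using D.dim_subset[OF image_subsetI[of UNIV \<delta> E, OF \<delta>E]] dimE by simp
  \<comment> \<open>Rank-nullity for \<delta> gives the upper bound. The lower bound holds because
    \<open>K\<close> and \<open>E\<close> meet only in 0, as \<open>w\<close> differs from
    \<open>w'\<close>.\<close>
  moreover have "D.dim UNIV \<ge> 4"
  proof -
    have "K \<inter> E \<subseteq> {0}"
    proof
      fix v assume "v \<in> K \<inter> E"
      then have "v * w = w * v" "v * w = w' * v" using commK[of v] by (auto simp: E_def)
      then have "w * v = w' * v" by metis
      then show "v \<in> {0}" using ne by auto
    qed
    then have zero: "D.dim (K \<inter> E) = 0" using D.dim_eq_0 by blast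
    show ?thesis
      using D.dim_sums_Int[OF subK subE, unfolded zero dimK dimE]
        D.dim_subset[OF subset_UNIV, of "{x + y |x y. x \<in> K \<and> y \<in> E}"] by linarith
  qed
  ultimately show ?thesis by linarith
qed

lemma quadratic_type_if_quadratic_elements:
  assumes quad: "\<And>z. quadratic_element z" and large: "large_field TYPE('f) (D.dim UNIV)"
  shows "quadratic_type \<iota>"
proof (cases "commutative_ring TYPE('d)")
  case True
  then show ?thesis using quadratic_type_if_commutative[OF quad large] by blast
next
  case False
  then obtain x y :: 'd where nc: "x * y \<noteq> y * x" by (auto simp: commutative_ring_def)
  have x: "x \<notin> range \<iota>" using not_scalar_if_noncommuting[OF nc] .
  have "y \<noteq> \<iota> a + \<iota> b * x" for a b
  proof
    assume "y = \<iota> a + \<iota> b * x"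
    then show False
      using nc by (simp add: distrib_left distrib_right embed_commute[of x] embed_left_commute[of x] mult.assoc)
  qed
  then have y: "y \<notin> D.span {x, 1}" by (auto simp: span_1_x)
  then have "D.independent {y, x, 1}" by (intro D.independent_insertI independent_1_x x)
  moreover have "card {y, x, 1} = 3"
  proof -
    have "y \<noteq> x" "y \<noteq> 1" "x \<noteq> 1" using nc by auto
    then show ?thesis by simp
  qed
  ultimately have "D.dim UNIV \<ge> 3" using D.independent_card_le_dim[of "{y, x, 1}" UNIV] by simp
  then have large3: "large_field TYPE('f) 3" using large by linarith
  have "I = {0} \<or> I = UNIV" if I: "two_sided_ideal I" for I :: "'d set"
  proof (cases "I = {0}")
    case False
    then obtain v where v: "v \<in> I" "v \<noteq> 0" using I by (auto simp: two_sided_ideal_def)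
    then have "r * inverse v * v \<in> I" for r using I by (simp add: two_sided_ideal_def)
    then have "r \<in> I" for r using v(2) by (simp add: mult.assoc)
    then show ?thesis by blast
  qed simp
  then have "quaternion_algebra \<iota>"
    unfolding quaternion_algebra_def
    using center_is_range_if_noncommutative[OF quad large3 nc] dim_4_if_noncommutative[OF quad large3 nc] by blast
  then show ?thesis by (simp add: quadratic_type_def Let_def quaternion_algebra_def)
qed

end

subsection \<open>Columns and matrices over a division algebra\<close>

definition scale_vec :: "('f::field \<Rightarrow> 'd::division_ring) \<Rightarrow> 'f \<Rightarrow> 'd^'n \<Rightarrow> 'd^'n" where
  "scale_vec \<iota> c x = (\<chi> i. \<iota> c * x $ i)"

lemma axis_add: "axis i (a + b) = axis i a + axis i (b :: 'a::monoid_add)"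
  by (simp add: vec_eq_iff axis_def)

text \<open>The action on the entries is left general, so that the lemma applies once to columns and
  once more to matrices seen as vectors of rows.\<close>

lemma finite_dimensional_vec:
  fixes s :: "'f::field \<Rightarrow> 'a::ab_group_add \<Rightarrow> 'a"
  assumes "finite_dimensional_vector_space s B"
  shows "\<exists>B'. finite_dimensional_vector_space (\<lambda>c (v :: 'a^'n). \<chi> i. s c (v $ i)) B'"
proof -
  interpret a: finite_dimensional_vector_space s B by fact
  let ?s = "\<lambda>c (v :: 'a^'n). \<chi> i. s c (v $ i)"
  interpret v: vector_space ?s
    by unfold_locales (auto simp: vec_eq_iff a.scale_right_distrib a.scale_left_distrib)
  let ?S = "(\<lambda>(i :: 'n, b). axis i b) ` (UNIV \<times> B)"
  have lin: "Vector_Spaces.linear s ?s (axis i)" for i :: 'n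
    unfolding Vector_Spaces.linear_iff
    by (simp add: axis_add a.vector_space_axioms v.vector_space_axioms) (simp add: vec_eq_iff axis_def)
  have ax: "axis i x \<in> v.span ?S" for i :: 'n and x
  proof -
    interpret l: Vector_Spaces.linear s ?s "axis i" by (rule lin)
    have "x \<in> a.span B" unfolding a.span_Basis by (rule UNIV_I)
    then have "axis i x \<in> v.span (axis i ` B)" unfolding l.span_image by (rule imageI)
    moreover have "axis i ` B \<subseteq> ?S" by force
    ultimately show ?thesis using v.span_mono by blast
  qed
  have "x \<in> v.span ?S" for x :: "'a^'n"
  proof -
    have "(\<Sum>i\<in>UNIV. axis i (x $ i)) = x"
      by (simp add: vec_eq_iff axis_def if_distrib sum.delta cong: if_cong)
    moreover have "(\<Sum>i\<in>UNIV. axis i (x $ i)) \<in> v.span ?S" by (rule v.span_sum) (rule ax)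
    ultimately show ?thesis by (simp only:)
  qed
  then have "v.span ?S = UNIV" by (intro subset_antisym subset_UNIV subsetI)
  moreover have "finite ?S" using a.finite_Basis by simp
  ultimately show ?thesis
    by (intro finite_dimensional_if_finite_span[OF v.vector_space_axioms])
qed

text \<open>Columns form a right space over \<open>D\<close>: matrices act from the left and commute
  with multiplication from the right.\<close>

definition scale_right :: "'d::division_ring^'n \<Rightarrow> 'd \<Rightarrow> 'd^'n" where
  "scale_right x a = (\<chi> i. x $ i * a)"

lemma matrix_vector_scale_right: "A *v scale_right x a = scale_right (A *v x) a"
  by (simp add: vec_eq_iff scale_right_def matrix_vector_mult_def sum_distrib_right mult.assoc)

lemma matrix_vector_nth: "(A *v x) $ i = (\<Sum>j\<in>UNIV. A $ i $ j * x $ j)"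
  by (simp add: matrix_vector_mult_def)

lemma matrix_vector_axis: "(A *v axis j a) $ i = A $ i $ j * a"
  by (simp add: matrix_vector_nth axis_def if_distrib[of "(*) _"] sum.delta' cong: if_cong)

context central_algebra
begin

definition vec_basis :: "('d^'n) set" where
  "vec_basis = (SOME B. finite_dimensional_vector_space (scale_vec \<iota> :: _ \<Rightarrow> 'd^'n \<Rightarrow> _) B)"

definition mat_basis :: "('d^'n^'n) set" where
  "mat_basis = (SOME B. finite_dimensional_vector_space (scale_mat \<iota> :: _ \<Rightarrow> 'd^'n^'n \<Rightarrow> _) B)"

lemma scale_vec_alt: "scale_vec \<iota> = (\<lambda>c v. \<chi> i. scale_ring \<iota> c (v $ i))"
  by (simp add: fun_eq_iff scale_vec_def scale_ring_def)

lemma scale_mat_alt: "scale_mat \<iota> = (\<lambda>c v. \<chi> i. scale_vec \<iota> c (v $ i))"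
  by (simp add: fun_eq_iff scale_vec_def scale_mat_def vec_eq_iff)

lemma vec_basis: "finite_dimensional_vector_space (scale_vec \<iota> :: _ \<Rightarrow> 'd^'n \<Rightarrow> _) vec_basis"
  unfolding vec_basis_def scale_vec_alt
  by (rule someI_ex, rule finite_dimensional_vec, rule D.finite_dimensional_vector_space_axioms)

lemma mat_basis: "finite_dimensional_vector_space (scale_mat \<iota> :: _ \<Rightarrow> 'd^'n^'n \<Rightarrow> _) mat_basis"
  unfolding mat_basis_def scale_mat_alt
  by (rule someI_ex, rule finite_dimensional_vec, rule vec_basis)

sublocale V: finite_dimensional_vector_space "scale_vec \<iota> :: 'f \<Rightarrow> 'd^'n \<Rightarrow> 'd^'n" vec_basis
  by (rule vec_basis)

sublocale M: finite_dimensional_vector_space "scale_mat \<iota> :: 'f \<Rightarrow> 'd^'n^'n \<Rightarrow> 'd^'n^'n" mat_basis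
  by (rule mat_basis)

lemma scale_vec_nth: "scale_vec \<iota> c x $ i = \<iota> c * x $ i"
  by (simp add: scale_vec_def)

lemma scale_mat_nth: "scale_mat \<iota> c A $ i $ j = \<iota> c * A $ i $ j"
  by (simp add: scale_mat_def)

lemma scale_mat_vector: "scale_mat \<iota> c A *v x = scale_vec \<iota> c (A *v x)"
  by (simp add: vec_eq_iff scale_mat_nth scale_vec_nth matrix_vector_nth sum_distrib_left mult.assoc)

lemma matrix_scale_vec: "A *v scale_vec \<iota> c x = scale_vec \<iota> c (A *v x)"
  by (simp only: vec_eq_iff scale_vec_nth matrix_vector_nth sum_distrib_left embed_left_commute[of "A $ _ $ _"]) simp

lemma scale_mat_mult_left: "scale_mat \<iota> c A ** B = scale_mat \<iota> c (A ** B)"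
  by (simp add: vec_eq_iff scale_mat_nth matrix_matrix_mult_def sum_distrib_left mult.assoc)

lemma scale_mat_mult_right: "A ** scale_mat \<iota> c B = scale_mat \<iota> c (A ** B)"
  by (simp add: vec_eq_iff scale_mat_nth matrix_matrix_mult_def sum_distrib_left embed_left_commute[of "A $ _ $ _"])

lemma linear_eval: "Vector_Spaces.linear (scale_mat \<iota>) (scale_vec \<iota>) (\<lambda>A. A *v x)"
  unfolding Vector_Spaces.linear_iff
  by (simp add: M.vector_space_axioms V.vector_space_axioms matrix_vector_mult_add_rdistrib scale_mat_vector)

lemma linear_nth: "Vector_Spaces.linear (scale_vec \<iota>) (scale_ring \<iota>) (\<lambda>x. x $ i)"
  unfolding Vector_Spaces.linear_iff
  by (simp add: D.vector_space_axioms V.vector_space_axioms scale_vec_nth scale_ring_def)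

lemma linear_mult_vector: "Vector_Spaces.linear (scale_vec \<iota>) (scale_vec \<iota>) (\<lambda>x. A *v x)"
  unfolding Vector_Spaces.linear_iff
  by (simp add: V.vector_space_axioms matrix_vector_right_distrib matrix_scale_vec)

lemma matrix_add_mult: "(A + B) ** C = A ** C + B ** (C :: 'd^'n^'n)"
  by (simp add: vec_eq_iff matrix_matrix_mult_def distrib_right sum.distrib)

lemma linear_conj:
  fixes R P :: "'d^'n^'n"
  shows "Vector_Spaces.linear (scale_mat \<iota>) (scale_mat \<iota>) (\<lambda>A. R ** A ** P)"
  unfolding Vector_Spaces.linear_iff
  by (simp add: M.vector_space_axioms matrix_add_ldistrib matrix_add_mult scale_mat_mult_right scale_mat_mult_left)

lemma vec_subspace_iff:
  "V.subspace S \<longleftrightarrow> 0 \<in> S \<and> (\<forall>x\<in>S. \<forall>y\<in>S. x + y \<in> S) \<and> (\<forall>c. \<forall>x\<in>S. scale_vec \<iota> c x \<in> S)"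
  by (simp add: V.subspace_def)

lemma mat_subspace_iff:
  "M.subspace S \<longleftrightarrow> 0 \<in> S \<and> (\<forall>x\<in>S. \<forall>y\<in>S. x + y \<in> S) \<and> (\<forall>c. \<forall>x\<in>S. scale_mat \<iota> c x \<in> S)"
  by (simp add: M.subspace_def)

text \<open>
  If \<open>N *v w\<close> were outside the range, then by maximality of the rank every scalar would be an eigenvalue
  of the pencil spanned by the evaluations at \<open>w\<close> and \<open>z\<close>, modulo \<open>N *v w\<close>.
\<close>

lemma annihilator_maps_into_range:
  fixes W :: "('d^'n^'n) set"
  assumes W: "M.subspace W"
    and max: "\<And>w. V.dim ((\<lambda>A. A *v w) ` W) \<le> V.dim ((\<lambda>A. A *v z) ` W)"
    and large: "large_field TYPE('f) (Suc (V.dim ((\<lambda>A. A *v z) ` W)))"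
    and N: "N \<in> W" "N *v z = 0"
  shows "N *v w \<in> (\<lambda>A. A *v z) ` W"
proof (rule ccontr)
  let ?r = "V.dim ((\<lambda>A. A *v z) ` W)" and ?K = "{A \<in> W. A *v z = 0}"
  assume Nw: "N *v w \<notin> (\<lambda>A. A *v z) ` W"
  interpret p: finite_dimensional_vector_space_pair_1
    "scale_mat \<iota> :: 'f \<Rightarrow> 'd^'n^'n \<Rightarrow> _" mat_basis "scale_vec \<iota> :: 'f \<Rightarrow> 'd^'n \<Rightarrow> _" by unfold_locales
  interpret lz: Vector_Spaces.linear "scale_mat \<iota>" "scale_vec \<iota>" "\<lambda>A. A *v z" by (rule linear_eval)
  have Kz: "M.subspace ?K"
    using M.subspace_inter[OF W lz.subspace_kernel] by (simp add: Collect_conj_eq)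
  have image_sub: "V.subspace ((\<lambda>A. A *v z) ` W)" using lz.subspace_image[OF W] .
  then have Nw0: "N *v w \<noteq> 0" using Nw V.subspace_0[OF image_sub] by auto
  then have N0: "N \<noteq> 0" by auto
  \<comment> \<open>On \<open>U\<close> evaluation at \<open>z\<close> is injective, so
    \<open>U\<close> has the dimension of the range.\<close>
  obtain U where U: "M.subspace U" "U \<subseteq> W" "U \<inter> ?K = {0}" "M.dim W = M.dim U + M.dim ?K"
    by (rule M.exists_linear_complement[OF Kz W]) auto
  have dimU: "M.dim U = ?r" using p.rank_nullity[OF W linear_eval, of z] U(4) by linarith
  have NU: "N \<notin> U" using N N0 U(3) by blast
  obtain \<Lambda> :: "'f set" where \<Lambda>: "finite \<Lambda>" "card \<Lambda> = Suc ?r" using finite_scalars[OF large] by blast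
  have "card \<Lambda> \<le> M.dim U"
  proof (rule p.card_pencil_eigenvalues[OF U(1) V.subspace_span linear_eval linear_eval _ \<Lambda>(1)])
    fix u assume u: "u \<in> U" "u *v z \<in> V.span {N *v w}"
    then obtain c where c: "u *v z = scale_vec \<iota> c (N *v w)" by (auto simp: V.span_singleton)
    have "c = 0"
    proof (rule ccontr)
      assume "c \<noteq> 0"
      then have "N *v w = scale_vec \<iota> (inverse c) (u *v z)" unfolding c V.scale_scale by simp
      also have "\<dots> \<in> (\<lambda>A. A *v z) ` W"
        using image_sub u(1) U(2) by (intro V.subspace_scale) auto
      finally show False using Nw by simp
    qed
    then have "u \<in> U \<inter> ?K" using c u(1) U(2) by auto
    then show "u = 0" using U(3) by simp
  next
    fix c
    let ?y = "w - scale_vec \<iota> c z"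
    \<comment> \<open>One dimension larger than the maximal rank, so evaluation at \<open>?y\<close>
      has a nonzero kernel on it.\<close>
    let ?U = "M.span (insert N U)"
    have UW: "?U \<subseteq> W" using N(1) U(2) W by (intro M.span_minimal) auto
    have spU: "M.span U = U" using U(1) M.span_eq_iff by blast
    have "M.dim ?U = Suc ?r" unfolding M.dim_span M.dim_insert spU using NU dimU by simp
    moreover have "V.dim ((\<lambda>A. A *v ?y) ` ?U) \<le> ?r"
      using V.dim_subset[OF image_mono[OF UW, of "\<lambda>A. A *v ?y"]] max[of ?y] by linarith
    ultimately have "M.dim {A \<in> ?U. A *v ?y = 0} \<noteq> 0"
      using p.rank_nullity[OF M.subspace_span linear_eval, of "insert N U" ?y] by linarith
    then obtain X where X: "X \<in> ?U" "X *v ?y = 0" "X \<noteq> 0" unfolding M.dim_eq_0 by blast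
    obtain t where t: "X - scale_mat \<iota> t N \<in> U" using X(1) unfolding M.span_insert spU by blast
    \<comment> \<open>The part of \<open>X\<close> in \<open>U\<close>. If it were 0, then
      \<open>X\<close> would be a multiple of \<open>N\<close>, which does not kill
      \<open>?y\<close> unless the multiple is 0.\<close>
    define u where "u = X - scale_mat \<iota> t N"
    have "u *v w - scale_vec \<iota> c (u *v z) = u *v ?y"
      by (simp add: matrix_vector_mult_diff_distrib matrix_scale_vec)
    also have "\<dots> = - scale_vec \<iota> t (N *v w)"
      using X(2) N(2) by (simp add: u_def matrix_vector_mult_diff_rdistrib scale_mat_vector matrix_vector_mult_diff_distrib[of N] matrix_scale_vec[of N])
    finally have eq: "u *v w - scale_vec \<iota> c (u *v z) = - scale_vec \<iota> t (N *v w)" .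
    have "u \<noteq> 0"
    proof
      assume "u = 0"
      then have "scale_vec \<iota> t (N *v w) = 0" using eq by simp
      then have "t = 0" using Nw0 by simp
      then show False using \<open>u = 0\<close> X(3) by (simp add: u_def)
    qed
    moreover have "u *v w - scale_vec \<iota> c (u *v z) \<in> V.span {N *v w}"
      unfolding eq by (intro V.span_neg V.span_scale V.span_base) simp
    ultimately show "\<exists>u\<in>U. u \<noteq> 0 \<and> u *v w - scale_vec \<iota> c (u *v z) \<in> V.span {N *v w}"
      using t u_def by blast
  qed
  then show False using \<Lambda>(2) dimU by simp
qed

end

subsection \<open>Triangular spaces and adapted bases\<close>

text \<open>The index type carries no order, so triangularity refers to an enumeration of it.\<close>

definition idx :: "'n::finite \<Rightarrow> nat" where
  "idx = (SOME e. bij_betw e UNIV {0..<CARD('n)})"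

lemma bij_betw_idx: "bij_betw (idx :: 'n::finite \<Rightarrow> nat) UNIV {0..<CARD('n)}"
  unfolding idx_def by (rule someI_ex[OF ex_bij_betw_finite_nat[OF finite]])

lemma idx_eq_iff [simp]: "idx i = idx j \<longleftrightarrow> i = j"
  using bij_betw_idx by (meson bij_betw_imp_inj_on inj_eq)

lemma idx_less: "idx (i :: 'n::finite) < CARD('n::finite)"
  using bij_betw_idx[where 'n = 'n] by (auto simp: bij_betw_def)

lemma exists_idx:
  assumes "k < CARD('n::finite)"
  obtains m :: "'n::finite" where "idx m = k"
proof -
  have "k \<in> range (idx :: 'n \<Rightarrow> nat)"
    using bij_betw_idx[where 'n = 'n] assms by (simp add: bij_betw_def)
  then show thesis using that by blast
qed

text \<open>The index type cannot shrink during the induction on the size, so objects of size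
  \<open>k\<close> are those supported on the first \<open>k\<close> indices.\<close>

definition vec_supp :: "nat \<Rightarrow> ('d::division_ring^'n) set" where
  "vec_supp k = {x. \<forall>i. k \<le> idx i \<longrightarrow> x $ i = 0}"

definition mat_supp :: "nat \<Rightarrow> ('d::division_ring^'n^'n) set" where
  "mat_supp k = {A. \<forall>i j. k \<le> idx i \<or> k \<le> idx j \<longrightarrow> A $ i $ j = 0}"

text \<open>The model spaces: upper triangular in the leading block, with the diagonal entry at
  \<open>i\<close> in the kernel of the form \<open>h i\<close>, which may depend on the
  position.\<close>

definition triangular :: "('n::finite \<Rightarrow> 'd::division_ring \<Rightarrow> 'f::zero) \<Rightarrow> nat \<Rightarrow> ('d^'n^'n) set" where
  "triangular h k = {A \<in> mat_supp k. (\<forall>i j. idx j < idx i \<longrightarrow> A $ i $ j = 0) \<and> (\<forall>i. idx i < k \<longrightarrow> h i (A $ i $ i) = 0)}"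

text \<open>For a linear space \<open>W\<close> this means that the translate of \<open>W\<close> by
  the identity consists of invertible matrices.\<close>

definition trivial_spectrum :: "('d::division_ring^'n^'n) set \<Rightarrow> bool" where
  "trivial_spectrum W \<longleftrightarrow> (\<forall>A\<in>W. \<forall>x. A *v x = x \<longrightarrow> x = 0)"

text \<open>The base changes of the induction, which act on the first \<open>k\<close> coordinates
  and leave the others alone.\<close>

definition block_id :: "nat \<Rightarrow> ('d::division_ring^'n^'n) \<Rightarrow> bool" where
  "block_id k P \<longleftrightarrow> P - mat 1 \<in> mat_supp k"

text \<open>In closed form \<open>d * k * (k + 1) / 2 - k\<close> for positive \<open>d\<close>:
  each new column brings a hyperplane of its entries.\<close>

fun optimal_dim :: "nat \<Rightarrow> nat \<Rightarrow> nat" where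
  "optimal_dim d 0 = 0"
| "optimal_dim d (Suc k) = optimal_dim d k + (Suc k * d - 1)"

lemma mat_supp_mult_left: "A \<in> mat_supp k \<Longrightarrow> B \<in> mat_supp k \<Longrightarrow> A ** B \<in> mat_supp k"
  by (auto simp: mat_supp_def matrix_matrix_mult_def)

lemma mat_supp_add: "A \<in> mat_supp k \<Longrightarrow> B \<in> mat_supp k \<Longrightarrow> A + B \<in> mat_supp k"
  by (simp add: mat_supp_def)

lemma mat_supp_mono: "k \<le> l \<Longrightarrow> mat_supp k \<subseteq> mat_supp l"
  by (auto simp: mat_supp_def)

lemma mat_supp_vector: "A \<in> mat_supp k \<Longrightarrow> A *v x \<in> vec_supp k"
  by (auto simp: mat_supp_def vec_supp_def matrix_vector_nth)

lemma matrix_diff_mult: "(A - B) ** C = A ** C - B ** (C :: 'd::division_ring^'n^'n)"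
  by (simp add: vec_eq_iff matrix_matrix_mult_def left_diff_distrib sum_subtractf)

lemma matrix_mult_diff: "C ** (A - B) = C ** A - C ** (B :: 'd::division_ring^'n^'n)"
  by (simp add: vec_eq_iff matrix_matrix_mult_def right_diff_distrib sum_subtractf)

lemma block_id_mono: "block_id k P \<Longrightarrow> k \<le> l \<Longrightarrow> block_id l P"
  using mat_supp_mono by (auto simp: block_id_def)

text \<open>The matrix \<open>R - mat 1\<close> is minus the product of \<open>?N\<close> and
  \<open>R\<close> in either order; one order clears the rows, the other the columns.\<close>

lemma block_id_inverse:
  assumes P: "block_id k P" and inv: "P ** R = mat 1" "R ** P = mat 1"
  shows "block_id k R"
proof -
  let ?N = "P - mat 1"
  have "R - mat 1 = - (?N ** R)" "R - mat 1 = - (R ** ?N)"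
    by (simp_all add: matrix_diff_mult matrix_mult_diff inv)
  moreover have "(?N ** R) $ i $ j = 0" if "k \<le> idx i" for i j
    using P that by (simp add: block_id_def mat_supp_def matrix_matrix_mult_def)
  moreover have "(R ** ?N) $ i $ j = 0" if "k \<le> idx j" for i j
    using P that by (simp add: block_id_def mat_supp_def matrix_matrix_mult_def)
  ultimately have "(R - mat 1) $ i $ j = 0" if "k \<le> idx i \<or> k \<le> idx j" for i j
    using that by (metis uminus_apply neg_0_equal_iff_equal vector_uminus_component)
  then show ?thesis by (simp add: block_id_def mat_supp_def)
qed

lemma mat_supp_conj:
  assumes A: "A \<in> mat_supp k" and P: "block_id k P" and R: "block_id k R"
  shows "R ** A ** P \<in> mat_supp k"
proof -
  have *: "B ** P \<in> mat_supp k" if "B \<in> mat_supp k" for B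
  proof -
    have "B ** P = B ** (P - mat 1) + B" by (simp add: matrix_mult_diff)
    then show ?thesis using that P by (simp add: block_id_def mat_supp_add mat_supp_mult_left)
  qed
  have "R ** A = (R - mat 1) ** A + A" by (simp add: matrix_diff_mult)
  then have "R ** A \<in> mat_supp k" using A R by (simp add: block_id_def mat_supp_add mat_supp_mult_left)
  then show ?thesis by (rule *)
qed

lemma block_id_mult:
  assumes "block_id k P" "block_id k Q"
  shows "block_id k (P ** Q)"
proof -
  have "P ** Q - mat 1 = (P - mat 1) ** (Q - mat 1) + (P - mat 1) + (Q - mat 1)"
    by (simp add: matrix_diff_mult matrix_mult_diff)
  then show ?thesis
    using mat_supp_add[OF mat_supp_add[OF mat_supp_mult_left]] assms by (simp only: block_id_def)
qed

lemma block_id_vector: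
  assumes "block_id k P" "k \<le> idx i"
  shows "(P *v x) $ i = x $ i"
proof -
  have "((P - mat 1) *v x) $ i = 0" using assms by (simp add: block_id_def mat_supp_def matrix_vector_nth)
  then show ?thesis by (simp add: matrix_vector_mult_diff_rdistrib)
qed

lemma block_id_axis:
  assumes "block_id k P" "k \<le> idx m"
  shows "P *v axis m a = axis m a"
proof -
  have "(P - mat 1) *v axis m a = 0"
    using assms by (simp add: vec_eq_iff matrix_vector_axis block_id_def mat_supp_def)
  then show ?thesis by (simp add: matrix_vector_mult_diff_rdistrib)
qed

context central_algebra
begin

lemma subspace_vec_supp: "V.subspace (vec_supp k)"
  by (simp add: vec_subspace_iff vec_supp_def scale_vec_nth)

lemma dim_vec_supp: "k \<le> CARD('n::finite) \<Longrightarrow> V.dim (vec_supp k :: ('d^'n) set) = k * D.dim UNIV"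
proof (induction k)
  case 0
  have "(vec_supp 0 :: ('d^'n) set) = {0}" by (auto simp: vec_supp_def vec_eq_iff)
  then show ?case by simp
next
  case (Suc k)
  obtain m :: 'n where m: "idx m = k" using exists_idx[of k, where 'n = 'n] Suc.prems by auto
  interpret p: finite_dimensional_vector_space_pair_1
    "scale_vec \<iota> :: 'f \<Rightarrow> 'd^'n \<Rightarrow> _" vec_basis "scale_ring \<iota>" by unfold_locales
  have "(\<lambda>x. x $ m) ` (vec_supp (Suc k) :: ('d^'n) set) = UNIV"
  proof -
    have "axis m a \<in> vec_supp (Suc k)" for a :: 'd using m by (auto simp: vec_supp_def axis_def)
    moreover have "axis m a $ m = a" for a :: 'd by (simp add: axis_def)
    ultimately show ?thesis unfolding image_def by (metis (mono_tags, lifting) UNIV_eq_I mem_Collect_eq)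
  qed
  moreover have "{x \<in> vec_supp (Suc k). x $ m = 0} = (vec_supp k :: ('d^'n) set)"
  proof -
    have "k \<le> idx i \<longleftrightarrow> Suc k \<le> idx i \<or> i = m" for i
      using m idx_eq_iff[of i m] by linarith
    then show ?thesis unfolding vec_supp_def by blast
  qed
  moreover have "V.dim (vec_supp k :: ('d^'n) set) = k * D.dim UNIV" using Suc by simp
  ultimately show ?case
    using p.rank_nullity[OF subspace_vec_supp linear_nth, of "Suc k" m] by (simp only: mult_Suc)
qed

lemma linear_form_nth:
  assumes f: "form f"
  shows "Vector_Spaces.linear (scale_vec \<iota>) (*) (\<lambda>x. f (x $ i))"
  unfolding Vector_Spaces.linear_iff
  by (simp add: V.vector_space_axioms vector_space_over_itself.vector_space_axioms scale_vec_nth form_add[OF f] form_scale[OF f])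

lemma subspace_hyperplane:
  assumes f: "form f"
  shows "V.subspace {x \<in> vec_supp k. f (x $ m) = 0}"
  by (simp add: vec_subspace_iff vec_supp_def scale_vec_nth form_add[OF f] form_scale[OF f] form_0[OF f])

lemma dim_hyperplane:
  assumes f: "form f" "f 1 = 1" and m: "idx (m :: 'n::finite) = k"
  shows "V.dim {x \<in> vec_supp (Suc k) :: ('d^'n) set. f (x $ m) = 0} = Suc k * D.dim UNIV - 1"
proof -
  have "V.dim {x \<in> vec_supp (Suc k) :: ('d^'n) set. f (x $ m) = 0} + 1 = V.dim (vec_supp (Suc k) :: ('d^'n) set)"
  proof (rule V.dim_kernel_form[OF subspace_vec_supp linear_form_nth[OF f(1)]])
    show "axis m 1 \<in> vec_supp (Suc k)" using m by (auto simp: vec_supp_def axis_def)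
    show "f (axis m 1 $ m) \<noteq> 0" using f by (simp add: axis_def)
  qed
  moreover have "Suc k \<le> CARD('n)" using idx_less[of m] m by simp
  ultimately show ?thesis using dim_vec_supp[of "Suc k", where 'n = 'n] by simp
qed

lemma subspace_triangular:
  assumes "\<And>i. form (h i)"
  shows "M.subspace (triangular h k)"
  by (simp add: mat_subspace_iff triangular_def mat_supp_def scale_mat_nth form_add[OF assms] form_scale[OF assms] form_0[OF assms])

lemma triangular_eval_axis:
  assumes h: "\<And>i. form (h i)" and m: "idx (m :: 'n::finite) = k"
  shows "(\<lambda>A. A *v axis m 1) ` triangular h (Suc k) = {x \<in> vec_supp (Suc k) :: ('d^'n) set. h m (x $ m) = 0}"
proof
  show "(\<lambda>A. A *v axis m 1) ` triangular h (Suc k) \<subseteq> {x \<in> vec_supp (Suc k). h m (x $ m) = 0}"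
    using m by (auto simp: triangular_def mat_supp_vector matrix_vector_axis)
  show "{x \<in> vec_supp (Suc k). h m (x $ m) = 0} \<subseteq> (\<lambda>A. A *v axis m 1) ` triangular h (Suc k)"
  proof
    fix x :: "'d^'n" assume x: "x \<in> {x \<in> vec_supp (Suc k). h m (x $ m) = 0}"
    let ?A = "(\<chi> i j. if j = m then x $ i else 0) :: 'd^'n^'n"
    have "?A \<in> triangular h (Suc k)"
      using x m form_0[OF h] by (auto simp: triangular_def mat_supp_def vec_supp_def)
    moreover have "?A *v axis m 1 = x" by (simp add: vec_eq_iff matrix_vector_axis)
    ultimately show "x \<in> (\<lambda>A. A *v axis m 1) ` triangular h (Suc k)" by (metis image_eqI)
  qed
qed

lemma triangular_kernel:
  fixes h :: "'n::finite \<Rightarrow> 'd \<Rightarrow> 'f"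
  assumes h: "\<And>i. form (h i)" and m: "idx m = k"
  shows "{A \<in> triangular h (Suc k). A *v axis m 1 = 0} = triangular h k"
proof (rule set_eqI)
  fix A :: "'d^'n^'n"
  have col: "A *v axis m 1 = 0 \<longleftrightarrow> (\<forall>i. A $ i $ m = 0)"
    by (simp add: vec_eq_iff matrix_vector_axis)
  have eq_m: "i = m" if "k \<le> idx i" "\<not> Suc k \<le> idx i" for i
    using that m idx_eq_iff[of i m] by linarith
  show "A \<in> {A \<in> triangular h (Suc k). A *v axis m 1 = 0} \<longleftrightarrow> A \<in> triangular h k"
  proof
    assume "A \<in> {A \<in> triangular h (Suc k). A *v axis m 1 = 0}"
    then have A: "A \<in> triangular h (Suc k)" and zero: "\<And>i. A $ i $ m = 0" using col by auto
    have "A $ i $ j = 0" if ij: "k \<le> idx i \<or> k \<le> idx j" for i j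
    proof (cases "Suc k \<le> idx i \<or> Suc k \<le> idx j \<or> j = m")
      case True
      then show ?thesis using A zero by (auto simp: triangular_def mat_supp_def)
    next
      case False
      then have "\<not> k \<le> idx j" "i = m" using eq_m ij by blast+
      then have "idx j < idx i" using m by simp
      then show ?thesis using A by (simp add: triangular_def)
    qed
    then have "A \<in> mat_supp k" by (simp add: mat_supp_def)
    then show "A \<in> triangular h k" using A by (simp add: triangular_def)
  next
    assume A: "A \<in> triangular h k"
    then have supp: "A \<in> mat_supp k" by (simp add: triangular_def)
    then have "A \<in> mat_supp (Suc k)" using mat_supp_mono[of k "Suc k"] by auto
    moreover have zero: "A $ i $ m = 0" for i using supp m by (simp add: mat_supp_def)
    moreover have "h i (A $ i $ i) = 0" if "idx i < Suc k" for i
    proof (cases "idx i < k")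
      case True
      then show ?thesis using A by (simp add: triangular_def)
    next
      case False
      then have "i = m" using eq_m that by simp
      then show ?thesis using zero form_0[OF h] by simp
    qed
    ultimately show "A \<in> {A \<in> triangular h (Suc k). A *v axis m 1 = 0}"
      using A col by (simp add: triangular_def)
  qed
qed

text \<open>Rank-nullity for evaluation at the last basis column mirrors the recursion: the image is
  a hyperplane and the kernel is the model space of the next smaller size.\<close>

lemma dim_triangular:
  assumes h: "\<And>i. form (h i)" "\<And>i. h i 1 = 1"
  shows "k \<le> CARD('n::finite) \<Longrightarrow> M.dim (triangular h k :: ('d^'n^'n) set) = optimal_dim (D.dim UNIV) k"
proof (induction k)
  case 0
  have "(triangular h 0 :: ('d^'n^'n) set) = {0}"
    by (auto simp: triangular_def mat_supp_def vec_eq_iff)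
  then show ?case by simp
next
  case (Suc k)
  obtain m :: 'n where m: "idx m = k" using exists_idx[of k, where 'n = 'n] Suc.prems by auto
  interpret p: finite_dimensional_vector_space_pair_1
    "scale_mat \<iota> :: 'f \<Rightarrow> 'd^'n^'n \<Rightarrow> _" mat_basis "scale_vec \<iota> :: 'f \<Rightarrow> 'd^'n \<Rightarrow> _" by unfold_locales
  show ?case
    using p.rank_nullity[OF subspace_triangular[of h, OF h(1)] linear_eval, of "Suc k" "axis m 1",
        unfolded triangular_eval_axis[of h, OF h(1) m] triangular_kernel[of h, OF h(1) m] dim_hyperplane[OF h m]]
      Suc by simp
qed

text \<open>At the last nonzero coordinate \<open>i\<close> of a fixed column, triangularity forces
  the diagonal entry to be 1, but \<open>h i\<close> does not vanish at 1.\<close>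

lemma trivial_spectrum_triangular:
  fixes h :: "'n::finite \<Rightarrow> 'd \<Rightarrow> 'f"
  assumes h: "\<And>i. form (h i)" "\<And>i. h i 1 = 1"
  shows "trivial_spectrum (triangular h k)"
  unfolding trivial_spectrum_def
proof (intro ballI allI impI, rule ccontr)
  fix A and x :: "'d^'n" assume A: "A \<in> triangular h k" and Ax: "A *v x = x" and "x \<noteq> 0"
  then have ne: "{i. x $ i \<noteq> 0} \<noteq> {}" by (auto simp: vec_eq_iff)
  have "Max (idx ` {i. x $ i \<noteq> 0}) \<in> idx ` {i. x $ i \<noteq> 0}" using ne by (intro Max_in) auto
  then obtain i where i: "x $ i \<noteq> 0" "Max (idx ` {i. x $ i \<noteq> 0}) = idx i" by auto
  have max: "idx j \<le> idx i" if "x $ j \<noteq> 0" for j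
    unfolding i(2)[symmetric] using that by (intro Max_ge) auto
  have "(A *v x) $ i = (\<Sum>j\<in>UNIV. if j = i then A $ i $ i * x $ i else 0)"
    unfolding matrix_vector_nth
  proof (rule sum.cong[OF refl])
    fix j
    show "A $ i $ j * x $ j = (if j = i then A $ i $ i * x $ i else 0)"
    proof (cases "x $ j = 0 \<or> j = i")
      case False
      then have "idx j < idx i" using max[of j] idx_eq_iff[of j i] by linarith
      then show ?thesis using A by (auto simp: triangular_def)
    qed (use i in auto)
  qed
  then have "A $ i $ i * x $ i = x $ i" using Ax by simp
  then have 1: "A $ i $ i = 1" using i by simp
  have "idx i < k"
  proof (rule ccontr)
    assume "\<not> idx i < k"
    then have "A $ i $ i = 0" using A by (simp add: triangular_def mat_supp_def)
    then show False using 1 by simp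
  qed
  then have "h i (A $ i $ i) = 0" using A by (simp add: triangular_def)
  then show False using 1 h(2) by simp
qed

end

subsection \<open>Induction on the size\<close>

text \<open>The product of a row \<open>y\<close> with a column \<open>x\<close>, linear over
  \<open>D\<close> from the left in \<open>y\<close> and from the right in \<open>x\<close>.\<close>

definition dot :: "'d::division_ring^'n \<Rightarrow> 'd^'n \<Rightarrow> 'd" where
  "dot y x = (\<Sum>i\<in>UNIV. y $ i * x $ i)"

lemma dot_scale_right: "dot y (scale_right x a) = dot y x * a"
  by (simp add: dot_def scale_right_def sum_distrib_right mult.assoc)

lemma dot_scale_left: "dot (\<chi> i. a * y $ i) x = a * dot y x"
  by (simp add: dot_def sum_distrib_left mult.assoc)

lemma dot_matrix_vector: "dot y (P *v x) = (\<Sum>j\<in>UNIV. (\<Sum>r\<in>UNIV. y $ r * P $ r $ j) * x $ j)"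
proof -
  have "dot y (P *v x) = (\<Sum>r\<in>UNIV. \<Sum>j\<in>UNIV. y $ r * (P $ r $ j * x $ j))"
    by (simp add: dot_def matrix_vector_nth sum_distrib_left)
  also have "\<dots> = (\<Sum>j\<in>UNIV. \<Sum>r\<in>UNIV. y $ r * (P $ r $ j * x $ j))" by (rule sum.swap)
  finally show ?thesis by (simp add: sum_distrib_right mult.assoc)
qed

definition truncate :: "nat \<Rightarrow> 'd::division_ring^'n::finite \<Rightarrow> 'd^'n" where
  "truncate k x = (\<chi> i. if idx i < k then x $ i else 0)"

lemma truncate_supp: "truncate k x \<in> vec_supp k"
  by (simp add: truncate_def vec_supp_def)

lemma mat_supp_truncate: "A \<in> mat_supp k \<Longrightarrow> A *v truncate k x = A *v x"
  by (auto simp: vec_eq_iff matrix_vector_nth truncate_def mat_supp_def not_less intro!: sum.cong)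

lemma dot_truncate: "x \<in> vec_supp k \<Longrightarrow> dot (truncate k y) x = dot y x"
  by (auto simp: dot_def truncate_def vec_supp_def not_less intro!: sum.cong)

context central_algebra
begin

text \<open>Finite dimension over the scalars makes the map surjective; preimages of the basis
  columns form a right inverse, and injectivity makes it a left inverse as well.\<close>

lemma injective_imp_invertible:
  fixes P :: "'d^'n^'n"
  assumes inj: "\<And>x. P *v x = 0 \<Longrightarrow> x = 0"
  obtains R where "P ** R = mat 1" "R ** P = mat 1"
proof -
  interpret l: Vector_Spaces.linear "scale_vec \<iota>" "scale_vec \<iota>" "(*v) P" by (rule linear_mult_vector)
  have "inj ((*v) P)" unfolding l.inj_iff_eq_0 using inj by blast
  then have "surj ((*v) P)" by (rule V.linear_inj_imp_surj[OF linear_mult_vector])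
  then have "\<exists>c. P *v c = axis j 1" for j by (metis surjD)
  then obtain c where c: "\<And>j. P *v c j = axis j 1" by metis
  define R :: "'d^'n^'n" where "R = (\<chi> i j. c j $ i)"
  have "(P ** R) $ i $ j = (P *v c j) $ i" for i j
    by (simp add: matrix_matrix_mult_def matrix_vector_nth R_def)
  then have PR: "P ** R = mat 1"
    unfolding c by (simp add: vec_eq_iff mat_def axis_def)
  have "P ** (R ** P - mat 1) = 0"
    by (simp add: matrix_mult_diff matrix_mul_assoc PR)
  then have "P *v ((R ** P - mat 1) *v x) = 0" for x by (simp add: matrix_vector_mul_assoc)
  then have "(R ** P - mat 1) *v axis j 1 = 0" for j using inj by blast
  then have "(R ** P - mat 1) $ i $ j = 0" for i j
    by (metis matrix_vector_axis mult_1_right zero_index)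
  then have "R ** P = mat 1" by (simp add: vec_eq_iff)
  with PR that show thesis by blast
qed

lemma exists_adapted_basis:
  fixes z y :: "'d^'n"
  assumes m: "idx m = k" and z: "z \<in> vec_supp (Suc k)" and y: "y \<in> vec_supp (Suc k)" and yz: "dot y z = 1"
  obtains P R where "P ** R = mat 1" "R ** P = mat 1" "block_id (Suc k) P" "P *v axis m 1 = z"
    "\<And>x. dot y (P *v x) = x $ m"
proof -
  have "\<exists>i. y $ i \<noteq> 0"
  proof (rule ccontr)
    assume "\<not> ?thesis"
    then have "dot y z = 0" by (simp add: dot_def)
    then show False using yz by simp
  qed
  then obtain i where i: "y $ i \<noteq> 0" by blast
  \<comment> \<open>Column \<open>m\<close> is reserved for \<open>z\<close>. The transposition of
    \<open>m\<close> and the pivot \<open>i\<close> lets the remaining columns correspond to the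
    coordinates other than \<open>i\<close>.\<close>
  define \<pi> where "\<pi> j = (if j = m then i else if j = i then m else j)" for j
  have \<pi>\<pi>: "\<pi> (\<pi> j) = j" for j by (simp add: \<pi>_def)
  have \<pi>_eq: "\<pi> j = i \<longleftrightarrow> j = m" for j by (auto simp: \<pi>_def)
  \<comment> \<open>Besides \<open>z\<close>, the columns are basis columns corrected at the pivot
    so that \<open>y\<close> kills them.\<close>
  define P :: "'d^'n^'n" where
    "P = (\<chi> r j. if j = m then z $ r
       else (if r = \<pi> j then 1 else 0) - (if r = i then inverse (y $ i) * y $ \<pi> j else 0))"
  have P_m: "P $ r $ m = z $ r" for r by (simp add: P_def)
  have col: "(\<Sum>r\<in>UNIV. y $ r * P $ r $ j) = (if j = m then 1 else 0)" for j
  proof (cases "j = m")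
    case True
    then show ?thesis using yz by (simp add: P_m dot_def)
  next
    case False
    then have "(\<Sum>r\<in>UNIV. y $ r * P $ r $ j)
        = (\<Sum>r\<in>UNIV. (if r = \<pi> j then y $ r else 0) - (if r = i then y $ i * (inverse (y $ i) * y $ \<pi> j) else 0))"
      by (intro sum.cong) (auto simp: P_def right_diff_distrib)
    also have "\<dots> = y $ \<pi> j - y $ i * (inverse (y $ i) * y $ \<pi> j)"
      by (simp add: sum_subtractf)
    also have "\<dots> = 0" using i by (simp flip: mult.assoc)
    finally show ?thesis using False by simp
  qed
  have dotP: "dot y (P *v x) = x $ m" for x
  proof -
    have "dot y (P *v x) = (\<Sum>j\<in>UNIV. if j = m then x $ m else 0)"
      unfolding dot_matrix_vector col by (intro sum.cong) auto
    then show ?thesis by simp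
  qed
  have inj: "x = 0" if x: "P *v x = 0" for x
  proof -
    have xm: "x $ m = 0" using dotP[of x] x by (simp add: dot_def)
    have "x $ j = 0" if j: "j \<noteq> m" for j
    proof -
      have "\<pi> j \<noteq> i" using j \<pi>_eq by simp
      have "P $ \<pi> j $ l * x $ l = (if l = j then x $ j else 0)" for l
      proof (cases "l = m")
        case False
        have "\<pi> j = \<pi> l \<longleftrightarrow> l = j" using \<pi>\<pi> by metis
        then show ?thesis using False \<open>\<pi> j \<noteq> i\<close> by (simp add: P_def)
      qed (use xm j in simp)
      then have "(P *v x) $ \<pi> j = x $ j" unfolding matrix_vector_nth by simp
      then show ?thesis using x by simp
    qed
    then show "x = 0" unfolding vec_eq_iff using xm by (metis zero_index)
  qed
  obtain R where R: "P ** R = mat 1" "R ** P = mat 1" by (rule injective_imp_invertible[OF inj])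
  have "block_id (Suc k) P"
  proof -
    have im: "\<not> Suc k \<le> idx i" "\<not> Suc k \<le> idx m" using i y m by (auto simp: vec_supp_def)
    have fix_\<pi>: "\<pi> r = r" if "Suc k \<le> idx r" for r
      using that im by (auto simp: \<pi>_def)
    have "P $ r $ j = (if r = j then 1 else 0)" if rj: "Suc k \<le> idx r \<or> Suc k \<le> idx j" for r j
    proof (cases "Suc k \<le> idx r")
      case True
      have "r \<noteq> i" "r \<noteq> m" "z $ r = 0" using True im z by (auto simp: vec_supp_def)
      moreover have "r = \<pi> j \<longleftrightarrow> r = j" using fix_\<pi>[OF True] \<pi>\<pi> by metis
      ultimately show ?thesis by (auto simp: P_def)
    next
      case False
      then have j: "Suc k \<le> idx j" using rj by simp
      then have "j \<noteq> m" "y $ \<pi> j = 0" "\<pi> j = j" using im y fix_\<pi> by (auto simp: vec_supp_def)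
      then show ?thesis by (auto simp: P_def)
    qed
    then show ?thesis by (simp add: block_id_def mat_supp_def mat_def)
  qed
  moreover have "P *v axis m 1 = z" by (simp add: vec_eq_iff matrix_vector_axis P_m)
  ultimately show thesis using that[OF R _ _ dotP] by blast
qed

lemma exists_form: obtains f :: "'d \<Rightarrow> 'f" where "form f" "f 1 = 1"
proof -
  have "D.subspace {0}" "1 \<notin> {0 :: 'd}" by simp_all
  then obtain g where "form g" "g 1 = 1" by (rule D.exists_separating_form)
  then show thesis using that by blast
qed

text \<open>Applying \<open>form_represented\<close> to each coordinate turns a form over the
  scalars into a row over \<open>D\<close>, whose kernel is a \<open>D\<close>-hyperplane inside the
  kernel of the form.\<close>

lemma vec_form_represented:
  fixes g :: "'d^'n \<Rightarrow> 'f"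
  assumes f: "form f" "f 1 = 1" and g: "Vector_Spaces.linear (scale_vec \<iota>) (*) g"
  obtains y where "\<And>x. g x = f (dot y x)"
proof -
  interpret g: Vector_Spaces.linear "scale_vec \<iota>" "(*)" g by fact
  have fg: "form (\<lambda>a. g (axis i a))" for i
  proof -
    have "axis i (\<iota> c * a) = scale_vec \<iota> c (axis i a)" for c a
      by (simp add: vec_eq_iff axis_def scale_vec_nth)
    then show ?thesis by (simp add: form_iff axis_add g.add g.scale)
  qed
  have "\<exists>b. \<forall>a. g (axis i a) = f (b * a)" for i
    using form_represented[OF f(1) _ fg[of i], of 1] f(2) by (metis one_neq_zero)
  then obtain b where b: "\<And>i a. g (axis i a) = f (b i * a)" by metis
  have "g x = f (dot (\<chi> i. b i) x)" for x
  proof -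
    have x: "(\<Sum>i\<in>UNIV. axis i (x $ i)) = x"
      by (simp add: vec_eq_iff axis_def if_distrib sum.delta cong: if_cong)
    interpret f: Vector_Spaces.linear "scale_ring \<iota>" "(*)" f by (rule f(1))
    have "g x = (\<Sum>i\<in>UNIV. g (axis i (x $ i)))" by (subst x[symmetric]) (rule g.sum)
    also have "\<dots> = f (dot (\<chi> i. b i) x)" by (simp add: b dot_def f.sum)
    finally show ?thesis .
  qed
  then show thesis using that by blast
qed

lemma exists_vector_of_maximal_rank:
  fixes W :: "('d^'n^'n) set"
  assumes W: "W \<subseteq> mat_supp (Suc k)" and k: "Suc k \<le> CARD('n::finite)"
  obtains z where "z \<in> vec_supp (Suc k)" "z \<noteq> 0"
    "\<And>w. V.dim ((\<lambda>A. A *v w) ` W) \<le> V.dim ((\<lambda>A. A *v z) ` W)"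
proof -
  let ?r = "\<lambda>w. V.dim ((\<lambda>A. A *v w) ` W)"
  have "?r w < Suc (V.dim (UNIV :: ('d^'n) set))" for w by (rule le_imp_less_Suc[OF V.dim_subset[OF subset_UNIV]])
  then have "\<exists>z. \<forall>w. ?r w \<le> ?r z"
    using ex_has_greatest_nat[of "\<lambda>_. True" undefined ?r "Suc (V.dim (UNIV :: ('d^'n) set))"] by blast
  then obtain z where z: "\<And>w. ?r w \<le> ?r z" by blast
  have tr: "(\<lambda>A. A *v truncate (Suc k) w) ` W = (\<lambda>A. A *v w) ` W" for w
    using W by (intro image_cong) (auto simp: mat_supp_truncate)
  show thesis
  proof (cases "truncate (Suc k) z = 0")
    case False
    have "?r w \<le> ?r (truncate (Suc k) z)" for w unfolding tr by (rule z)
    with that[OF truncate_supp False] show thesis by blast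
  next
    case True
    \<comment> \<open>The maximal rank is 0 here, so any nonzero column will do.\<close>
    obtain m :: 'n where m: "idx m = k" using exists_idx[of k, where 'n = 'n] k by auto
    have "(\<lambda>A. A *v z) ` W \<subseteq> {0}" unfolding tr[of z, symmetric] True by auto
    then have r0: "?r z = 0" using V.dim_eq_0 by blast
    have "?r w \<le> ?r (axis m 1)" for w using z[of w] unfolding r0 by linarith
    moreover have "axis m 1 \<in> vec_supp (Suc k)" using m by (auto simp: vec_supp_def axis_def)
    moreover have "axis m (1::'d) \<noteq> 0" by (simp add: axis_eq_0_iff)
    ultimately show thesis using that by blast
  qed
qed

definition conjugate :: "'d^'n^'n \<Rightarrow> 'd^'n^'n \<Rightarrow> ('d^'n^'n) set \<Rightarrow> ('d^'n^'n) set" where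
  "conjugate R P W = (\<lambda>A. R ** A ** P) ` W"

lemma subspace_conjugate: "M.subspace W \<Longrightarrow> M.subspace (conjugate R P W)"
proof -
  interpret l: Vector_Spaces.linear "scale_mat \<iota>" "scale_mat \<iota>" "\<lambda>A. R ** A ** P" by (rule linear_conj)
  show "M.subspace W \<Longrightarrow> ?thesis" unfolding conjugate_def by (rule l.subspace_image)
qed

lemma dim_conjugate:
  fixes P R :: "'d^'n^'n"
  assumes inv: "P ** R = mat 1" "R ** P = mat 1"
  shows "M.dim (conjugate R P W) = M.dim W"
proof -
  interpret p: finite_dimensional_vector_space_pair_1
    "scale_mat \<iota> :: 'f \<Rightarrow> 'd^'n^'n \<Rightarrow> _" mat_basis "scale_mat \<iota> :: 'f \<Rightarrow> 'd^'n^'n \<Rightarrow> _" by unfold_locales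
  have "P ** (R ** A ** P) ** R = (P ** R) ** A ** (P ** R)" for A
    by (simp only: matrix_mul_assoc)
  then have "P ** (R ** A ** P) ** R = A" for A by (simp add: inv)
  then have "inj_on (\<lambda>A. R ** A ** P) X" for X by (intro inj_on_inverseI)
  then show ?thesis unfolding conjugate_def by (rule p.dim_image_eq[OF linear_conj])
qed

lemma trivial_spectrum_conjugate:
  fixes P R :: "'d^'n^'n"
  assumes inv: "P ** R = mat 1" "R ** P = mat 1" and W: "trivial_spectrum W"
  shows "trivial_spectrum (conjugate R P W)"
  unfolding trivial_spectrum_def
proof (intro ballI allI impI)
  fix B x assume "B \<in> conjugate R P W" and Bx: "B *v x = x"
  then obtain A where A: "A \<in> W" "B = R ** A ** P" by (auto simp: conjugate_def)
  have "P *v (B *v x) = A *v (P *v x)"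
    unfolding A(2) matrix_vector_mul_assoc matrix_mul_assoc inv by simp
  then have "A *v (P *v x) = P *v x" unfolding Bx ..
  then have "P *v x = 0" using A(1) W unfolding trivial_spectrum_def by blast
  then have "R *v (P *v x) = 0" by simp
  then show "x = 0" unfolding matrix_vector_mul_assoc inv by simp
qed

text \<open>
  A column \<open>z\<close> of maximal rank becomes the last basis vector and a row \<open>y\<close> killing the range of the
  annihilator of \<open>z\<close> becomes the last coordinate.
\<close>

lemma reduction:
  fixes W :: "('d^'n^'n) set"
  assumes W: "M.subspace W" "W \<subseteq> mat_supp (Suc k)" "trivial_spectrum W"
    and k: "Suc k \<le> CARD('n::finite)" and large: "large_field TYPE('f) (Suc k * D.dim UNIV)"
    and m: "idx m = k"
  obtains P R f where "P ** R = mat 1" "R ** P = mat 1" "block_id (Suc k) P" "form f" "f 1 = 1"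
    "\<And>A. A \<in> conjugate R P W \<Longrightarrow> f ((A *v axis m 1) $ m) = 0"
    "\<And>A. A \<in> conjugate R P W \<Longrightarrow> A *v axis m 1 = 0 \<Longrightarrow> A \<in> mat_supp k"
proof -
  obtain z where z: "z \<in> vec_supp (Suc k)" "z \<noteq> 0"
    "\<And>w. V.dim ((\<lambda>A. A *v w) ` W) \<le> V.dim ((\<lambda>A. A *v z) ` W)"
    using exists_vector_of_maximal_rank[OF W(2) k] by blast
  interpret lz: Vector_Spaces.linear "scale_mat \<iota>" "scale_vec \<iota>" "\<lambda>A. A *v z" by (rule linear_eval)
  let ?Wz = "(\<lambda>A. A *v z) ` W"
  have subWz: "V.subspace ?Wz" using lz.subspace_image[OF W(1)] .
  have "z \<notin> ?Wz" using W(3) z(2) by (auto simp: trivial_spectrum_def)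
  then obtain g where g: "Vector_Spaces.linear (scale_vec \<iota>) (*) g" "\<And>x. x \<in> ?Wz \<Longrightarrow> g x = 0" "g z = 1"
    using V.exists_separating_form[OF subWz] by blast
  have Wz_supp: "?Wz \<subseteq> vec_supp (Suc k)" using W(2) by (auto intro: mat_supp_vector)
  \<comment> \<open>The range misses \<open>z\<close>, so its dimension is below that of the columns
    of this size; this provides the number of scalars that the pencil argument needs.\<close>
  have "V.dim ?Wz \<le> V.dim {x \<in> vec_supp (Suc k). g x = 0}"
    using Wz_supp g(2) by (intro V.dim_subset) blast
  then have "Suc (V.dim ?Wz) \<le> Suc k * D.dim UNIV"
    using V.dim_kernel_form[OF subspace_vec_supp g(1) z(1)] g(3) dim_vec_supp[OF k] by simp
  then have large': "large_field TYPE('f) (Suc (V.dim ?Wz))" using large by (meson order_trans)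
  obtain f0 where f0: "form f0" "f0 1 = 1" using exists_form by blast
  obtain y0 where y0: "\<And>x. g x = f0 (dot y0 x)" using vec_form_represented[OF f0 g(1)] by blast
  define y1 where "y1 = truncate (Suc k) y0"
  have y1: "g x = f0 (dot y1 x)" if "x \<in> vec_supp (Suc k)" for x
    using that by (simp add: y0 y1_def dot_truncate)
  define c where "c = dot y1 z"
  have f0c: "f0 c = 1" using y1[OF z(1)] g(3) by (simp add: c_def)
  then have c: "c \<noteq> 0" using form_0[OF f0(1)] by auto
  \<comment> \<open>The row is normalized to take the value 1 at \<open>z\<close>; the factor
    \<open>c\<close> moves into the form.\<close>
  define y where "y = (\<chi> i. inverse c * y1 $ i)"
  have y: "dot y x = inverse c * dot y1 x" for x unfolding y_def by (rule dot_scale_left)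
  have "dot y z = 1" using c by (simp add: y c_def)
  moreover have "y \<in> vec_supp (Suc k)"
    using truncate_supp[of "Suc k" y0] by (simp add: y_def y1_def vec_supp_def)
  ultimately obtain P R where P: "P ** R = mat 1" "R ** P = mat 1" "block_id (Suc k) P" "P *v axis m 1 = z"
    "\<And>x. dot y (P *v x) = x $ m"
    using exists_adapted_basis[OF m z(1)] by blast
  have R: "block_id (Suc k) R" using block_id_inverse[OF P(3,1,2)] .
  have PB: "P *v (R ** A ** P *v x) = A *v (P *v x)" for A x
    unfolding matrix_vector_mul_assoc matrix_mul_assoc P(1) by simp
  have "form (\<lambda>a. f0 (c * a))" by (rule form_mult_left[OF f0(1)])
  moreover have "f0 (c * 1) = 1" using f0c by simp
  moreover have "f0 (c * (B *v axis m 1) $ m) = 0" if B: "B \<in> conjugate R P W" for B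
  proof -
    obtain A where A: "A \<in> W" "B = R ** A ** P" using B by (auto simp: conjugate_def)
    have "c * (B *v axis m 1) $ m = c * dot y (A *v z)" unfolding P(5)[symmetric] A(2) PB P(4) ..
    also have "\<dots> = dot y1 (A *v z)" using c by (simp add: y flip: mult.assoc)
    finally have eq: "c * (B *v axis m 1) $ m = dot y1 (A *v z)" .
    have Az: "A *v z \<in> ?Wz" using A(1) by blast
    then have "f0 (dot y1 (A *v z)) = 0" using g(2)[OF Az] y1[of "A *v z"] Wz_supp by auto
    then show ?thesis unfolding eq .
  qed
  moreover have "B \<in> mat_supp k" if B: "B \<in> conjugate R P W" and Bm: "B *v axis m 1 = 0" for B
  proof -
    obtain A where A: "A \<in> W" "B = R ** A ** P" using B by (auto simp: conjugate_def)
    have Az: "A *v z = 0" using PB[of A "axis m 1"] Bm unfolding A(2)[symmetric] P(4) by simp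
    have "dot y1 (A *v w) = 0" for w
    proof (rule ccontr)
      assume nz: "dot y1 (A *v w) \<noteq> 0"
      \<comment> \<open>The range condition holds for all columns, hence also for right multiples of
        \<open>w\<close>. Rescaling the nonzero value to 1 contradicts the vanishing of
        \<open>f0\<close>: from a scalar hyperplane one passes to a
        \<open>D\<close>-hyperplane.\<close>
      let ?a = "inverse (dot y1 (A *v w))"
      have "A *v scale_right w ?a \<in> ?Wz"
        by (rule annihilator_maps_into_range[OF W(1) z(3) large' A(1) Az])
      then have "f0 (dot y1 (A *v scale_right w ?a)) = 0" using g(2) y1 Wz_supp by (metis subsetD)
      moreover have "dot y1 (A *v scale_right w ?a) = 1"
        using nz by (simp add: matrix_vector_scale_right dot_scale_right)
      ultimately show False using f0(2) by simp
    qed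
    then have "dot y (A *v w) = 0" for w by (simp add: y)
    then have row: "(B *v x) $ m = 0" for x unfolding P(5)[symmetric] A(2) PB .
    have "B $ m $ j = 0" for j using row[of "axis j 1"] by (simp add: matrix_vector_axis)
    moreover have "B $ i $ m = 0" for i using Bm by (metis matrix_vector_axis mult_1_right zero_index)
    moreover have "B \<in> mat_supp (Suc k)" unfolding A(2) using A(1) W(2) by (intro mat_supp_conj P(3) R) auto
    moreover have "k \<le> idx i \<longleftrightarrow> Suc k \<le> idx i \<or> i = m" for i using m idx_eq_iff[of i m] by linarith
    ultimately show ?thesis unfolding mat_supp_def by (auto)
  qed
  ultimately show thesis using that P(1-3) by blast
qed

text \<open>Rank-nullity at the last basis column after \<open>reduction\<close>: the image lies in
  a hyperplane and the kernel is a space of size \<open>k\<close>.\<close>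

lemma dim_le_optimal_dim:
  fixes W :: "('d^'n^'n) set"
  assumes "M.subspace W" "W \<subseteq> mat_supp k" "trivial_spectrum W"
    and "k \<le> CARD('n::finite)" and "large_field TYPE('f) (k * D.dim UNIV)"
  shows "M.dim W \<le> optimal_dim (D.dim UNIV) k"
  using assms
proof (induction k arbitrary: W)
  case 0
  then have "W \<subseteq> {0}" by (auto simp: mat_supp_def vec_eq_iff)
  then show ?case using M.dim_eq_0 by auto
next
  case (Suc k)
  obtain m :: 'n where m: "idx m = k" using exists_idx[of k, where 'n = 'n] Suc.prems by auto
  obtain P R f where P: "P ** R = mat 1" "R ** P = mat 1" "block_id (Suc k) P" and f: "form f" "f 1 = 1"
    and W1: "\<And>A. A \<in> conjugate R P W \<Longrightarrow> f ((A *v axis m 1) $ m) = 0"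
      "\<And>A. A \<in> conjugate R P W \<Longrightarrow> A *v axis m 1 = 0 \<Longrightarrow> A \<in> mat_supp k"
    using reduction[OF Suc.prems m] by blast
  let ?W = "conjugate R P W"
  interpret p: finite_dimensional_vector_space_pair_1
    "scale_mat \<iota> :: 'f \<Rightarrow> 'd^'n^'n \<Rightarrow> _" mat_basis "scale_vec \<iota> :: 'f \<Rightarrow> 'd^'n \<Rightarrow> _" by unfold_locales
  interpret l: Vector_Spaces.linear "scale_mat \<iota>" "scale_vec \<iota>" "\<lambda>A. A *v axis m 1" by (rule linear_eval)
  have sub: "M.subspace ?W" by (rule subspace_conjugate[OF Suc.prems(1)])
  have supp: "?W \<subseteq> mat_supp (Suc k)"
    unfolding conjugate_def using Suc.prems(2) P(3) block_id_inverse[OF P(3,1,2)] by (auto intro: mat_supp_conj)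
  have ts: "trivial_spectrum ?W" by (rule trivial_spectrum_conjugate[OF P(1,2) Suc.prems(3)])
  have "M.dim {A \<in> ?W. A *v axis m 1 = 0} \<le> optimal_dim (D.dim UNIV) k"
  proof (rule Suc.IH)
    show "M.subspace {A \<in> ?W. A *v axis m 1 = 0}"
      using M.subspace_inter[OF sub l.subspace_kernel] by (simp add: Collect_conj_eq)
    show "trivial_spectrum {A \<in> ?W. A *v axis m 1 = 0}" using ts unfolding trivial_spectrum_def by blast
    show "large_field TYPE('f) (k * D.dim UNIV)" using Suc.prems(5) by (auto intro: order_trans[rotated])
  qed (use W1(2) Suc.prems(4) in auto)
  moreover have "V.dim ((\<lambda>A. A *v axis m 1) ` ?W) \<le> Suc k * D.dim UNIV - 1"
    unfolding dim_hyperplane[OF f m, symmetric]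
    using W1(1) supp by (intro V.dim_subset) (auto intro: mat_supp_vector)
  ultimately show ?case
    using p.rank_nullity[OF sub linear_eval, of "axis m 1"] dim_conjugate[OF P(1,2), of W] by simp
qed

text \<open>
  The rows \<open>p\<close> and \<open>m\<close> of \<open>A *v x\<close>, together with the corresponding entries of the last column, behave
  like the two-dimensional case, because the triangular part adjusts the other coordinates of
  a fixed vector at will.
\<close>

lemma bottom_row_zero:
  fixes W :: "('d^'n^'n) set" and x :: "'d^'n"
  assumes W: "M.subspace W" "W \<subseteq> mat_supp (Suc k)" "trivial_spectrum W"
    and m: "idx m = k" and p: "Suc (idx p) = k"
    and h: "\<And>i. form (h i)" "\<And>i. h i 1 = 1" and f: "form f" "f 1 = 1"
    and corner: "\<And>A. A \<in> W \<Longrightarrow> f ((A *v axis m 1) $ m) = 0"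
    and col: "\<And>w. w \<in> vec_supp (Suc k) \<Longrightarrow> f (w $ m) = 0 \<Longrightarrow> \<exists>A\<in>W. A *v axis m 1 = w"
    and ker: "{A \<in> W. A *v axis m 1 = 0} = triangular h k"
    and nq: "\<not> quadratic_element q" and large: "large_field TYPE('f) (D.dim UNIV)"
    and x: "x \<in> vec_supp k" "x $ p = 1" and A: "A \<in> W"
  shows "(A *v x) $ m = 0"
proof -
  have pm: "p \<noteq> m" using m p by auto
  have xm: "x $ m = 0" using x(1) m by (simp add: vec_supp_def)
  have entry: "B $ i $ m = (B *v axis m 1) $ i" for B :: "'d^'n^'n" and i by (simp add: matrix_vector_axis)
  have tri: "(N *v x) $ m = 0" "h p ((N *v x) $ p) = 0" if N: "N \<in> triangular h k" for N
  proof -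
    have "N $ m $ j = 0" for j using N m by (simp add: triangular_def mat_supp_def)
    then show "(N *v x) $ m = 0" by (simp add: matrix_vector_nth)
    have "N $ p $ j * x $ j = (if j = p then N $ p $ p else 0)" for j
    proof (cases "j = p")
      case False
      then have "idx j < idx p \<or> k \<le> idx j" using idx_eq_iff[of j p] p by linarith
      then show ?thesis using N False by (auto simp: triangular_def mat_supp_def)
    qed (simp add: x(2))
    then have "(N *v x) $ p = N $ p $ p" by (simp add: matrix_vector_nth)
    then show "h p ((N *v x) $ p) = 0" using N p by (simp add: triangular_def)
  qed
  have avoid: False
    if B: "B \<in> W" and Bm: "(B *v x) $ m + B $ m $ m * y = y" and Bp: "h p ((B *v x) $ p + B $ p $ m * y) = 1" for B y
  proof -
    define v where "v = x + axis m y"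
    have Bv: "(B *v v) $ i = (B *v x) $ i + B $ i $ m * y" for i
      by (simp add: v_def matrix_vector_right_distrib matrix_vector_axis)
    have vp: "v $ p = 1" using pm x(2) by (simp add: v_def axis_def)
    \<comment> \<open>As \<open>v\<close> is 1 at \<open>p\<close>, column \<open>p\<close> alone
      repairs all coordinates of \<open>v\<close> below \<open>k\<close>. Its diagonal entry is
      admissible by \<open>Bp\<close>.\<close>
    define N :: "'d^'n^'n" where "N = (\<chi> i j. if j = p \<and> idx i < k then x $ i - (B *v v) $ i else 0)"
    have "N \<in> triangular h k"
    proof -
      have "h p (x $ p - (B *v v) $ p) = 0" using Bp x(2) h(2) by (simp add: Bv form_diff[OF h(1)])
      then have "h i (N $ i $ i) = 0" for i by (auto simp: N_def form_0[OF h(1)])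
      moreover have "N \<in> mat_supp k" using p by (auto simp: N_def mat_supp_def)
      moreover have "N $ i $ j = 0" if "idx j < idx i" for i j using that p by (auto simp: N_def)
      ultimately show ?thesis by (simp add: triangular_def)
    qed
    then have "N \<in> W" using ker by blast
    then have BN: "B + N \<in> W" using W(1) B M.subspace_add by blast
    have Nv: "(N *v v) $ i = (if idx i < k then x $ i - (B *v v) $ i else 0)" for i
    proof -
      have "N $ i $ j * v $ j = (if j = p then (if idx i < k then x $ i - (B *v v) $ i else 0) else 0)" for j
        using vp by (simp add: N_def)
      then show ?thesis by (simp add: matrix_vector_nth)
    qed
    have "((B + N) *v v) $ i = v $ i" for i
    proof -
      consider "idx i < k" | "i = m" | "Suc k \<le> idx i" using m idx_eq_iff[of i m] by linarith
      then show ?thesis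
      proof cases
        case 1
        then have "i \<noteq> m" using m by auto
        then show ?thesis using 1 by (simp add: matrix_vector_mult_add_rdistrib Nv) (simp add: v_def axis_def)
      next
        case 2
        then show ?thesis using m Bm xm by (simp add: matrix_vector_mult_add_rdistrib Nv Bv) (simp add: v_def axis_def)
      next
        case 3
        then have "i \<noteq> m" "x $ i = 0" using m x(1) by (auto simp: vec_supp_def)
        moreover have "(B *v v) $ i = 0" using mat_supp_vector[of B "Suc k" v] B W(2) 3 by (auto simp: vec_supp_def)
        ultimately show ?thesis using 3 by (simp add: matrix_vector_mult_add_rdistrib Nv) (simp add: v_def axis_def)
      qed
    qed
    then have "(B + N) *v v = v" by (simp add: vec_eq_iff)
    then have "v = 0" using W(3) BN unfolding trivial_spectrum_def by blast
    then show False using vp by simp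
  qed
  \<comment> \<open>Last columns supported on rows \<open>p\<close> and \<open>m\<close>, the pairs
    \<open>(l, h)\<close> of the two-dimensional case.\<close>
  define E where "E l s = axis p l + axis m s" for l s :: 'd
  have E_p: "E l s $ p = l" and E_m: "E l s $ m = s" for l s using pm by (auto simp: E_def axis_def)
  define S where "S l s = (SOME A. A \<in> W \<and> A *v axis m 1 = E l s)" for l s
  have S: "S l s \<in> W" "S l s *v axis m 1 = E l s" if s: "f s = 0" for l s
  proof -
    have "E l s \<in> vec_supp (Suc k)" using m p by (auto simp: E_def vec_supp_def axis_def)
    then have "\<exists>A. A \<in> W \<and> A *v axis m 1 = E l s" using col[of "E l s"] s E_m by auto
    then have "S l s \<in> W \<and> S l s *v axis m 1 = E l s" unfolding S_def by (rule someI_ex)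
    then show "S l s \<in> W" "S l s *v axis m 1 = E l s" by auto
  qed
  define b where "b l s = (S l s *v x) $ m" for l s
  define \<phi> where "\<phi> l s = h p ((S l s *v x) $ p)" for l s
  \<comment> \<open>Elements of \<open>W\<close> with the same last column differ by a triangular
    matrix, which changes neither quantity. So the choice made in \<open>S\<close> is harmless, and
    linearity follows.\<close>
  have uniq: "(B *v x) $ m = b l s" "h p ((B *v x) $ p) = \<phi> l s"
    if B: "B \<in> W" "B *v axis m 1 = E l s" and s: "f s = 0" for B l s
  proof -
    have "B - S l s \<in> triangular h k"
      unfolding ker[symmetric] using B S[OF s, of l] M.subspace_diff[OF W(1)] by (simp add: matrix_vector_mult_diff_rdistrib)
    then show "(B *v x) $ m = b l s" "h p ((B *v x) $ p) = \<phi> l s"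
      using tri[of "B - S l s"] by (auto simp: b_def \<phi>_def matrix_vector_mult_diff_rdistrib form_diff[OF h(1)])
  qed
  have sum: "b (l + l') (s + s') = b l s + b l' s'" "\<phi> (l + l') (s + s') = \<phi> l s + \<phi> l' s'"
    if s: "f s = 0" "f s' = 0" for l l' s s'
  proof -
    have "E (l + l') (s + s') = E l s + E l' s'" by (simp add: E_def axis_add)
    then have *: "(S l s + S l' s') *v axis m 1 = E (l + l') (s + s')"
      using S s by (simp add: matrix_vector_mult_add_rdistrib)
    have "S l s + S l' s' \<in> W" using M.subspace_add[OF W(1)] S s by blast
    moreover have "f (s + s') = 0" using s by (simp add: form_add[OF f(1)])
    ultimately show "b (l + l') (s + s') = b l s + b l' s'" "\<phi> (l + l') (s + s') = \<phi> l s + \<phi> l' s'"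
      using uniq[OF _ *] by (auto simp: matrix_vector_mult_add_rdistrib b_def \<phi>_def form_add[OF h(1)])
  qed
  have scale: "b (\<iota> c * l) (\<iota> c * s) = \<iota> c * b l s" "\<phi> (\<iota> c * l) (\<iota> c * s) = c * \<phi> l s"
    if s: "f s = 0" for c l s
  proof -
    have "E (\<iota> c * l) (\<iota> c * s) = scale_vec \<iota> c (E l s)" by (simp add: E_def vec_eq_iff axis_def scale_vec_nth distrib_left)
    then have *: "scale_mat \<iota> c (S l s) *v axis m 1 = E (\<iota> c * l) (\<iota> c * s)"
      using S s by (simp add: scale_mat_vector)
    have "scale_mat \<iota> c (S l s) \<in> W" using M.subspace_scale[OF W(1)] S s by blast
    moreover have "f (\<iota> c * s) = 0" using s by (simp add: form_scale[OF f(1)])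
    ultimately show "b (\<iota> c * l) (\<iota> c * s) = \<iota> c * b l s" "\<phi> (\<iota> c * l) (\<iota> c * s) = c * \<phi> l s"
      using uniq[OF _ *] by (auto simp: scale_mat_vector b_def \<phi>_def scale_vec_nth form_scale[OF h(1)])
  qed
  have S_entry: "S l s $ p $ m = l" "S l s $ m $ m = s" if "f s = 0" for l s
    using that S by (simp_all add: entry E_p E_m)
  have b0: "b l s = 0" if s: "f s = 0" for l s
  proof (rule lower_corner_zero[where b = b and \<phi> = \<phi> and f\<^sub>1 = "h p" and f\<^sub>2 = f, OF h f sum(1) scale(1) sum(2) scale(2) _ nq large s])
    fix l t assume t: "f t = 0"
    show "\<phi> l t + h p (l * (inverse (1 - t) * b l t)) \<noteq> 1"
    proof
      assume eq: "\<phi> l t + h p (l * (inverse (1 - t) * b l t)) = 1"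
      let ?y = "inverse (1 - t) * b l t"
      have "f (1 - t) = 1" using t f by (simp add: form_diff)
      then have "1 - t \<noteq> 0" using form_0[OF f(1)] by auto
      then have "(1 - t) * ?y = b l t" by (simp flip: mult.assoc)
      then have "(S l t *v x) $ m + S l t $ m $ m * ?y = ?y"
        by (simp add: S_entry[OF t] b_def left_diff_distrib algebra_simps)
      moreover have "h p ((S l t *v x) $ p + S l t $ p $ m * ?y) = 1"
        using eq by (simp add: S_entry[OF t] \<phi>_def form_add[OF h(1)])
      ultimately show False using avoid S(1)[OF t] by blast
    qed
  qed
  have f0: "f 0 = 0" using form_0[OF f(1)] .
  \<comment> \<open>The last column of \<open>A\<close> may have entries in other rows, so
    \<open>b0\<close> does not cover \<open>A\<close> itself. Here those in rows \<open>p\<close>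
    and \<open>m\<close> are removed without changing the bottom entry in question.\<close>
  define C where "C = A - S (A $ p $ m) (A $ m $ m)"
  have fA: "f (A $ m $ m) = 0" using corner[OF A] by (simp add: entry)
  have C: "C \<in> W" using A S(1)[OF fA] M.subspace_diff[OF W(1)] by (simp add: C_def)
  have Cpm: "C $ p $ m = 0" "C $ m $ m = 0" by (simp_all add: C_def S_entry[OF fA])
  have Cx: "(C *v x) $ m = (A *v x) $ m"
    using b0[OF fA, of "A $ p $ m"] by (simp add: C_def matrix_vector_mult_diff_rdistrib b_def)
  show ?thesis
  proof (rule ccontr)
    assume "(A *v x) $ m \<noteq> 0"
    then have c: "(C *v x) $ m \<noteq> 0" (is "?c \<noteq> 0") using Cx by simp
    \<comment> \<open>With \<open>y = ?c\<close> the condition of \<open>avoid\<close> in row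
      \<open>m\<close> holds automatically. Adding \<open>?S s\<close> contributes just
      \<open>s\<close> to the condition in row \<open>p\<close>, once its action on \<open>x\<close>
      is seen to be invisible to \<open>h p\<close>.\<close>
    let ?S = "\<lambda>s. S (\<iota> s * inverse ?c) 0"
    have Sx: "(?S s *v x) $ m = 0" for s using b0[OF f0] by (simp add: b_def)
    have \<phi>_s: "h p ((?S s *v x) $ p) = s * \<phi> (inverse ?c) 0" for s
      using scale(2)[OF f0, of s "inverse ?c"] by (simp add: \<phi>_def)
    have "\<phi> (inverse ?c) 0 = 0"
    proof (rule affine_avoids_1)
      fix s
      show "0 + s * \<phi> (inverse ?c) 0 \<noteq> 1"
        using avoid[OF S(1)[OF f0], of "\<iota> s * inverse ?c" 0] Sx[of s] \<phi>_s[of s] by auto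
    qed
    then have \<phi>0: "h p ((?S s *v x) $ p) = 0" for s using \<phi>_s by simp
    define s where "s = 1 - h p ((C *v x) $ p)"
    have CS: "C + ?S s \<in> W" using M.subspace_add[OF W(1) C S(1)[OF f0]] .
    show False
    proof (rule avoid[OF CS])
      show "((C + ?S s) *v x) $ m + (C + ?S s) $ m $ m * ?c = ?c"
        by (simp add: matrix_vector_mult_add_rdistrib Sx Cpm S_entry[OF f0])
      have "\<iota> s * inverse ?c * ?c = \<iota> s" using c by (simp add: mult.assoc)
      moreover have "h p (\<iota> s) = s" using form_scale[OF h(1), of p s 1] h(2) by simp
      ultimately show "h p (((C + ?S s) *v x) $ p + (C + ?S s) $ p $ m * ?c) = 1"
        by (simp add: matrix_vector_mult_add_rdistrib Cpm S_entry[OF f0] form_add[OF h(1)] \<phi>0) (simp add: s_def)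
    qed
  qed
qed

section \<open>The case of equality in the dimension bound\<close>

lemma conjugate_conjugate: "conjugate S Q (conjugate R P W) = conjugate (S ** R) (P ** Q) W"
  unfolding conjugate_def image_image matrix_mul_assoc ..

text \<open>Equality in the bound forces equality in both summands of rank-nullity: the last columns
  fill the hyperplane, and the annihilator is optimal, so the induction makes it triangular. Then
  \<open>bottom_row_zero\<close> applies.\<close>

lemma conjugate_triangular_if_optimal:
  fixes W :: "('d^'n^'n) set"
  assumes "M.subspace W" "W \<subseteq> mat_supp k" "trivial_spectrum W"
    and "k \<le> CARD('n::finite)" and "large_field TYPE('f) (k * D.dim UNIV)"
    and "M.dim W = optimal_dim (D.dim UNIV) k" and nq: "\<not> quadratic_element q"
  shows "\<exists>P R h. P ** R = mat 1 \<and> R ** P = mat 1 \<and> block_id k P \<and> (\<forall>i. form (h i) \<and> h i 1 = 1)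
    \<and> conjugate R P W = triangular h k"
  using assms(1-6)
proof (induction k arbitrary: W)
  case 0
  have "0 \<in> W" using M.subspace_0[OF 0(1)] .
  then have W: "W = {0}" using 0(2) by (auto simp: mat_supp_def vec_eq_iff)
  have tri: "(triangular h 0 :: ('d^'n^'n) set) = {0}" for h :: "'n \<Rightarrow> 'd \<Rightarrow> 'f"
    by (auto simp: triangular_def mat_supp_def vec_eq_iff)
  obtain f0 where f0: "form f0" "f0 1 = 1" using exists_form by blast
  show ?case
  proof (intro exI conjI allI)
    show "mat 1 ** mat 1 = (mat 1 :: 'd^'n^'n)" "mat 1 ** mat 1 = (mat 1 :: 'd^'n^'n)" by simp_all
    show "block_id 0 (mat 1 :: 'd^'n^'n)" by (simp add: block_id_def mat_supp_def)
    show "form f0" "f0 1 = 1" by (fact f0)+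
    show "conjugate (mat 1) (mat 1) W = triangular (\<lambda>_. f0) 0" unfolding tri unfolding W conjugate_def by simp
  qed
next
  case (Suc k)
  obtain m :: 'n where m: "idx m = k" using exists_idx[of k, where 'n = 'n] Suc.prems by auto
  have large_k: "large_field TYPE('f) (k * D.dim UNIV)" and large: "large_field TYPE('f) (D.dim UNIV)"
    using Suc.prems(5) by (auto intro: order_trans[rotated])
  have kn: "k \<le> CARD('n)" using Suc.prems(4) by simp
  obtain P R f where P: "P ** R = mat 1" "R ** P = mat 1" "block_id (Suc k) P" and f: "form f" "f 1 = 1"
    and W1: "\<And>A. A \<in> conjugate R P W \<Longrightarrow> f ((A *v axis m 1) $ m) = 0"
      "\<And>A. A \<in> conjugate R P W \<Longrightarrow> A *v axis m 1 = 0 \<Longrightarrow> A \<in> mat_supp k"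
    using reduction[OF Suc.prems(1-5) m] by blast
  define W1 where "W1 = conjugate R P W"
  interpret p: finite_dimensional_vector_space_pair_1
    "scale_mat \<iota> :: 'f \<Rightarrow> 'd^'n^'n \<Rightarrow> _" mat_basis "scale_vec \<iota> :: 'f \<Rightarrow> 'd^'n \<Rightarrow> _" by unfold_locales
  interpret l: Vector_Spaces.linear "scale_mat \<iota>" "scale_vec \<iota>" "\<lambda>A. A *v axis m 1" by (rule linear_eval)
  let ?K = "{A \<in> W1. A *v axis m 1 = 0}" and ?col = "(\<lambda>A. A *v axis m 1) ` W1"
    and ?H = "{x \<in> vec_supp (Suc k) :: ('d^'n) set. f (x $ m) = 0}"
  have sub1: "M.subspace W1" unfolding W1_def by (rule subspace_conjugate[OF Suc.prems(1)])
  have supp1: "W1 \<subseteq> mat_supp (Suc k)"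
    unfolding W1_def conjugate_def using Suc.prems(2) P(3) block_id_inverse[OF P(3,1,2)] by (auto intro: mat_supp_conj)
  have ts1: "trivial_spectrum W1" unfolding W1_def by (rule trivial_spectrum_conjugate[OF P(1,2) Suc.prems(3)])
  have K: "M.subspace ?K" "?K \<subseteq> mat_supp k" "trivial_spectrum ?K"
  proof -
    show "M.subspace ?K" using M.subspace_inter[OF sub1 l.subspace_kernel] by (simp add: Collect_conj_eq)
    show "?K \<subseteq> mat_supp k" using W1(2) unfolding W1_def by blast
    show "trivial_spectrum ?K" using ts1 unfolding trivial_spectrum_def by blast
  qed
  have col_le: "?col \<subseteq> ?H" using W1(1) supp1 by (auto simp: W1_def intro: mat_supp_vector)
  have sub_col: "V.subspace ?col" using l.subspace_image[OF sub1] .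
  have dims: "optimal_dim (D.dim UNIV) (Suc k) = V.dim ?col + M.dim ?K"
    using p.rank_nullity[OF sub1 linear_eval, of "axis m 1"] Suc.prems(6) dim_conjugate[OF P(1,2), of W]
    by (simp only: W1_def)
  have dimH: "V.dim ?H = Suc k * D.dim UNIV - 1" by (rule dim_hyperplane[OF f m])
  have "V.dim ?col \<le> V.dim ?H" using V.dim_subset[OF col_le] .
  moreover have "M.dim ?K \<le> optimal_dim (D.dim UNIV) k" using dim_le_optimal_dim[OF K kn large_k] .
  ultimately have dimK: "M.dim ?K = optimal_dim (D.dim UNIV) k" and "V.dim ?H \<le> V.dim ?col"
    using dims dimH by simp_all
  then have col_eq: "?col = ?H"
    using V.subspace_dim_equal[OF sub_col subspace_hyperplane[OF f(1)] col_le] by blast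
  obtain Q S h where QSh: "Q ** S = mat 1 \<and> S ** Q = mat 1 \<and> block_id k Q \<and> (\<forall>i. form (h i) \<and> h i 1 = 1)
      \<and> conjugate S Q ?K = triangular h k"
    using Suc.IH[OF K kn large_k dimK] by (elim exE) (rule that)
  then have Q: "Q ** S = mat 1" "S ** Q = mat 1" "block_id k Q" and h: "\<And>i. form (h i)" "\<And>i. h i 1 = 1"
    and QK: "conjugate S Q ?K = triangular h k" by simp_all
  have S: "block_id k S" using block_id_inverse[OF Q(3,1,2)] .
  define W2 where "W2 = conjugate S Q W1"
  have W2m: "S ** (A :: 'd^'n^'n) ** Q *v axis m 1 = S *v (A *v axis m 1)" for A
    using block_id_axis[OF Q(3), of m 1] m by (simp flip: matrix_vector_mul_assoc)
  have SQ: "S *v (Q *v v) = v" and QS: "Q *v (S *v v) = v" for v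
    by (simp_all add: matrix_vector_mul_assoc Q)
  have sub2: "M.subspace W2" unfolding W2_def by (rule subspace_conjugate[OF sub1])
  have supp2: "W2 \<subseteq> mat_supp (Suc k)"
    unfolding W2_def conjugate_def
    using supp1 block_id_mono[OF Q(3), of "Suc k"] block_id_mono[OF S, of "Suc k"] by (auto intro: mat_supp_conj)
  have ts2: "trivial_spectrum W2" unfolding W2_def by (rule trivial_spectrum_conjugate[OF Q(1,2) ts1])
  have dim2: "M.dim W2 = optimal_dim (D.dim UNIV) (Suc k)"
    unfolding W2_def W1_def dim_conjugate[OF Q(1,2)] dim_conjugate[OF P(1,2)] by (rule Suc.prems(6))
  have corner: "f ((B *v axis m 1) $ m) = 0" if B: "B \<in> W2" for B
  proof -
    obtain A where A: "A \<in> W1" "B = S ** A ** Q" using B by (auto simp: W2_def conjugate_def)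
    have "(B *v axis m 1) $ m = (A *v axis m 1) $ m"
      unfolding A(2) W2m using block_id_vector[OF S, of m] m by simp
    then show ?thesis using W1(1) A(1) by (simp add: W1_def)
  qed
  have col2: "\<exists>B\<in>W2. B *v axis m 1 = w" if w: "w \<in> vec_supp (Suc k)" "f (w $ m) = 0" for w
  proof -
    have "(Q *v w) $ i = w $ i" if "k \<le> idx i" for i using block_id_vector[OF Q(3) that] .
    then have "Q *v w \<in> ?H" using w m by (simp add: vec_supp_def)
    then have "Q *v w \<in> ?col" by (simp only: col_eq)
    then obtain A where A: "A \<in> W1" "Q *v w = A *v axis m 1" by (rule imageE)
    have "S ** A ** Q *v axis m 1 = w" unfolding W2m A(2)[symmetric] SQ ..
    moreover have "S ** A ** Q \<in> W2" unfolding W2_def conjugate_def using A(1) by (rule imageI)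
    ultimately show ?thesis by blast
  qed
  have ker2: "{B \<in> W2. B *v axis m 1 = 0} = triangular h k"
  proof -
    have "S *v v = 0 \<longleftrightarrow> v = 0" for v
    proof
      assume "S *v v = 0"
      then show "v = 0" using QS[of v] by simp
    qed simp
    then have "S ** A ** Q *v axis m 1 = 0 \<longleftrightarrow> A *v axis m 1 = 0" for A unfolding W2m .
    then have "{B \<in> W2. B *v axis m 1 = 0} = conjugate S Q ?K"
      unfolding W2_def conjugate_def by blast
    then show ?thesis using QK by simp
  qed
  have row: "(B :: 'd^'n^'n) $ m $ j = 0" if B: "B \<in> W2" and j: "idx j < k" for B and j :: 'n
  proof -
    obtain r where r: "k = Suc r" using j by (cases k) auto
    obtain p :: 'n where p: "idx p = r" using exists_idx[of r, where 'n = 'n] kn r by auto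
    have p': "Suc (idx p) = k" using p r by simp
    note bottom = bottom_row_zero[OF sub2 supp2 ts2 m p' h f corner col2 ker2 nq large _ _ B]
    have ax: "axis i a \<in> vec_supp k" if "idx i < k" for i :: 'n and a :: 'd
      using that by (auto simp: vec_supp_def axis_def)
    have "(B *v axis p 1) $ m = 0" using p' by (intro bottom ax) (auto simp: axis_def)
    then have Bp: "B $ m $ p = 0" by (simp add: matrix_vector_axis)
    show ?thesis
    proof (cases "j = p")
      case False
      \<comment> \<open>The lemma on the bottom row asks for coordinate \<open>p\<close> to be 1, so
        other entries are reached by adding to the basis column at \<open>p\<close>.\<close>
      have "(B *v (axis p 1 + axis j 1)) $ m = 0"
      proof (rule bottom)
        show "axis p 1 + axis j (1 :: 'd) \<in> vec_supp k"
          by (rule V.subspace_add[OF subspace_vec_supp]) (use ax p' j in auto)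
        show "(axis p 1 + axis j 1) $ p = (1::'d)" using False by (simp add: axis_def)
      qed
      then show ?thesis using Bp by (simp add: matrix_vector_right_distrib matrix_vector_axis)
    qed (use Bp in simp)
  qed
  \<comment> \<open>As the last row vanishes left of the diagonal, a column fixed by the leading
    block is fixed by the whole matrix. So the blocks have trivial spectrum; containing the
    triangular space, they equal it by the dimension bound.\<close>
  define cut :: "'d^'n^'n \<Rightarrow> 'd^'n^'n" where "cut B = (\<chi> i j. if idx i < k \<and> idx j < k then B $ i $ j else 0)" for B
  have lin_cut: "Vector_Spaces.linear (scale_mat \<iota>) (scale_mat \<iota>) cut"
    unfolding Vector_Spaces.linear_iff
    by (simp add: M.vector_space_axioms) (simp add: vec_eq_iff cut_def scale_mat_nth)
  interpret c: Vector_Spaces.linear "scale_mat \<iota>" "scale_mat \<iota>" cut by (rule lin_cut)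
  have cut_sub: "M.subspace (cut ` W2)" using c.subspace_image[OF sub2] .
  have cut_supp: "cut ` W2 \<subseteq> mat_supp k" by (auto simp: cut_def mat_supp_def)
  have cut_ts: "trivial_spectrum (cut ` W2)"
    unfolding trivial_spectrum_def
  proof (intro ballI allI impI)
    fix C x assume "C \<in> cut ` W2" and Cx: "C *v x = x"
    then obtain B where B: "B \<in> W2" "C = cut B" by blast
    have x: "x \<in> vec_supp k" using mat_supp_vector[of C k x] cut_supp B Cx by auto
    have eq: "B $ i $ j * x $ j = C $ i $ j * x $ j" for i j
    proof (cases "idx j < k")
      case True
      have "B $ i $ j = 0" if "\<not> idx i < k"
      proof (cases "i = m")
        case False
        then have "Suc k \<le> idx i" using that m idx_eq_iff[of i m] by linarith
        then show ?thesis using B(1) supp2 by (auto simp: mat_supp_def)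
      qed (use row[OF B(1) True] in simp)
      then show ?thesis using True by (simp add: B(2) cut_def)
    next
      case False
      then show ?thesis using x by (simp add: vec_supp_def)
    qed
    have "(B *v x) $ i = (C *v x) $ i" for i unfolding matrix_vector_nth by (rule sum.cong[OF refl]) (rule eq)
    then have "B *v x = C *v x" by (simp add: vec_eq_iff)
    then show "x = 0" using Cx B(1) ts2 unfolding trivial_spectrum_def by metis
  qed
  have "triangular h k \<subseteq> cut ` W2"
  proof
    fix N assume N: "N \<in> triangular h k"
    then have "N \<in> W2" using ker2 by blast
    moreover have "cut N = N" using N by (auto simp: vec_eq_iff cut_def triangular_def mat_supp_def not_less)
    ultimately show "N \<in> cut ` W2" by (metis image_eqI)
  qed
  moreover have "M.dim (cut ` W2) \<le> M.dim (triangular h k :: ('d^'n^'n) set)"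
    using dim_le_optimal_dim[OF cut_sub cut_supp cut_ts kn large_k] dim_triangular[of h, OF h kn] by simp
  ultimately have cut_tri: "cut ` W2 = triangular h k"
    using M.subspace_dim_equal[OF subspace_triangular[of h, OF h(1)] cut_sub] by blast
  define h' where "h' = h(m := f)"
  have h': "form (h' i)" "h' i 1 = 1" for i using h f by (auto simp: h'_def)
  have "W2 \<subseteq> triangular h' (Suc k)"
  proof
    fix B assume B: "B \<in> W2"
    then have cB: "cut B \<in> triangular h k" using cut_tri by blast
    have "B $ i $ j = 0" if ij: "idx j < idx i" for i j
    proof -
      consider "idx i < k" | "i = m" | "Suc k \<le> idx i" using m idx_eq_iff[of i m] by linarith
      then show ?thesis
      proof cases
        case 1
        have "cut B $ i $ j = 0" using cB ij by (simp add: triangular_def)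
        then show ?thesis using 1 ij by (simp add: cut_def)
      next
        case 2
        then show ?thesis using row[OF B] ij m by simp
      next
        case 3
        then show ?thesis using B supp2 by (auto simp: mat_supp_def)
      qed
    qed
    moreover have "h' i (B $ i $ i) = 0" if i: "idx i < Suc k" for i
    proof (cases "i = m")
      case True
      then show ?thesis using corner[OF B] by (simp add: h'_def matrix_vector_axis)
    next
      case False
      then have "idx i < k" using i m idx_eq_iff[of i m] by linarith
      moreover from this have "h i (cut B $ i $ i) = 0" using cB by (simp add: triangular_def)
      ultimately show ?thesis using False by (simp add: h'_def cut_def)
    qed
    ultimately show "B \<in> triangular h' (Suc k)" using B supp2 by (auto simp: triangular_def)
  qed
  moreover have "M.dim (triangular h' (Suc k) :: ('d^'n^'n) set) \<le> M.dim W2"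
    unfolding dim2 dim_triangular[of h', OF h' Suc.prems(4)] ..
  ultimately have "W2 = triangular h' (Suc k)"
    by (intro M.subspace_dim_equal[OF sub2 subspace_triangular[of h', OF h'(1)]])
  then have "conjugate (S ** R) (P ** Q) W = triangular h' (Suc k)"
    unfolding W2_def W1_def conjugate_conjugate .
  moreover have "(P ** Q) ** (S ** R) = mat 1" "(S ** R) ** (P ** Q) = mat 1"
  proof -
    have "(P ** Q) ** (S ** R) = P ** (Q ** S) ** R" by (simp only: matrix_mul_assoc)
    then show "(P ** Q) ** (S ** R) = mat 1" using P Q by simp
    have "(S ** R) ** (P ** Q) = S ** (R ** P) ** Q" by (simp only: matrix_mul_assoc)
    then show "(S ** R) ** (P ** Q) = mat 1" using P Q by simp
  qed
  moreover have "block_id (Suc k) (P ** Q)"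
    using block_id_mult[OF P(3)] block_id_mono[OF Q(3), of "Suc k"] by simp
  ultimately show ?case using h' by blast
qed

subsection \<open>Optimal unital affine subspaces\<close>

lemma affine_dim_translate:
  assumes V: "M.subspace V"
  shows "affine_dim_mat \<iota> ((\<lambda>B. A + B) ` V) = M.dim V"
proof -
  have "{B - C |B C. B \<in> (\<lambda>B. A + B) ` V \<and> C \<in> (\<lambda>B. A + B) ` V} = V" (is "?L = V")
  proof
    show "?L \<subseteq> V"
    proof
      fix X assume "X \<in> ?L"
      then obtain B C where "B \<in> V" "C \<in> V" "X = (A + B) - (A + C)" by blast
      then show "X \<in> V" using M.subspace_diff[OF V] by simp
    qed
    show "V \<subseteq> ?L"
    proof
      fix X assume X: "X \<in> V"
      have "A + X \<in> (\<lambda>B. A + B) ` V" using X by (rule imageI)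
      moreover have "A + 0 \<in> (\<lambda>B. A + B) ` V" using M.subspace_0[OF V] by (rule imageI)
      moreover have "X = (A + X) - (A + 0)" by simp
      ultimately show "X \<in> ?L" by blast
    qed
  qed
  then show ?thesis by (simp add: affine_dim_mat_def)
qed

lemma unital_translate_of_trivial_spectrum:
  fixes W :: "('d^'n^'n) set"
  assumes W: "M.subspace W" "trivial_spectrum W"
  shows "unital ((\<lambda>X. mat 1 + X) ` W)"
  unfolding unital_def
proof (intro subsetI CollectI)
  fix B assume "B \<in> (\<lambda>X. mat 1 + X) ` W"
  then obtain X where X: "X \<in> W" "B = mat 1 + X" by blast
  have inj: "x = 0" if Bx: "B *v x = 0" for x
  proof -
    have "x + X *v x = 0" using Bx unfolding X(2) by (simp add: matrix_vector_mult_add_rdistrib)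
    then have "- (X *v x) = x" by (simp only: neg_eq_iff_add_eq_0 add.commute)
    moreover have "(0 - X) *v x = - (X *v x)" unfolding matrix_vector_mult_diff_rdistrib by simp
    ultimately have "(- X) *v x = x" by simp
    moreover have "- X \<in> W" by (rule M.subspace_neg[OF W(1) X(1)])
    ultimately show ?thesis using W(2) unfolding trivial_spectrum_def by blast
  qed
  obtain R where "B ** R = mat 1" "R ** B = mat 1" by (rule injective_imp_invertible[OF inj])
  then show "invertible B" unfolding invertible_def by blast
qed

text \<open>The base point \<open>A\<close> lies in \<open>T\<close>, hence is invertible and can be
  divided out. A column fixed by \<open>R ** B\<close> is killed by \<open>A + - B\<close>, which
  lies in \<open>T\<close> as well.\<close>

lemma unital_affine_subspace_reduction:
  fixes T :: "('d^'n^'n) set"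
  assumes T: "affine_subspace_mat \<iota> T" "unital T"
  obtains A R W where "A ** R = mat 1" "R ** A = mat 1" "M.subspace W" "trivial_spectrum W"
    "T = (\<lambda>X. A ** (mat 1 + X)) ` W" "affine_dim_mat \<iota> T = M.dim W"
proof -
  obtain A V where V: "M.subspace V" and TV: "T = (\<lambda>B. A + B) ` V"
    using T(1) by (auto simp: affine_subspace_mat_def)
  have inv: "invertible (A + B)" if "B \<in> V" for B using T(2) that by (auto simp: TV unital_def)
  have "invertible A" using inv[OF M.subspace_0[OF V]] by simp
  then obtain R where R: "A ** R = mat 1" "R ** A = mat 1" unfolding invertible_def by blast
  have lin: "Vector_Spaces.linear (scale_mat \<iota>) (scale_mat \<iota>) (\<lambda>B. R ** B)"
    using linear_conj[of R "mat 1"] by simp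
  interpret l: Vector_Spaces.linear "scale_mat \<iota>" "scale_mat \<iota>" "\<lambda>B. R ** B" by (rule lin)
  interpret p: finite_dimensional_vector_space_pair_1
    "scale_mat \<iota> :: 'f \<Rightarrow> 'd^'n^'n \<Rightarrow> _" mat_basis "scale_mat \<iota> :: 'f \<Rightarrow> 'd^'n^'n \<Rightarrow> _" by unfold_locales
  have AR: "A ** (R ** B) = B" for B by (simp add: matrix_mul_assoc R)
  define W where "W = (\<lambda>B. R ** B) ` V"
  have "M.subspace W" unfolding W_def by (rule l.subspace_image[OF V])
  moreover have "M.dim W = M.dim V"
    unfolding W_def by (rule p.dim_image_eq[OF lin]) (rule inj_on_inverseI[of _ "\<lambda>B. A ** B"], rule AR)
  moreover have "T = (\<lambda>X. A ** (mat 1 + X)) ` W"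
    unfolding W_def TV image_image by (simp add: matrix_add_ldistrib AR)
  moreover have "trivial_spectrum W"
    unfolding trivial_spectrum_def
  proof (intro ballI allI impI)
    fix X x assume "X \<in> W" and Xx: "X *v x = x"
    then obtain B where B: "B \<in> V" "X = R ** B" by (auto simp: W_def)
    have "B *v x = A *v (X *v x)" unfolding B(2) matrix_vector_mul_assoc AR ..
    then have Bx: "B *v x = A *v x" unfolding Xx .
    have "(A + - B) *v x = 0"
      unfolding diff_conv_add_uminus[symmetric] by (simp add: matrix_vector_mult_diff_rdistrib Bx)
    moreover obtain C where "C ** (A + - B) = mat 1"
      using inv[OF M.subspace_neg[OF V B(1)]] unfolding invertible_def by blast
    ultimately have "mat 1 *v x = C *v 0" by (metis matrix_vector_mul_assoc)
    then show "x = 0" by simp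
  qed
  ultimately show thesis using that[OF R] affine_dim_translate[OF V, of A] TV by simp
qed

lemma mat_supp_UNIV: "mat_supp (CARD('n::finite)) = (UNIV :: ('d^'n^'n) set)"
  using idx_less[where 'n = 'n] by (auto simp: mat_supp_def not_le[symmetric])

definition diag :: "('n \<Rightarrow> 'd) \<Rightarrow> 'd^'n^'n" where
  "diag a = (\<chi> i j. if i = j then a i else 0)"

lemma diag_mult: "(diag a ** B) $ i $ j = a i * B $ i $ j"
proof -
  have "diag a $ i $ l * B $ l $ j = (if l = i then a i * B $ i $ j else 0)" for l
    by (simp add: diag_def)
  then show ?thesis by (simp add: matrix_matrix_mult_def)
qed

text \<open>Write \<open>h i\<close> as \<open>f\<close> after left multiplication by
  \<open>a i\<close>. A diagonal entry \<open>x\<close> of the translate satisfies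
  \<open>h i x = 1\<close> on one side and \<open>f x = 1\<close> on the other, so scaling row
  \<open>i\<close> by \<open>a i\<close> matches the two conditions.\<close>

lemma diag_normalizes_triangular:
  fixes h :: "'n::finite \<Rightarrow> 'd \<Rightarrow> 'f"
  assumes f: "form f" "f 1 = 1" and h: "\<And>i. form (h i)" "\<And>i. h i 1 = 1"
  obtains a where "\<And>i. a i \<noteq> 0"
    "(\<lambda>X. diag (\<lambda>i. inverse (a i)) ** (mat 1 + X)) ` triangular (\<lambda>_. f) (CARD('n)) = (\<lambda>X. mat 1 + X) ` triangular h (CARD('n))"
proof -
  have "\<exists>b. \<forall>x. h i x = f (b * x)" for i
    using form_represented[OF f(1) _ h(1)[of i], of 1] f(2) by (metis one_neq_zero)
  then obtain a where a: "\<And>i x. h i x = f (a i * x)" by metis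
  have fa: "f (a i) = 1" for i using a[of i 1] h(2) by simp
  then have a0: "a i \<noteq> 0" for i using form_0[OF f(1)] by (metis zero_neq_one)
  let ?E = "diag (\<lambda>i. inverse (a i))" and ?D = "diag a"
  have ED: "?E ** (?D ** B) = B" and DE: "?D ** (?E ** B) = B" for B :: "'d^'n^'n"
    using a0 by (simp_all add: vec_eq_iff diag_mult flip: mult.assoc)
  have 1: "?E ** (mat 1 + X) - mat 1 \<in> triangular h (CARD('n))" if X: "X \<in> triangular (\<lambda>_. f) (CARD('n))" for X
  proof -
    have "(?E ** (mat 1 + X) - mat 1) $ i $ j = 0" if "idx j < idx i" for i j
      using X that by (auto simp: diag_mult triangular_def mat_def)
    moreover have "h i ((?E ** (mat 1 + X) - mat 1) $ i $ i) = 0" for i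
    proof -
      have "a i * (inverse (a i) * (1 + X $ i $ i) - 1) = 1 + X $ i $ i - a i"
        using a0[of i] by (simp add: right_diff_distrib flip: mult.assoc)
      then have "h i ((?E ** (mat 1 + X) - mat 1) $ i $ i) = f (1 + X $ i $ i - a i)"
        by (simp add: a diag_mult mat_def)
      also have "\<dots> = 0"
        using X idx_less[of i] by (simp add: form_add[OF f(1)] form_diff[OF f(1)] f(2) fa triangular_def)
      finally show ?thesis .
    qed
    ultimately show ?thesis by (simp add: triangular_def mat_supp_UNIV)
  qed
  have 2: "?D ** (mat 1 + Y) - mat 1 \<in> triangular (\<lambda>_. f) (CARD('n))" if Y: "Y \<in> triangular h (CARD('n))" for Y
  proof -
    have "(?D ** (mat 1 + Y) - mat 1) $ i $ j = 0" if "idx j < idx i" for i j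
      using Y that by (auto simp: diag_mult triangular_def mat_def)
    moreover have "f ((?D ** (mat 1 + Y) - mat 1) $ i $ i) = 0" for i
    proof -
      have "f (a i * Y $ i $ i) = 0" using Y idx_less[of i] by (simp add: triangular_def a)
      then show ?thesis by (simp add: diag_mult mat_def form_diff[OF f(1)] distrib_left form_add[OF f(1)] fa f(2))
    qed
    ultimately show ?thesis by (simp add: triangular_def mat_supp_UNIV)
  qed
  have "(\<lambda>X. ?E ** (mat 1 + X)) ` triangular (\<lambda>_. f) (CARD('n)) = (\<lambda>X. mat 1 + X) ` triangular h (CARD('n))"
  proof (intro subset_antisym subsetI)
    fix B assume "B \<in> (\<lambda>X. ?E ** (mat 1 + X)) ` triangular (\<lambda>_. f) (CARD('n))"
    then obtain X where X: "X \<in> triangular (\<lambda>_. f) (CARD('n))" "B = ?E ** (mat 1 + X)" by blast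
    then have "B = mat 1 + (?E ** (mat 1 + X) - mat 1)" by simp
    then show "B \<in> (\<lambda>X. mat 1 + X) ` triangular h (CARD('n))" using 1[OF X(1)] by (rule image_eqI)
  next
    fix B assume "B \<in> (\<lambda>X. mat 1 + X) ` triangular h (CARD('n))"
    then obtain Y where Y: "Y \<in> triangular h (CARD('n))" "B = mat 1 + Y" by blast
    have "B = ?E ** (mat 1 + (?D ** (mat 1 + Y) - mat 1))" using ED Y(2) by simp
    then show "B \<in> (\<lambda>X. ?E ** (mat 1 + X)) ` triangular (\<lambda>_. f) (CARD('n))" using 2[OF Y(1)] by (rule image_eqI)
  qed
  with a0 that show thesis by blast
qed

theorem unique_optimal_unital_affine:
  assumes nq: "\<not> quadratic_type \<iota>" and large: "large_field TYPE('f) (CARD('n::finite) * D.dim UNIV)"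
  shows "\<exists>S :: ('d^'n^'n) set. optimal_unital_affine \<iota> S \<and>
           (\<forall>T :: ('d^'n^'n) set. optimal_unital_affine \<iota> T \<longrightarrow> equivalent_mat_sets S T)"
proof -
  have "D.dim UNIV \<le> CARD('n) * D.dim UNIV" by simp
  then have "large_field TYPE('f) (D.dim UNIV)" using large by (meson order_trans)
  then obtain q where q: "\<not> quadratic_element q" using quadratic_type_if_quadratic_elements nq by blast
  obtain f where f: "form f" "f 1 = 1" using exists_form by blast
  let ?tri = "triangular (\<lambda>_. f) (CARD('n)) :: ('d^'n^'n) set"
  define S where "S = (\<lambda>X. mat 1 + X) ` ?tri"
  have tri: "M.subspace ?tri" "trivial_spectrum ?tri"
    using subspace_triangular[of "\<lambda>_. f", OF f(1)] trivial_spectrum_triangular[of "\<lambda>_. f", OF f] by auto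
  have dim_tri: "M.dim ?tri = optimal_dim (D.dim UNIV) (CARD('n))"
    by (rule dim_triangular[OF f order_refl])
  have S: "affine_subspace_mat \<iota> S" "unital S"
    using tri(1) unital_translate_of_trivial_spectrum[OF tri] by (auto simp: S_def affine_subspace_mat_def)
  have dimS: "affine_dim_mat \<iota> S = optimal_dim (D.dim UNIV) (CARD('n))"
    unfolding S_def affine_dim_translate[OF tri(1)] by (rule dim_tri)
  have bound: "M.dim W \<le> optimal_dim (D.dim UNIV) (CARD('n))"
    if "M.subspace W" "trivial_spectrum W" for W :: "('d^'n^'n) set"
    using dim_le_optimal_dim[OF that(1) _ that(2), of "CARD('n)"] large by (simp add: mat_supp_UNIV)
  have "optimal_unital_affine \<iota> S"
    unfolding optimal_unital_affine_def
  proof (intro conjI allI impI S)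
    fix T :: "('d^'n^'n) set" assume T: "affine_subspace_mat \<iota> T \<and> unital T"
    obtain W :: "('d^'n^'n) set" where "M.subspace W" "trivial_spectrum W" "affine_dim_mat \<iota> T = M.dim W"
      by (rule unital_affine_subspace_reduction[OF conjunct1[OF T] conjunct2[OF T]])
    then show "affine_dim_mat \<iota> T \<le> affine_dim_mat \<iota> S" using bound dimS by simp
  qed
  moreover have "equivalent_mat_sets S T" if T: "optimal_unital_affine \<iota> T" for T
  proof -
    have T': "affine_subspace_mat \<iota> T" "unital T" and ge: "affine_dim_mat \<iota> S \<le> affine_dim_mat \<iota> T"
      using T S unfolding optimal_unital_affine_def by blast+
    obtain A B W where AB: "A ** B = mat 1" "B ** A = mat 1" and W: "M.subspace W" "trivial_spectrum W"
      and TW: "T = (\<lambda>X. A ** (mat 1 + X)) ` W" and dimT: "affine_dim_mat \<iota> T = M.dim W"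
      by (rule unital_affine_subspace_reduction[OF T'])
    have dimW: "M.dim W = optimal_dim (D.dim UNIV) (CARD('n))"
      using bound[OF W] ge unfolding dimT dimS by simp
    have supp: "W \<subseteq> mat_supp (CARD('n))" by (simp add: mat_supp_UNIV)
    obtain P R h where PRh: "P ** R = mat 1 \<and> R ** P = mat 1 \<and> block_id (CARD('n)) P \<and> (\<forall>i. form (h i) \<and> h i 1 = 1)
        \<and> conjugate R P W = triangular h (CARD('n))"
      using conjugate_triangular_if_optimal[OF W(1) supp W(2) order_refl large dimW q] by (elim exE) (rule that)
    then have PR: "P ** R = mat 1" "R ** P = mat 1" and h: "\<And>i. form (h i)" "\<And>i. h i 1 = 1"
      and conj: "conjugate R P W = triangular h (CARD('n))" by simp_all
    obtain a where a: "\<And>i. a i \<noteq> 0"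
      and diag: "(\<lambda>X. diag (\<lambda>i. inverse (a i)) ** (mat 1 + X)) ` ?tri = (\<lambda>X. mat 1 + X) ` triangular h (CARD('n))"
      by (rule diag_normalizes_triangular[OF f, of h, OF h]) (rule that)
    let ?E = "diag (\<lambda>i. inverse (a i))" and ?D = "diag a"
    have DE: "?D ** ?E = mat 1" "?E ** ?D = mat 1"
      using a by (simp_all add: vec_eq_iff diag_mult) (simp_all add: diag_def mat_def)
    have "P ** (mat 1 + R ** X ** P) ** R = mat 1 + X" for X
    proof -
      have "P ** (mat 1 + R ** X ** P) ** R = P ** R + (P ** R) ** X ** (P ** R)"
        by (simp add: matrix_add_ldistrib matrix_add_mult matrix_mul_assoc)
      then show ?thesis by (simp add: PR)
    qed
    then have unconj: "(\<lambda>B. P ** B ** R) ` (\<lambda>X. mat 1 + X) ` triangular h (CARD('n)) = (\<lambda>X. mat 1 + X) ` W"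
      unfolding conj[symmetric] conjugate_def image_image by simp
    \<comment> \<open>From the inside outwards: \<open>?E\<close> exchanges the form
      \<open>f\<close> for the forms \<open>h\<close>, conjugation leads to the translate of
      \<open>W\<close>, and \<open>A\<close> leads to \<open>T\<close>.\<close>
    have "(\<lambda>M. (A ** P ** ?E) ** M ** R) ` S = (\<lambda>B. A ** B) ` (\<lambda>B. P ** B ** R) ` (\<lambda>X. ?E ** (mat 1 + X)) ` ?tri"
      unfolding S_def image_image by (simp only: matrix_mul_assoc)
    also have "\<dots> = T" unfolding diag unconj unfolding TW image_image ..
    finally have "T = (\<lambda>M. (A ** P ** ?E) ** M ** R) ` S" ..
    moreover have "invertible R" using PR unfolding invertible_def by blast
    moreover have "invertible (A ** P ** ?E)"
      unfolding invertible_def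
    proof (intro exI conjI)
      have "A ** P ** ?E ** (?D ** R ** B) = A ** (P ** (?E ** ?D) ** R) ** B" by (simp only: matrix_mul_assoc)
      then show "A ** P ** ?E ** (?D ** R ** B) = mat 1" by (simp add: DE PR AB)
      have "?D ** R ** B ** (A ** P ** ?E) = ?D ** (R ** (B ** A) ** P) ** ?E" by (simp only: matrix_mul_assoc)
      then show "?D ** R ** B ** (A ** P ** ?E) = mat 1" by (simp add: DE PR AB)
    qed
    ultimately show ?thesis unfolding equivalent_mat_sets_def by blast
  qed
  ultimately show ?thesis by blast
qed

end

theorem theorem7p2:
  fixes \<iota> :: "'f::field \<Rightarrow> 'd::division_ring"
    and d :: nat
  assumes "central_subfield \<iota>"
    and "\<exists>B. finite_dimensional_vector_space (scale_ring \<iota>) B"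
    and "d = vector_space.dim (scale_ring \<iota>) (UNIV :: 'd set)"
    and "\<not> quadratic_type \<iota>"
    and "finite (UNIV :: 'f set) \<longrightarrow> CARD('n::finite) * d \<le> card (UNIV :: 'f set)"
  shows "\<exists>S :: ('d^'n^'n) set. optimal_unital_affine \<iota> S \<and>
           (\<forall>T :: ('d^'n^'n) set. optimal_unital_affine \<iota> T \<longrightarrow> equivalent_mat_sets S T)"
proof -
  interpret central_algebra \<iota> using assms(1,2) by unfold_locales
  show ?thesis by (rule unique_optimal_unital_affine[OF assms(4) assms(5)[unfolded assms(3)]])
qed

end
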